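(* Let $X$ be a Čech-complete space, let $(M,d)$ be a separable metric space, and let $G\subseteq C(X,M)$ be such that $\overline{G}^{M^X}$ is compact. Consider the following three properties: (a) $G$ is almost equicontinuous. (b) There exists a dense Baire subset $F\subseteq X$ such that $(\overline{G}^{M^X})|_F$ is metrizable. (c) There exists a dense $G_\delta$ subset $F\subseteq X$ such that $(F,t_p(\overline{G}^{M^X}))$ is Lindel\"of. Then (b) implies (c), and (c) implies (a). If $X$ is also a hereditarily Lindel\"of space, then all three conditions are equivalent.
   Context: $C(X,M)$ is the set of continuous functions from $X$ to $M$. A Čech-complete space is a completely regular Hausdorff space that is a $G_\delta$-subset of its Stone-Čech compactification. $\overline{G}^{M^X}$ is the closure of $G$ in the Tychonoff product $M^X$ (topology of pointwise convergence on $X$), and is given the subspace topology. For a set $H$ of functions from $X$ to $M$ and $F\subseteq X$, $H|_F=\{h|_F:h\in H\}\subseteq M^F$, with the topology of pointwise convergence on $F$. $(F,t_p(\overline{G}^{M^X}))$ is the set $F$ with the weak (initial) topology generated by the functions in $\overline{G}^{M^X}|_F$. A Baire subset of $X$ is a subset that is a Baire space in the subspace topology. A point $x\in X$ is an equicontinuity point of $G$ if for every $\epsilon>0$ there is a neighborhood $U$ of $x$ such that $\mathrm{diam}(g(U))<\epsilon$ for all $g\in G$. $G$ is almost equicontinuous if its set of equicontinuity points is dense in $X$. *)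

theory Defs
  imports "HOL-Analysis.Analysis"
begin

definition dense_in :: "'a topology \<Rightarrow> 'a set \<Rightarrow> bool" where
  "dense_in X S \<longleftrightarrow> S \<subseteq> topspace X \<and> X closure_of S = topspace X"

text \<open>The intersection with the carrier only matters for the empty family.\<close>

definition Baire_space :: "'a topology \<Rightarrow> bool" where
  "Baire_space X \<longleftrightarrow>
     (\<forall>\<U>. countable \<U> \<and> (\<forall>U\<in>\<U>. openin X U \<and> dense_in X U)
        \<longrightarrow> dense_in X (topspace X \<inter> \<Inter>\<U>))"

text \<open>
  Functions on a carrier set are represented by their extensional versions, as in
  \<^const>\<open>product_topology\<close>, so that each map on the space is represented exactly once.
\<close>

definition continuous_functions :: "'a topology \<Rightarrow> 'b topology \<Rightarrow> ('a \<Rightarrow> 'b) set" where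
  "continuous_functions X Y = {f \<in> extensional (topspace X). continuous_map X Y f}"

text \<open>
  The Stone-Cech compactification is the closure of the image of the evaluation map in the
  cube whose factors are indexed by the continuous maps into the unit interval.
\<close>

definition unit_functions :: "'a topology \<Rightarrow> ('a \<Rightarrow> real) set" where
  "unit_functions X = continuous_functions X (top_of_set {0..1})"

definition Stone_Cech_eval :: "'a topology \<Rightarrow> 'a \<Rightarrow> ('a \<Rightarrow> real) \<Rightarrow> real" where
  "Stone_Cech_eval X x = (\<lambda>f\<in>unit_functions X. f x)"

definition Stone_Cech :: "'a topology \<Rightarrow> (('a \<Rightarrow> real) \<Rightarrow> real) topology" where
  "Stone_Cech X =
     (let cube = product_topology (\<lambda>_. top_of_set {0..1}) (unit_functions X)
      in subtopology cube (cube closure_of (Stone_Cech_eval X ` topspace X)))"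

definition Cech_complete_space :: "'a topology \<Rightarrow> bool" where
  "Cech_complete_space X \<longleftrightarrow>
     completely_regular_space X \<and> Hausdorff_space X \<and>
     gdelta_in (Stone_Cech X) (Stone_Cech_eval X ` topspace X)"

abbreviation pointwise_topology :: "'a set \<Rightarrow> 'b metric \<Rightarrow> ('a \<Rightarrow> 'b) topology" where
  "pointwise_topology S M \<equiv> product_topology (\<lambda>_. mtopology_of M) S"

definition pointwise_closure :: "'a topology \<Rightarrow> 'b metric \<Rightarrow> ('a \<Rightarrow> 'b) set \<Rightarrow> ('a \<Rightarrow> 'b) set" where
  "pointwise_closure X M G = pointwise_topology (topspace X) M closure_of G"

definition restrict_functions :: "('a \<Rightarrow> 'b) set \<Rightarrow> 'a set \<Rightarrow> ('a \<Rightarrow> 'b) set" where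
  "restrict_functions H F = (\<lambda>h. restrict h F) ` H"

text \<open>
  The set \<open>F\<close> is added to the subbase so that the carrier is \<open>F\<close> even if \<open>H\<close> is empty.
\<close>

definition weak_topology :: "'a set \<Rightarrow> ('a \<Rightarrow> 'b) set \<Rightarrow> 'b topology \<Rightarrow> 'a topology" where
  "weak_topology F H Y =
     topology_generated_by (insert F {{x \<in> F. f x \<in> U} | f U. f \<in> H \<and> openin Y U})"

text \<open>
  The diameter takes values in the extended nonnegative reals: it is infinite on unbounded sets
  and zero on the empty set.
\<close>

definition mdiameter :: "'b metric \<Rightarrow> 'b set \<Rightarrow> ennreal" where
  "mdiameter M S = (SUP (x, y)\<in>S \<times> S. ennreal (mdist M x y))"

definition equicontinuity_point ::
  "'a topology \<Rightarrow> 'b metric \<Rightarrow> ('a \<Rightarrow> 'b) set \<Rightarrow> 'a \<Rightarrow> bool" where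
  "equicontinuity_point X M G x \<longleftrightarrow>
     x \<in> topspace X \<and>
     (\<forall>\<epsilon>>0. \<exists>U. openin X U \<and> x \<in> U \<and> (\<forall>g\<in>G. mdiameter M (g ` U) < ennreal \<epsilon>))"

definition almost_equicontinuous :: "'a topology \<Rightarrow> 'b metric \<Rightarrow> ('a \<Rightarrow> 'b) set \<Rightarrow> bool" where
  "almost_equicontinuous X M G \<longleftrightarrow> dense_in X {x. equicontinuity_point X M G x}"

definition metrizable_on_dense_Baire ::
  "'a topology \<Rightarrow> 'b metric \<Rightarrow> ('a \<Rightarrow> 'b) set \<Rightarrow> bool" where
  "metrizable_on_dense_Baire X M G \<longleftrightarrow>
     (\<exists>F. dense_in X F \<and> Baire_space (subtopology X F) \<and>
        metrizable_space (subtopology (pointwise_topology F M)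
          (restrict_functions (pointwise_closure X M G) F)))"

definition Lindelof_on_dense_gdelta ::
  "'a topology \<Rightarrow> 'b metric \<Rightarrow> ('a \<Rightarrow> 'b) set \<Rightarrow> bool" where
  "Lindelof_on_dense_gdelta X M G \<longleftrightarrow>
     (\<exists>F. dense_in X F \<and> gdelta_in X F \<and>
        Lindelof_space (weak_topology F
          (restrict_functions (pointwise_closure X M G) F) (mtopology_of M)))"

end

theory Submission
  imports Defs "HOL-Probability.Probability"
begin

text \<open>
  Write \<open>K\<close> for the pointwise closure of \<open>G\<close> and \<open>E\<close> for the set of equicontinuity points, a
  $G_\delta$ set. Everything rests on the pseudometric of uniform convergence on \<open>G\<close>, which is the same
  for \<open>K\<close>. If \<open>E\<close> is dense and separable for it, then \<open>K\<close> restricted to \<open>E\<close> embeds into a countable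
  power of \<open>M\<close>, and the weak topology on \<open>E\<close> is Lindelof. A hereditarily Lindelof space makes \<open>E\<close>
  separable because the pseudometric is continuous at the points of \<open>E\<close>; and (b) makes \<open>F\<close>
  separable, since evaluations are continuous functions on a compact metrizable space, after which the
  Baire property of \<open>F\<close> turns a countable cover by small closed sets into density of \<open>E\<close>.

  For (c) implies (a), suppose that every open subset of some open set is split by a member of \<open>G\<close>. A
  Cantor scheme then yields a copy \<open>c\<close> of the Cantor space in \<open>F\<close> and countably many real functions
  \<open>f i\<close> that are continuous along \<open>c\<close>, uniformly separate the points \<open>c \<omega>\<close>, and have all their
  pointwise limits continuous for the weak topology. Consider the fair coin measure. If the \<open>f i \<circ> c\<close>
  are not relatively compact in $L^1$, some of them oscillate on every subset of a set of positive
  measure, so they contain an independent sequence; its limits along ultrafilters, tested on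
  an uncountable independent family of subsets of the integers, produce an uncountable set without
  condensation points, which a Lindelof space excludes. If they are relatively compact, each point all of
  whose weak neighbourhoods have positive outer measure defines a function of \<open>i\<close> that is uniformly
  continuous in the $L^1$ metric. Up to a small error there are only countably many such
  points, and they have weak neighbourhoods of arbitrarily small measure. The remaining points have null
  neighbourhoods, so a countable subcover gives the Cantor space measure less than one.
\<close>

section \<open>Subfilters along which functions converge\<close>

text \<open>Subfilters play the role of subnets. Without a cluster point, finitely many open sets
  that \<open>f\<close> eventually avoids would cover \<open>K\<close>. A cluster point
  \<open>h\<close> becomes a limit once \<open>G\<close> is met with the pullback of the
  neighbourhood filter of \<open>h\<close>.\<close>

lemma compactin_subfilter:
  assumes K: "compactin Z K" and ne: "G \<noteq> bot" and f: "\<And>i. f i \<in> K"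
  shows "\<exists>G' h. G' \<le> G \<and> G' \<noteq> bot \<and> h \<in> K \<and> limitin Z f h G'"
proof -
  have "\<exists>h\<in>K. \<forall>U. openin Z U \<and> h \<in> U \<longrightarrow> (\<exists>\<^sub>F i in G. f i \<in> U)"
  proof (rule ccontr)
    assume "\<not> ?thesis"
    then obtain U where U: "\<And>h. h \<in> K \<Longrightarrow> openin Z (U h) \<and> h \<in> U h \<and> (\<forall>\<^sub>F i in G. f i \<notin> U h)"
      by (simp add: not_frequently) metis
    then obtain \<F> where \<F>: "finite \<F>" "\<F> \<subseteq> U ` K" "K \<subseteq> \<Union>\<F>"
      using K unfolding compactin_def by (metis (no_types, lifting) UN_I imageE subsetI)
    then have "\<forall>\<^sub>F i in G. \<forall>V\<in>\<F>. f i \<notin> V"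
      using U by (intro eventually_ball_finite) auto
    then have "\<forall>\<^sub>F i in G. False"
      by (rule eventually_mono) (use f \<F>(3) in blast)
    with ne show False by simp
  qed
  then obtain h where h: "h \<in> K" and freq: "\<And>U. openin Z U \<Longrightarrow> h \<in> U \<Longrightarrow> \<exists>\<^sub>F i in G. f i \<in> U"
    by blast
  have hZ: "h \<in> topspace Z" using K h compactin_subset_topspace by blast
  let ?G = "inf G (filtercomap f (nhdsin Z h))"
  show ?thesis
  proof (intro exI conjI)
    show "?G \<le> G" by simp
    show "?G \<noteq> bot"
    proof
      assume "?G = bot"
      then have "eventually (\<lambda>_. False) ?G" by simp
      then obtain Q S where Q: "eventually Q G" and S: "openin Z S" "h \<in> S"
        and QS: "\<And>i. Q i \<Longrightarrow> f i \<in> S \<Longrightarrow> False"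
        using hZ unfolding eventually_inf eventually_filtercomap eventually_nhdsin by blast
      have "\<forall>\<^sub>F i in G. f i \<notin> S"
        using Q by (rule eventually_mono) (use QS in blast)
      then show False using freq[OF S] by (simp add: frequently_def)
    qed
    show "h \<in> K" by fact
    show "limitin Z f h ?G"
      unfolding limitin_def
    proof (intro conjI allI impI hZ)
      fix U assume "openin Z U \<and> h \<in> U"
      then have "eventually (\<lambda>x. x \<in> U) (nhdsin Z h)"
        using hZ by (auto simp: eventually_nhdsin)
      then have "eventually (\<lambda>i. f i \<in> U) (filtercomap f (nhdsin Z h))"
        by (rule eventually_filtercomapI)
      then show "eventually (\<lambda>i. f i \<in> U) ?G"
        by (rule filter_leD[rotated]) simp
    qed
  qed
qed

text \<open>Tychonoff's theorem for the cube over \<open>S\<close>. Filters are needed because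
  \<open>S\<close> may be uncountable, so that sequences need not have pointwise convergent
  subsequences.\<close>

lemma pointwise_subfilter:
  fixes f :: "'i \<Rightarrow> 'a \<Rightarrow> real"
  assumes ne: "G \<noteq> bot" and f: "\<And>i x. x \<in> S \<Longrightarrow> f i x \<in> {0..1}"
  shows "\<exists>G' \<phi>. G' \<le> G \<and> G' \<noteq> bot \<and> (\<forall>x\<in>S. \<phi> x \<in> {0..1}) \<and>
    (\<forall>x\<in>S. ((\<lambda>i. f i x) \<longlongrightarrow> \<phi> x) G')"
proof -
  let ?Z = "product_topology (\<lambda>_. top_of_set {0..1::real}) S"
  have "compact_space ?Z"
    by (simp add: compact_space_product_topology compact_space_subtopology)
  then have "compactin ?Z (topspace ?Z)" by (simp add: compact_space_def)
  moreover have "(\<lambda>x\<in>S. f i x) \<in> topspace ?Z" for i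
    using f by auto
  ultimately obtain G' \<phi> where G': "G' \<le> G" "G' \<noteq> bot" "\<phi> \<in> topspace ?Z"
    "limitin ?Z (\<lambda>i. \<lambda>x\<in>S. f i x) \<phi> G'"
    using compactin_subfilter[OF _ ne] by metis
  have "((\<lambda>i. f i x) \<longlongrightarrow> \<phi> x) G'" if "x \<in> S" for x
    using G'(4) that by (auto simp: limitin_componentwise limitin_subtopology)
  moreover have "\<phi> x \<in> {0..1}" if "x \<in> S" for x
    using G'(3) that by auto
  ultimately show ?thesis using G' by blast
qed

section \<open>Oscillation and compactness in $L^1$\<close>

text \<open>Weak-star compactness of the functions with values in the unit interval. Along a
  subfilter the integrals over all measurable sets converge together; the limiting set function is a
  measure dominated by \<open>M\<close>, and \<open>w\<close> is its Radon-Nikodym density.\<close>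

lemma (in prob_space) weak_limit_subfilter:
  fixes u :: "'i \<Rightarrow> 'a \<Rightarrow> real"
  assumes [measurable]: "\<And>i. u i \<in> borel_measurable M" and u: "\<And>i x. u i x \<in> {0..1}"
    and ne: "G \<noteq> bot"
  shows "\<exists>G' w. G' \<le> G \<and> G' \<noteq> bot \<and> w \<in> borel_measurable M \<and> (\<forall>x. w x \<in> {0..1}) \<and>
    (\<forall>E\<in>sets M.
      ((\<lambda>i. \<integral>x. u i x * indicator E x \<partial>M) \<longlongrightarrow> (\<integral>x. w x * indicator E x \<partial>M)) G')"
proof -
  have int: "integrable M (\<lambda>x. u i x * indicator E x)" if "E \<in> sets M" for i E
    by (rule integrable_const_bound[where B=1])
      (use u that in \<open>auto simp: indicator_def intro!: AE_I2\<close>)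
  have le: "(\<integral>x. u i x * indicator E x \<partial>M) \<le> prob E" if E: "E \<in> sets M" for i E
  proof -
    have "(\<integral>x. u i x * indicator E x \<partial>M) \<le> (\<integral>x. indicator E x \<partial>M)"
    proof (rule integral_mono[OF int[OF E]])
      show "integrable M (indicator E :: 'a \<Rightarrow> real)"
        using E by (simp add: emeasure_eq_measure)
      show "u i x * indicator E x \<le> indicator E x" for x
        using u by (auto simp: indicator_def)
    qed
    then show ?thesis using E by simp
  qed
  have nonneg: "0 \<le> (\<integral>x. u i x * indicator E x \<partial>M)" for i E
    by (intro integral_nonneg_AE AE_I2) (use u in auto)
  have range: "(\<integral>x. u i x * indicator E x \<partial>M) \<in> {0..1}" if "E \<in> sets M" for i E
    using nonneg[of i E] order_trans[OF le[OF that, of i] prob_le_1] by simp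
  obtain G' l
    where G': "G' \<le> G" "G' \<noteq> bot" and l: "\<And>E. E \<in> sets M \<Longrightarrow> l E \<in> {0..1::real}"
      "\<And>E. E \<in> sets M \<Longrightarrow> ((\<lambda>i. \<integral>x. u i x * indicator E x \<partial>M) \<longlongrightarrow> l E) G'"
    using pointwise_subfilter[of G "sets M" "\<lambda>i E. \<integral>x. u i x * indicator E x \<partial>M", OF ne range]
    by blast
  have l_le: "l E \<le> prob E" if "E \<in> sets M" for E
    using tendsto_upperbound[OF l(2)[OF that] _ G'(2)] le[OF that] by simp
  have l_add: "l (A \<union> B) = l A + l B" if AB: "A \<in> sets M" "B \<in> sets M" "A \<inter> B = {}" for A B
  proof -
    have "(\<integral>x. u i x * indicator (A \<union> B) x \<partial>M) =
        (\<integral>x. u i x * indicator A x \<partial>M) + (\<integral>x. u i x * indicator B x \<partial>M)" for i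
      using AB by (subst Bochner_Integration.integral_add[OF int int, symmetric])
        (auto intro!: Bochner_Integration.integral_cong simp: indicator_def)
    then have "((\<lambda>i. \<integral>x. u i x * indicator (A \<union> B) x \<partial>M) \<longlongrightarrow> l A + l B) G'"
      using tendsto_add[OF l(2)[OF AB(1)] l(2)[OF AB(2)]] by simp
    then show ?thesis
      by (rule tendsto_unique[OF G'(2) l(2)[OF sets.Un[OF AB(1,2)]]])
  qed
  define N where "N = measure_of (space M) (sets M) (\<lambda>E. ennreal (l E))"
  have l0: "l {} = 0" using l_le[of "{}"] l(1)[of "{}"] by simp
  have sets_N: "sets N = sets M" by (simp add: N_def sets.sets_measure_of_eq)
  \<comment> \<open>Finite additivity survives the limit. Countable additivity then only requires
    continuity at the empty set, which \<open>l_le\<close> transfers from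
    \<open>prob\<close>.\<close>
  have "countably_additive (sets M) (\<lambda>E. ennreal (l E))"
  proof (rule sets.empty_continuous_imp_countably_additive)
    show "positive (sets M) (\<lambda>E. ennreal (l E))" by (simp add: positive_def l0)
    show "additive (sets M) (\<lambda>E. ennreal (l E))"
      using l(1) by (auto simp: additive_def l_add ennreal_plus[symmetric] simp del: ennreal_plus)
    show "\<forall>A\<in>sets M. ennreal (l A) \<noteq> \<infinity>" by simp
    fix A :: "nat \<Rightarrow> 'a set" assume A: "range A \<subseteq> sets M" "decseq A" "(\<Inter>i. A i) = {}"
    have "(\<lambda>i. prob (A i)) \<longlonglongrightarrow> prob (\<Inter>i. A i)"
      by (rule finite_Lim_measure_decseq[OF A(1,2)])
    then have "(\<lambda>i. prob (A i)) \<longlonglongrightarrow> 0" using A(3) by simp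
    then have "(\<lambda>i. l (A i)) \<longlonglongrightarrow> 0"
      by (intro tendsto_sandwich[of "\<lambda>_. 0" "\<lambda>i. l (A i)" _ "\<lambda>i. prob (A i)"] tendsto_const always_eventually allI)
        (use A(1) l(1) l_le in \<open>auto simp: image_subset_iff\<close>)
    then show "(\<lambda>i. ennreal (l (A i))) \<longlonglongrightarrow> 0"
      using tendsto_ennrealI ennreal_0 by metis
  qed
  then have emeasure_N: "emeasure N E = ennreal (l E)" if "E \<in> sets M" for E
    unfolding N_def using that
    by (intro emeasure_measure_of_sigma) (auto simp: positive_def l0 sets.sigma_algebra_axioms)
  have "absolutely_continuous M N"
    unfolding absolutely_continuous_def
  proof
    fix E assume "E \<in> null_sets M"
    then have "E \<in> sets M" "prob E = 0" by (auto simp: null_sets_def measure_def)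
    then show "E \<in> null_sets N"
      using l_le[of E] by (auto simp: null_sets_def sets_N emeasure_N ennreal_eq_0_iff)
  qed
  from Radon_Nikodym[OF this sets_N] obtain f
    where f[measurable]: "f \<in> borel_measurable M" and fN: "density M f = N" by blast
  have f_int: "(\<integral>\<^sup>+x. f x * indicator E x \<partial>M) = ennreal (l E)" if "E \<in> sets M" for E
    using emeasure_density[OF f that] fN emeasure_N[OF that] by simp
  \<comment> \<open>On the set where \<open>f\<close> exceeds 1 its integral is at most the measure
    of that set, so the excess \<open>f x - 1\<close> integrates to zero there.\<close>
  have f_le: "AE x in M. f x \<le> 1"
  proof -
    let ?E = "{x\<in>space M. 1 < f x}"
    have E[measurable]: "?E \<in> sets M" by measurable
    have "(\<integral>\<^sup>+x. (f x - 1) * indicator ?E x \<partial>M) + emeasure M ?E =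
        (\<integral>\<^sup>+x. (f x - 1) * indicator ?E x + indicator ?E x \<partial>M)"
      by (subst nn_integral_add) auto
    also have "\<dots> = (\<integral>\<^sup>+x. f x * indicator ?E x \<partial>M)"
      by (intro nn_integral_cong) (auto simp: indicator_def diff_add_cancel_ennreal)
    also have "\<dots> \<le> emeasure M ?E"
      using f_int[OF E] l_le[OF E] by (simp add: emeasure_eq_measure ennreal_leI)
    finally have "(\<integral>\<^sup>+x. (f x - 1) * indicator ?E x \<partial>M) + emeasure M ?E \<le> 0 + emeasure M ?E"
      by simp
    then have "(\<integral>\<^sup>+x. (f x - 1) * indicator ?E x \<partial>M) = 0"
      by (simp add: emeasure_eq_measure ennreal_add_left_cancel_le add.commute)
    then have "AE x in M. (f x - 1) * indicator ?E x = 0"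
      by (subst (asm) nn_integral_0_iff_AE) auto
    then show ?thesis
      by (rule AE_mp, intro AE_I2)
        (auto simp: indicator_def diff_eq_0_iff_ennreal not_less split: if_splits)
  qed
  \<comment> \<open>Truncation turns the almost everywhere bound into a bound at every point and
    changes no integral.\<close>
  define w where "w x = min 1 (enn2real (f x))" for x
  have w[measurable]: "w \<in> borel_measurable M" unfolding w_def by measurable
  have w01: "w x \<in> {0..1}" for x by (simp add: w_def)
  have "(\<integral>x. w x * indicator E x \<partial>M) = l E" if E: "E \<in> sets M" for E
  proof -
    have "(\<integral>x. w x * indicator E x \<partial>M) = enn2real (\<integral>\<^sup>+x. ennreal (w x * indicator E x) \<partial>M)"
      using E w01 by (intro integral_eq_nn_integral) auto
    also have "(\<integral>\<^sup>+x. ennreal (w x * indicator E x) \<partial>M) = (\<integral>\<^sup>+x. f x * indicator E x \<partial>M)"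
    proof (intro nn_integral_cong_AE, use f_le in eventually_elim)
      fix x assume "f x \<le> 1"
      moreover from this obtain r where "f x = ennreal r" "r \<ge> 0"
        by (metis ennreal_cases ennreal_one_less_top infinity_ennreal_def leD)
      ultimately show "ennreal (w x * indicator E x) = f x * indicator E x"
        by (auto simp: w_def indicator_def min_def)
    qed
    also have "enn2real \<dots> = l E" using l(1)[OF E] f_int[OF E] by simp
    finally show ?thesis .
  qed
  then show ?thesis using G' w w01 l(2) by (intro exI[of _ G'] exI[of _ w]) simp
qed

text \<open>If \<open>w\<close> is a weak limit of the \<open>u i\<close> and the weak limit \<open>v\<close> of the \<open>\<bar>u i - w\<bar>\<close> does not vanish
  almost everywhere, then near a level of \<open>w\<close> the \<open>u i\<close> must deviate to both sides, because the mean
  of \<open>u i - w\<close> tends to zero.\<close>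

lemma (in prob_space) L1_limit_or_oscillation:
  fixes u :: "'i \<Rightarrow> 'a \<Rightarrow> real"
  assumes meas[measurable]: "\<And>i. u i \<in> borel_measurable M" and u: "\<And>i x. u i x \<in> {0..1}"
    and ne: "G \<noteq> bot"
  shows "(\<exists>G' w. G' \<le> G \<and> G' \<noteq> bot \<and> w \<in> borel_measurable M \<and> (\<forall>x. w x \<in> {0..1}) \<and>
      ((\<lambda>i. \<integral>x. \<bar>u i x - w x\<bar> \<partial>M) \<longlongrightarrow> 0) G') \<or>
    (\<exists>G' a b D. G' \<noteq> bot \<and> a < b \<and> D \<in> sets M \<and> prob D > 0 \<and>
      (\<forall>E\<in>sets M. E \<subseteq> D \<longrightarrow> prob E > 0 \<longrightarrow>
        (\<forall>\<^sub>F i in G'. prob {x\<in>E. u i x < a} > 0 \<and> prob {x\<in>E. u i x > b} > 0)))"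
    (is "?limit \<or> ?osc")
proof -
  obtain G1 w where G1: "G1 \<le> G" "G1 \<noteq> bot" and w[measurable]: "w \<in> borel_measurable M"
    and w01: "\<And>x. w x \<in> {0..1}"
    and lim_u: "\<And>E. E \<in> sets M \<Longrightarrow>
      ((\<lambda>i. \<integral>x. u i x * indicator E x \<partial>M) \<longlongrightarrow> (\<integral>x. w x * indicator E x \<partial>M)) G1"
    using weak_limit_subfilter[of u G, OF meas u ne] by blast
  have diff01: "\<bar>u i x - w x\<bar> \<in> {0..1}" for i x
    using u[of i x] w01[of x] by (auto simp: abs_if)
  obtain G2 v where G2: "G2 \<le> G1" "G2 \<noteq> bot" and v[measurable]: "v \<in> borel_measurable M"
    and v01: "\<And>x. v x \<in> {0..1}"
    and lim_v: "\<And>E. E \<in> sets M \<Longrightarrow>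
      ((\<lambda>i. \<integral>x. \<bar>u i x - w x\<bar> * indicator E x \<partial>M) \<longlongrightarrow> (\<integral>x. v x * indicator E x \<partial>M)) G2"
    using weak_limit_subfilter[of "\<lambda>i x. \<bar>u i x - w x\<bar>" G1, OF _ diff01 G1(2)] meas w by auto
  have int01: "integrable M (\<lambda>x. f x * indicator E x)"
    if "f \<in> borel_measurable M" "\<And>x. \<bar>f x\<bar> \<le> 1" "E \<in> sets M" for f :: "'a \<Rightarrow> real" and E
    by (rule integrable_const_bound[where B=1])
      (use that in \<open>auto simp: indicator_def intro!: AE_I2\<close>)
  have u1: "\<bar>u i x\<bar> \<le> 1" and w1: "\<bar>w x\<bar> \<le> 1" and v1: "\<bar>v x\<bar> \<le> 1"
    and d1: "\<bar>\<bar>u i x - w x\<bar>\<bar> \<le> 1" "\<bar>u i x - w x\<bar> \<le> 1" for i x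
    using u[of i x] w01[of x] v01[of x] diff01[of i x] by auto
  show ?thesis
  proof (cases "\<exists>t>0. prob {x\<in>space M. v x > t} > 0")
    case False
    then have "prob {x\<in>space M. v x > 1 / Suc n} = 0" for n
      using measure_nonneg[of M "{x\<in>space M. v x > 1 / Suc n}"]
      by (metis less_eq_real_def of_nat_0_less_iff zero_less_Suc zero_less_divide_1_iff)
    then have "AE x in M. \<not> v x > 1 / Suc n" for n
      by (subst AE_iff_measurable[OF _ refl]) (auto simp: emeasure_eq_measure)
    then have "AE x in M. \<forall>n. \<not> v x > 1 / Suc n" by (simp add: AE_all_countable)
    then have "AE x in M. v x * indicator (space M) x = 0"
    proof (rule AE_mp, intro AE_I2 impI)
      fix x assume *: "\<forall>n. \<not> v x > 1 / Suc n"
      have "v x \<le> 0"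
      proof (rule ccontr)
        assume "\<not> v x \<le> 0"
        then obtain n where "inverse (of_nat (Suc n)) < v x"
          using reals_Archimedean[of "v x"] by auto
        with * show False by (simp add: inverse_eq_divide)
      qed
      then show "v x * indicator (space M) x = 0" using v01[of x] by simp
    qed
    then have "(\<integral>x. v x * indicator (space M) x \<partial>M) = 0"
      by (rule integral_eq_zero_AE)
    with lim_v[of "space M"]
    have "((\<lambda>i. \<integral>x. \<bar>u i x - w x\<bar> * indicator (space M) x \<partial>M) \<longlongrightarrow> 0) G2" by simp
    moreover have "(\<integral>x. \<bar>u i x - w x\<bar> * indicator (space M) x \<partial>M) = (\<integral>x. \<bar>u i x - w x\<bar> \<partial>M)" for i
      by (intro Bochner_Integration.integral_cong) auto
    ultimately have ?limit
      using G1 G2 w w01 by (intro exI[of _ G2] exI[of _ w]) auto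
    then show ?thesis ..
  next
    case True
    then obtain t where t: "t > 0" and pos: "prob {x\<in>space M. v x > t} > 0" by blast
    \<comment> \<open>With this width, the upper bound
      \<open>2 * k * prob E + t * prob E / 4\<close> reached below for the integral of the absolute
      deviation over \<open>E\<close> equals its lower bound \<open>t * prob E / 2\<close>.\<close>
    define k where "k = t / 8"
    have k: "k > 0" using t by (simp add: k_def)
    \<comment> \<open>Each slice fixes \<open>w\<close> up to \<open>k\<close>. Countably many
      slices cover the set where \<open>v\<close> exceeds \<open>t\<close>, so one of them has
      positive measure.\<close>
    define Dn where "Dn n = {x\<in>space M. v x > t \<and> real n * k \<le> w x \<and> w x < real n * k + k}" for n :: nat
    have Dn[measurable]: "Dn n \<in> sets M" for n unfolding Dn_def by measurable
    have "\<exists>n. prob (Dn n) > 0"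
    proof (rule ccontr)
      assume "\<nexists>n. prob (Dn n) > 0"
      then have "prob (Dn n) = 0" for n
        by (metis measure_nonneg less_eq_real_def)
      then have "(\<Union>n. Dn n) \<in> null_sets M"
        by (intro null_sets_UN) (auto simp: null_sets_def emeasure_eq_measure)
      moreover have "{x\<in>space M. v x > t} \<subseteq> (\<Union>n. Dn n)"
      proof
        fix x assume x: "x \<in> {x\<in>space M. v x > t}"
        let ?n = "nat \<lfloor>w x / k\<rfloor>"
        have "0 \<le> w x / k" using k w01[of x] by simp
        then have "real ?n \<le> w x / k" "w x / k < real ?n + 1" by linarith+
        then have "real ?n * k \<le> w x" "w x < real ?n * k + k"
          using k by (auto simp: field_simps)
        with x show "x \<in> (\<Union>n. Dn n)" by (auto simp: Dn_def)
      qed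
      ultimately have "{x\<in>space M. v x > t} \<in> null_sets M"
        by (intro null_sets_subset[of "\<Union>n. Dn n" M "{x\<in>space M. v x > t}"]) auto
      then show False using pos by (simp add: null_sets_def emeasure_eq_measure)
    qed
    then obtain n where n: "prob (Dn n) > 0" by blast
    let ?a = "real n * k" and ?b = "real n * k + k"
    have "\<forall>\<^sub>F i in G2. prob {x\<in>E. u i x < ?a} > 0 \<and> prob {x\<in>E. u i x > ?b} > 0"
      if E[measurable]: "E \<in> sets M" and ED: "E \<subseteq> Dn n" and Epos: "prob E > 0" for E
    proof -
      have intE: "integrable M (indicator E :: 'a \<Rightarrow> real)" by (simp add: emeasure_eq_measure)
      have ge: "t * prob E \<le> (\<integral>x. v x * indicator E x \<partial>M)"
      proof -
        have "t * prob E = (\<integral>x. t * indicator E x \<partial>M)" using E by simp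
        also have "\<dots> \<le> (\<integral>x. v x * indicator E x \<partial>M)"
        proof (rule integral_mono)
          show "integrable M (\<lambda>x. t * indicator E x)" using intE by simp
          show "integrable M (\<lambda>x. v x * indicator E x)" by (rule int01[OF v v1 E])
        qed (use ED in \<open>auto simp: indicator_def Dn_def\<close>)
        finally show ?thesis .
      qed
      have "\<forall>\<^sub>F i in G2. (\<integral>x. \<bar>u i x - w x\<bar> * indicator E x \<partial>M) > t * prob E / 2"
      proof (rule order_tendstoD(1)[OF lim_v[OF E]])
        have "0 < t * prob E" using t Epos by simp
        then show "t * prob E / 2 < (\<integral>x. v x * indicator E x \<partial>M)" using ge by linarith
      qed
      moreover have "\<forall>\<^sub>F i in G2. \<bar>\<integral>x. (u i x - w x) * indicator E x \<partial>M\<bar> < t * prob E / 4"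
      proof -
        have "((\<lambda>i. (\<integral>x. u i x * indicator E x \<partial>M) - (\<integral>x. w x * indicator E x \<partial>M)) \<longlongrightarrow>
            (\<integral>x. w x * indicator E x \<partial>M) - (\<integral>x. w x * indicator E x \<partial>M)) G2"
          by (intro tendsto_diff tendsto_const tendsto_mono[OF G2(1) lim_u[OF E]])
        moreover have "(\<integral>x. u i x * indicator E x \<partial>M) - (\<integral>x. w x * indicator E x \<partial>M) =
            (\<integral>x. (u i x - w x) * indicator E x \<partial>M)" for i
          by (subst Bochner_Integration.integral_diff[symmetric])
            (auto intro!: int01 u1 w1 simp: left_diff_distrib)
        ultimately have "((\<lambda>i. \<bar>\<integral>x. (u i x - w x) * indicator E x \<partial>M\<bar>) \<longlongrightarrow> \<bar>0\<bar>) G2"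
          by (intro tendsto_rabs) simp
        then show ?thesis
          by (rule order_tendstoD(2)) (use t Epos in simp)
      qed
      ultimately show ?thesis
      proof eventually_elim
        case (elim i)
        have intd: "integrable M (\<lambda>x. (u i x - w x) * indicator E x)"
          "integrable M (\<lambda>x. \<bar>u i x - w x\<bar> * indicator E x)"
          by (intro int01 d1; measurable)+
        \<comment> \<open>If the difference \<open>u i - w\<close>, taken with sign
          \<open>s\<close>, is at most \<open>k\<close>, then its absolute value is at most
          \<open>2 * k\<close> minus the signed difference. The integral of the signed difference is
          small by weak convergence, so the absolute deviation would be too small.\<close>
        have *: "False" if s: "s \<in> {1, -1}" and ae: "AE x in M. x \<in> E \<longrightarrow> s * (u i x - w x) \<le> k" for s
        proof -
          have "(\<integral>x. \<bar>u i x - w x\<bar> * indicator E x \<partial>M)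
              \<le> (\<integral>x. (2 * k) * indicator E x - s * ((u i x - w x) * indicator E x) \<partial>M)"
          proof (rule integral_mono_AE)
            show "AE x in M. \<bar>u i x - w x\<bar> * indicator E x
                \<le> (2 * k) * indicator E x - s * ((u i x - w x) * indicator E x)"
              using ae by eventually_elim (use s k in \<open>auto simp: indicator_def abs_if\<close>)
          qed (use intd intE in auto)
          also have "\<dots> = 2 * k * prob E - s * (\<integral>x. (u i x - w x) * indicator E x \<partial>M)"
            using intd intE by simp
          also have "\<dots> < 2 * k * prob E + t * prob E / 4"
            using elim(2) s by (auto simp: abs_if split: if_splits)
          also have "\<dots> = t * prob E / 2" by (simp add: k_def)
          finally show False using elim(1) by simp
        qed
        have zero: "AE x in M. x \<notin> S" if "S \<in> sets M" "\<not> prob S > 0" for S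
          using that measure_nonneg[of M S]
          by (intro AE_not_in) (auto simp: null_sets_def emeasure_eq_measure)
        \<comment> \<open>On \<open>Dn n\<close> the values of \<open>w\<close> lie between
          \<open>?a\<close> and \<open>?b\<close>. Hence staying above \<open>?a\<close> bounds
          \<open>w - u i\<close> by \<open>k\<close>, and staying below \<open>?b\<close> bounds
          \<open>u i - w\<close> by \<open>k\<close>.\<close>
        have "prob {x\<in>E. u i x < ?a} > 0"
        proof (rule ccontr)
          assume "\<not> ?thesis"
          from zero[OF _ this] have ae: "AE x in M. x \<notin> {x\<in>E. u i x < ?a}" by simp
          show False
            by (rule *[of "-1"], simp, use ae in eventually_elim) (use ED in \<open>auto simp: Dn_def\<close>)
        qed
        moreover have "prob {x\<in>E. u i x > ?b} > 0"
        proof (rule ccontr)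
          assume "\<not> ?thesis"
          from zero[OF _ this] have ae: "AE x in M. x \<notin> {x\<in>E. u i x > ?b}" by simp
          show False
            by (rule *[of 1], simp, use ae in eventually_elim) (use ED in \<open>auto simp: Dn_def\<close>)
        qed
        ultimately show ?case by blast
      qed
    qed
    then have ?osc
      using G2 k n by (intro exI[of _ G2] exI[of _ ?a] exI[of _ ?b] exI[of _ "Dn n"]) auto
    then show ?thesis ..
  qed
qed

text \<open>Indices are chosen one after another while a finite family of pieces of positive measure
  is kept, one for each pattern of choices so far. Finitely many eventual conditions hold at a
  common index, which splits all pieces at once; positive measure makes the final pieces
  nonempty.\<close>

lemma (in prob_space) oscillation_imp_independent:
  fixes u :: "'i \<Rightarrow> 'a \<Rightarrow> real"
  assumes meas[measurable]: "\<And>i. u i \<in> borel_measurable M" and ne: "G \<noteq> bot"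
    and D: "D \<in> sets M" "prob D > 0"
    and osc: "\<And>E. E \<in> sets M \<Longrightarrow> E \<subseteq> D \<Longrightarrow> prob E > 0 \<Longrightarrow>
        \<forall>\<^sub>F i in G. prob {x\<in>E. u i x < a} > 0 \<and> prob {x\<in>E. u i x > b} > 0"
  shows "\<exists>r :: nat \<Rightarrow> 'i. \<forall>s k. \<exists>x. \<forall>j<k. if s j then u (r j) x < a else u (r j) x > b"
proof -
  define P where "P \<A> \<longleftrightarrow> finite \<A> \<and> \<A> \<noteq> {} \<and> (\<forall>E\<in>\<A>. E \<in> sets M \<and> E \<subseteq> D \<and> prob E > 0)" for \<A>
  define nxt where "nxt \<A> i = (\<lambda>E. {x\<in>E. u i x < a}) ` \<A> \<union> (\<lambda>E. {x\<in>E. u i x > b}) ` \<A>" for \<A> i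
  have step: "\<exists>i. P (nxt \<A> i)" if "P \<A>" for \<A>
  proof -
    have "\<forall>\<^sub>F i in G. \<forall>E\<in>\<A>. prob {x\<in>E. u i x < a} > 0 \<and> prob {x\<in>E. u i x > b} > 0"
      using that by (intro eventually_ball_finite) (auto simp: P_def intro!: osc)
    then obtain i where i: "\<forall>E\<in>\<A>. prob {x\<in>E. u i x < a} > 0 \<and> prob {x\<in>E. u i x > b} > 0"
      using eventually_happens'[OF ne] by blast
    have "P (nxt \<A> i)"
      using that i unfolding P_def nxt_def by auto
    then show ?thesis by blast
  qed
  have "\<exists>f. \<forall>n. P (fst (f n)) \<and> fst (f (Suc n)) = nxt (fst (f n)) (snd (f (Suc n)))"
    proof (rule dependent_nat_choice[where P="\<lambda>_ x. P (fst x)"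
          and Q="\<lambda>_ x y. fst y = nxt (fst x) (snd y)"])
      show "\<exists>x. P (fst x)"
        using D by (intro exI[of _ "({D}, undefined)"]) (auto simp: P_def)
      show "\<And>x n. P (fst x) \<Longrightarrow> \<exists>y. P (fst y) \<and> fst y = nxt (fst x) (snd y)"
        using step by (metis fst_conv snd_conv)
    qed
  then obtain f where f: "\<And>n. P (fst (f n))" "\<And>n. fst (f (Suc n)) = nxt (fst (f n)) (snd (f (Suc n)))"
    by blast
  \<comment> \<open>The index that splits the family of stage \<open>n\<close> is stored at stage
    \<open>Suc n\<close>; stage 0 carries only a dummy index.\<close>
  define r where "r n = snd (f (Suc n))" for n
  have "\<exists>E\<in>fst (f k). \<forall>x\<in>E. \<forall>j<k. if s j then u (r j) x < a else u (r j) x > b" for s k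
  proof (induction k)
    case 0
    then show ?case using f(1)[of 0] by (auto simp: P_def)
  next
    case (Suc k)
    then obtain E where E: "E \<in> fst (f k)"
      "\<forall>x\<in>E. \<forall>j<k. if s j then u (r j) x < a else u (r j) x > b" by blast
    let ?E = "if s k then {x\<in>E. u (r k) x < a} else {x\<in>E. u (r k) x > b}"
    have "?E \<in> fst (f (Suc k))"
      unfolding f(2) nxt_def r_def[symmetric] using E(1) by auto
    moreover have "\<forall>x\<in>?E. \<forall>j<Suc k. if s j then u (r j) x < a else u (r j) x > b"
      using E(2) by (auto simp: less_Suc_eq split: if_splits)
    ultimately show ?case by blast
  qed
  moreover have "E \<noteq> {}" if "E \<in> fst (f k)" for E k
    using f(1)[of k] that by (auto simp: P_def)
  ultimately have "\<exists>x. \<forall>j<k. if s j then u (r j) x < a else u (r j) x > b" for s k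
    by (metis ex_in_conv)
  then show ?thesis by blast
qed

section \<open>Independent sequences\<close>

lemma uncountable_bool_sequences: "uncountable (UNIV :: (nat \<Rightarrow> bool) set)"
proof
  assume "countable (UNIV :: (nat \<Rightarrow> bool) set)"
  then obtain f :: "nat \<Rightarrow> nat \<Rightarrow> bool" where f: "range f = UNIV"
    by (metis uncountable_def UNIV_not_empty)
  obtain n where "f n = (\<lambda>n. \<not> f n n)"
    by (metis f rangeE UNIV_I)
  then show False by metis
qed

text \<open>The members of the family are indexed by branches of the binary tree and live on the
  countable set of finite sets of nodes.\<close>

lemma independent_family:
  obtains a :: "(nat \<Rightarrow> bool) \<Rightarrow> nat set" where
    "\<And>T T'. finite T \<Longrightarrow> finite T' \<Longrightarrow> T \<inter> T' = {} \<Longrightarrow> (\<Inter>t\<in>T. a t) \<inter> (\<Inter>t\<in>T'. - a t) \<noteq> {}"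
proof -
  define a :: "(nat \<Rightarrow> bool) \<Rightarrow> nat set"
    where "a t = {n. \<exists>k. map t [0..<k] \<in> set (from_nat n :: bool list list)}" for t
  have "(\<Inter>t\<in>T. a t) \<inter> (\<Inter>t\<in>T'. - a t) \<noteq> {}" if T: "finite T" "finite T'" "T \<inter> T' = {}" for T T'
  proof -
    have "\<exists>j. t j \<noteq> t' j" if "t \<in> T" "t' \<in> T'" for t t'
    proof -
      have "t \<noteq> t'" using that T(3) by blast
      then show ?thesis by (simp add: fun_eq_iff)
    qed
    then obtain j where j: "\<And>t t'. t \<in> T \<Longrightarrow> t' \<in> T' \<Longrightarrow> t (j t t') \<noteq> t' (j t t')" by metis
    have "finite ((\<lambda>(t, t'). j t t') ` (T \<times> T'))" using T by simp
    then obtain k where k: "\<And>t t'. t \<in> T \<Longrightarrow> t' \<in> T' \<Longrightarrow> j t t' < k"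
      unfolding finite_nat_set_iff_bounded by fastforce
    \<comment> \<open>The witness is the code of a list of the prefixes of length \<open>k\<close>
      of the members of \<open>T\<close>. At this length every member of \<open>T\<close> already
      differs from every member of \<open>T'\<close>.\<close>
    obtain ds where ds: "set ds = (\<lambda>t. map t [0..<k]) ` T"
      using finite_list[OF finite_imageI[OF T(1)], of "\<lambda>t. map t [0..<k]"] by auto
    have "to_nat ds \<in> (\<Inter>t\<in>T. a t)" using ds by (auto simp: a_def)
    moreover have "to_nat ds \<notin> a t'" if t': "t' \<in> T'" for t'
    proof
      assume "to_nat ds \<in> a t'"
      then obtain k' t where t: "t \<in> T" "map t' [0..<k'] = map t [0..<k]"
        using ds by (auto simp: a_def)
      then have "k' = k" by (metis length_map length_upt minus_nat.diff_0)
      then have "t' (j t t') = t (j t t')"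
        using t k[OF t(1) t'] by (auto simp: map_eq_conv)
      then show False using j[OF t(1) t'] by simp
    qed
    ultimately show ?thesis by blast
  qed
  then show ?thesis using that by blast
qed

lemma fip_filter:
  assumes "\<forall>S. finite S \<longrightarrow> S \<subseteq> \<B> \<longrightarrow> \<Inter>S \<noteq> {}"
  shows "\<exists>G. G \<noteq> bot \<and> (\<forall>B\<in>\<B>. eventually (\<lambda>x. x \<in> B) G)"
proof -
  let ?G = "INF B\<in>\<B>. principal B"
  have "?G \<noteq> bot"
  proof (rule INF_filter_not_bot)
    fix X assume X: "X \<subseteq> \<B>" "finite X"
    show "(INF b\<in>X. principal b) \<noteq> bot"
      using assms[rule_format, OF X(2,1)] X(2) by (simp add: INF_principal_finite principal_eq_bot_iff)
  qed
  moreover have "eventually (\<lambda>x. x \<in> B) ?G" if "B \<in> \<B>" for B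
  proof (rule filter_leD)
    show "?G \<le> principal B" using that by (rule INF_lower)
    show "eventually (\<lambda>x. x \<in> B) (principal B)" by (simp add: eventually_principal)
  qed
  ultimately show ?thesis by blast
qed

text \<open>This says that all pointwise cluster functions of the family are continuous. Filters on
  the index type replace nets; principal filters show that the members \<open>f i\<close> are
  included.\<close>

definition limits_continuous :: "'a topology \<Rightarrow> ('i \<Rightarrow> 'a \<Rightarrow> real) \<Rightarrow> bool" where
  "limits_continuous T f \<longleftrightarrow>
    (\<forall>G \<phi>. G \<noteq> bot \<longrightarrow> (\<forall>x\<in>topspace T. ((\<lambda>i. f i x) \<longlongrightarrow> \<phi> x) G) \<longrightarrow>
      continuous_map T euclideanreal \<phi>)"

lemma limits_continuousD:
  assumes "limits_continuous T f" "G \<noteq> bot" "\<And>x. x \<in> topspace T \<Longrightarrow> ((\<lambda>i. f i x) \<longlongrightarrow> \<phi> x) G"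
    "open U"
  shows "openin T {x \<in> topspace T. \<phi> x \<in> U}"
proof -
  have "continuous_map T euclideanreal \<phi>"
    using assms(1)[unfolded limits_continuous_def, rule_format, OF assms(2)] assms(3) by simp
  from openin_continuous_map_preimage[OF this] show ?thesis
    using assms(4) by simp
qed

text \<open>A countable subcover by the given neighbourhoods writes the index type as a countable
  union of finite sets.\<close>

lemma Lindelof_pointwise_countable:
  fixes x :: "'t \<Rightarrow> 'a"
  assumes T: "Lindelof_space T" and x: "\<And>t. x t \<in> topspace T"
    and nb: "\<And>y. y \<in> topspace T \<Longrightarrow> \<exists>V. openin T V \<and> y \<in> V \<and> finite {t. x t \<in> V}"
  shows "countable (UNIV :: 't set)"
proof -
  obtain V where V: "\<And>y. y \<in> topspace T \<Longrightarrow> openin T (V y) \<and> y \<in> V y \<and> finite {t. x t \<in> V y}"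
    using nb by metis
  then obtain \<V> where \<V>: "countable \<V>" "\<V> \<subseteq> V ` topspace T" "\<Union>\<V> = topspace T"
  proof -
    have "\<Union>(V ` topspace T) = topspace T"
      using V openin_subset by fast
    moreover have "openin T U" if "U \<in> V ` topspace T" for U
      using that V by blast
    ultimately have "\<exists>\<V>. countable \<V> \<and> \<V> \<subseteq> V ` topspace T \<and> \<Union>\<V> = topspace T"
      by (intro Lindelof_spaceD[OF T]) auto
    then show ?thesis using that by blast
  qed
  have "UNIV = (\<Union>V\<in>\<V>. {t. x t \<in> V})" using x \<V>(3) by blast
  moreover have "countable (\<Union>V\<in>\<V>. {t. x t \<in> V})"
    using \<V> V by (intro countable_UN) (auto intro: countable_finite)
  ultimately show ?thesis by simp
qed

text \<open>An independent family of sets \<open>A t\<close>, with uncountably many indices, is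
  realised by points \<open>x t\<close> at which \<open>f j\<close> is low for \<open>j\<close> in
  \<open>A t\<close> and high otherwise. Limits of the \<open>f i\<close> along suitable filters
  separate any given \<open>y\<close> from all but finitely many \<open>x t\<close>, which a
  Lindelof space does not allow.\<close>

lemma independent_not_Lindelof:
  fixes f :: "nat \<Rightarrow> 'a \<Rightarrow> real"
  assumes T: "Lindelof_space T" and lim: "limits_continuous T f"
    and f01: "\<And>i x. x \<in> topspace T \<Longrightarrow> f i x \<in> {0..1}" and ab: "a < b"
    and ind: "\<And>s. \<exists>x\<in>topspace T. \<forall>j. if s j then f j x \<le> a else f j x \<ge> b"
  shows False
proof -
  obtain A :: "(nat \<Rightarrow> bool) \<Rightarrow> nat set" where
    A: "\<And>T T'. finite T \<Longrightarrow> finite T' \<Longrightarrow> T \<inter> T' = {} \<Longrightarrow> (\<Inter>t\<in>T. A t) \<inter> (\<Inter>t\<in>T'. - A t) \<noteq> {}"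
    using independent_family by blast
  obtain x where x: "\<And>t. x t \<in> topspace T" "\<And>t j. if j \<in> A t then f j (x t) \<le> a else f j (x t) \<ge> b"
    using ind[of "\<lambda>j. j \<in> A t" for t] by metis
  have xA: "j \<in> A t \<Longrightarrow> f j (x t) \<le> a" and xB: "j \<in> - A t \<Longrightarrow> f j (x t) \<ge> b" for j t
    using x(2)[where t=t and j=j] by simp_all
  \<comment> \<open>Any family of index sets with the finite intersection property is realised by a
    filter along which the \<open>f i\<close> converge pointwise, and the limit is continuous on
    \<open>T\<close>.\<close>
  have cluster: "\<exists>\<phi> G. G \<noteq> bot \<and> (\<forall>B\<in>\<B>. \<forall>\<^sub>F i in G. i \<in> B) \<and>
      (\<forall>y\<in>topspace T. ((\<lambda>i. f i y) \<longlongrightarrow> \<phi> y) G) \<and>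
      (\<forall>U. open U \<longrightarrow> openin T {y\<in>topspace T. \<phi> y \<in> U})"
    if fip: "\<forall>S. finite S \<longrightarrow> S \<subseteq> \<B> \<longrightarrow> \<Inter>S \<noteq> {}" for \<B>
  proof -
    from fip_filter[of \<B>, OF fip] obtain G
      where G: "G \<noteq> bot" "\<forall>B\<in>\<B>. \<forall>\<^sub>F i in G. i \<in> B" by auto
    from pointwise_subfilter[OF G(1), of "topspace T" f] f01
    obtain G' \<phi> where *: "G' \<le> G" "G' \<noteq> bot" "\<forall>x\<in>topspace T. ((\<lambda>i. f i x) \<longlongrightarrow> \<phi> x) G'"
      by auto
    have "\<forall>U. open U \<longrightarrow> openin T {y\<in>topspace T. \<phi> y \<in> U}"
      using limits_continuousD[OF lim *(2), of \<phi>] *(3) by simp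
    moreover have "\<forall>B\<in>\<B>. \<forall>\<^sub>F i in G'. i \<in> B" using G(2) filter_leD[OF *(1)] by simp
    ultimately show ?thesis using * by (intro exI[of _ \<phi>] exI[of _ G']) simp
  qed
  have nb: "\<exists>V. openin T V \<and> y \<in> V \<and> finite {t. x t \<in> V}" if y: "y \<in> topspace T" for y
  proof (cases "\<exists>S. finite S \<and> (\<Inter>t\<in>S. - A t) \<subseteq> {i. f i y > (a + b) / 2}")
    case False
    \<comment> \<open>Here \<open>?I\<close> is compatible with all complements of the
      \<open>A t\<close>. The limit is then at most the midpoint at \<open>y\<close> but at least
      \<open>b\<close> at every \<open>x t\<close>, so a neighbourhood of \<open>y\<close> contains
      no \<open>x t\<close>.\<close>
    let ?I = "{i. f i y \<le> (a + b) / 2}"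
    have "\<Inter>S \<noteq> {}" if S: "finite S" "S \<subseteq> insert ?I (range (\<lambda>t. - A t))" for S
    proof -
      have "S - {?I} \<subseteq> range (\<lambda>t. - A t)" using S(2) by blast
      then obtain S' where S': "finite S'" "S - {?I} = (\<lambda>t. - A t) ` S'"
        using S(1) by (meson finite_Diff finite_subset_image)
      have "\<not> (\<Inter>t\<in>S'. - A t) \<subseteq> {i. f i y > (a + b) / 2}"
        using False S'(1) by simp
      then obtain i where i: "i \<in> (\<Inter>t\<in>S'. - A t)" "i \<notin> {i. f i y > (a + b) / 2}"
        by (meson subsetI)
      have "i \<in> B" if "B \<in> S" for B
      proof (cases "B = ?I")
        case False
        then have "B \<in> S - {?I}" using that by simp
        then obtain t where "t \<in> S'" "B = - A t" unfolding S'(2) by (rule imageE)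
        then show ?thesis using i(1) by simp
      next
        case True
        then show ?thesis using i(2) by (simp add: not_less)
      qed
      then show ?thesis by blast
    qed
    then have "\<forall>S. finite S \<longrightarrow> S \<subseteq> insert ?I (range (\<lambda>t. - A t)) \<longrightarrow> \<Inter>S \<noteq> {}" by simp
    from cluster[OF this] obtain \<phi> G' where \<phi>: "G' \<noteq> bot"
      "\<forall>B\<in>insert ?I (range (\<lambda>t. - A t)). \<forall>\<^sub>F i in G'. i \<in> B"
      "\<forall>y\<in>topspace T. ((\<lambda>i. f i y) \<longlongrightarrow> \<phi> y) G'"
      "\<forall>U. open U \<longrightarrow> openin T {y\<in>topspace T. \<phi> y \<in> U}"
      by (elim exE conjE) (rule that; assumption)
    note ev = \<phi>(2)[rule_format]
    have "\<phi> y \<le> (a + b) / 2"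
      by (rule tendsto_upperbound[OF \<phi>(3)[rule_format, OF y] _ \<phi>(1)])
        (use ev[of ?I] in simp)
    moreover have "\<phi> (x t) \<ge> b" for t
      by (rule tendsto_lowerbound[OF \<phi>(3)[rule_format, OF x(1)] _ \<phi>(1)])
        (rule eventually_mono[OF ev[of "- A t"] xB], simp)
    ultimately have "y \<in> {y\<in>topspace T. \<phi> y \<in> {..<b}}" "{t. x t \<in> {y\<in>topspace T. \<phi> y \<in> {..<b}}} = {}"
      using ab y by (simp_all add: not_less)
    then show ?thesis
      using \<phi>(4)[rule_format, OF open_lessThan] by (metis finite.emptyI)
  next
    case True
    then obtain S where S: "finite S" "(\<Inter>t\<in>S. - A t) \<subseteq> {i. f i y > (a + b) / 2}" by blast
    \<comment> \<open>The complements over \<open>S\<close> force \<open>f i y\<close> above the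
      midpoint. Independence allows the sets \<open>A t\<close> for all other \<open>t\<close> to be
      added, so the limit exceeds \<open>a\<close> at \<open>y\<close> and is at most
      \<open>a\<close> at \<open>x t\<close> unless \<open>t\<close> is in \<open>S\<close>.\<close>
    have "\<Inter>Q \<noteq> {}" if Q: "finite Q" "Q \<subseteq> (\<lambda>t. - A t) ` S \<union> A ` (- S)" for Q
    proof -
      obtain S' where S': "finite S'" "S' \<subseteq> - S" "Q \<inter> A ` (-S) = A ` S'"
        by (meson Q(1) finite_Int finite_subset_image inf.cobounded2)
      obtain i where i: "i \<in> (\<Inter>t\<in>S'. A t) \<inter> (\<Inter>t\<in>S. - A t)"
        using A[OF S'(1) S(1)] S'(2) by blast
      have "i \<in> B" if "B \<in> Q" for B
      proof (cases "B \<in> A ` (- S)")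
        case True
        then have "B \<in> Q \<inter> A ` (- S)" using that by simp
        then obtain t where "t \<in> S'" "B = A t" unfolding S'(3) by (rule imageE)
        then show ?thesis using i by simp
      next
        case False
        then have "B \<in> (\<lambda>t. - A t) ` S" using that Q(2) by (meson UnE subsetD)
        then obtain t where "t \<in> S" "B = - A t" by (rule imageE)
        then show ?thesis using i by simp
      qed
      then show ?thesis by blast
    qed
    then have "\<forall>Q. finite Q \<longrightarrow> Q \<subseteq> (\<lambda>t. - A t) ` S \<union> A ` (- S) \<longrightarrow> \<Inter>Q \<noteq> {}" by simp
    from cluster[OF this] obtain \<phi> G' where \<phi>: "G' \<noteq> bot"
      "\<forall>B\<in>(\<lambda>t. - A t) ` S \<union> A ` (- S). \<forall>\<^sub>F i in G'. i \<in> B"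
      "\<forall>y\<in>topspace T. ((\<lambda>i. f i y) \<longlongrightarrow> \<phi> y) G'"
      "\<forall>U. open U \<longrightarrow> openin T {y\<in>topspace T. \<phi> y \<in> U}"
      by (elim exE conjE) (rule that; assumption)
    note ev = \<phi>(2)[rule_format]
    have "\<forall>\<^sub>F i in G'. \<forall>t\<in>S. i \<in> - A t"
    proof (intro eventually_ball_finite S(1) ballI)
      show "\<forall>\<^sub>F i in G'. i \<in> - A t" if "t \<in> S" for t
        using that by (intro ev UnI1 imageI)
    qed
    then have "\<forall>\<^sub>F i in G'. (a + b) / 2 \<le> f i y"
    proof (rule eventually_mono)
      fix i assume "\<forall>t\<in>S. i \<in> - A t"
      then have "i \<in> {i. f i y > (a + b) / 2}" using S(2) by (meson INT_I subsetD)
      then show "(a + b) / 2 \<le> f i y" by simp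
    qed
    then have "\<phi> y \<ge> (a + b) / 2"
      by (rule tendsto_lowerbound[OF \<phi>(3)[rule_format, OF y] _ \<phi>(1)])
    have "\<phi> (x t) \<le> a" if "t \<notin> S" for t
      by (rule tendsto_upperbound[OF \<phi>(3)[rule_format, OF x(1)] _ \<phi>(1)])
        (rule eventually_mono[OF ev[of "A t"] xA], use that in simp)
    then have "{t. x t \<in> {y\<in>topspace T. \<phi> y \<in> {a<..}}} \<subseteq> S"
      by (smt (verit, best) greaterThan_iff mem_Collect_eq subsetI)
    moreover have "y \<in> {y\<in>topspace T. \<phi> y \<in> {a<..}}"
      using ab y \<open>\<phi> y \<ge> (a + b) / 2\<close> by simp
    ultimately show ?thesis
      using \<phi>(4)[rule_format, OF open_greaterThan] finite_subset[OF _ S(1)] by metis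
  qed
  have "countable (UNIV :: (nat \<Rightarrow> bool) set)"
    by (rule Lindelof_pointwise_countable[of T x, OF T x(1) nb])
  then show False using uncountable_bool_sequences by simp
qed

section \<open>Separated families on the Cantor space\<close>

definition coin_flips :: "(nat \<Rightarrow> bool) measure" where
  "coin_flips = PiM UNIV (\<lambda>_. measure_pmf (bernoulli_pmf (1/2)))"

definition cylinder :: "bool list \<Rightarrow> (nat \<Rightarrow> bool) set" where
  "cylinder l = {\<omega>. \<forall>i<length l. \<omega> i = l ! i}"

interpretation coin_prod: product_prob_space "\<lambda>_::nat. measure_pmf (bernoulli_pmf (1/2))" UNIV ..

lemma prob_space_coin_flips: "prob_space coin_flips"
  unfolding coin_flips_def by (rule coin_prod.prob_space_axioms)

interpretation coin: prob_space coin_flips by (rule prob_space_coin_flips)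

lemma space_coin_flips [simp]: "space coin_flips = UNIV"
  by (simp add: coin_flips_def space_PiM)

lemma emeasure_cylinder: "emeasure coin_flips (cylinder l) = (1/2) ^ length l"
proof -
  have "cylinder l = {\<omega>\<in>space (PiM UNIV (\<lambda>_. measure_pmf (bernoulli_pmf (1/2)))).
      \<forall>i\<in>{..<length l}. \<omega> i \<in> {l ! i}}"
    by (auto simp: cylinder_def space_PiM)
  then have "emeasure coin_flips (cylinder l) =
      (\<Prod>i\<in>{..<length l}. emeasure (measure_pmf (bernoulli_pmf (1/2))) {l ! i})"
    unfolding coin_flips_def by (simp only: coin_prod.emeasure_PiM_Collect[of "{..<length l}"] sets_measure_pmf finite_lessThan subset_UNIV UNIV_I)
  also have "\<dots> = (\<Prod>i\<in>{..<length l}. 1/2)"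
  proof (rule prod.cong[OF refl])
    fix i
    show "emeasure (measure_pmf (bernoulli_pmf (1/2))) {l ! i} = 1/2"
    proof -
      have "inverse 2 = (1 / 2 :: ennreal)" by (simp add: divide_ennreal_def)
      then show ?thesis
        by (cases "l ! i") (simp_all add: emeasure_pmf_single divide_ennreal[symmetric])
    qed
  qed
  finally show ?thesis by simp
qed

lemma measure_cylinder: "measure coin_flips (cylinder l) = (1/2) ^ length l"
proof -
  have "(1/2 :: ennreal) = ennreal (1/2)" using divide_ennreal[of 1 2] by simp
  then have "ennreal (measure coin_flips (cylinder l)) = ennreal ((1/2) ^ length l)"
    unfolding coin.emeasure_eq_measure[symmetric] emeasure_cylinder
    by (simp only: ennreal_power)
  then show ?thesis by simp
qed

lemma sets_cylinder [measurable]: "cylinder l \<in> sets coin_flips"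
proof -
  have "(\<lambda>\<omega>. \<omega> i) -` {l ! i} \<inter> space coin_flips \<in> sets coin_flips" for i
    unfolding coin_flips_def by (rule measurable_sets[OF measurable_component_singleton]) auto
  then have "UNIV - (\<Union>i<length l. UNIV - ((\<lambda>\<omega>. \<omega> i) -` {l ! i} \<inter> space coin_flips)) \<in> sets coin_flips"
    using sets.top[of coin_flips] by (intro sets.Diff sets.finite_UN) auto
  also have "UNIV - (\<Union>i<length l. UNIV - ((\<lambda>\<omega>. \<omega> i) -` {l ! i} \<inter> space coin_flips)) = cylinder l"
    by (auto simp: cylinder_def)
  finally show ?thesis .
qed

text \<open>Uniform continuity on the Cantor space, which by compactness is plain continuity. The
  form with prefixes needs no topology on the sequences.\<close>

definition prefix_continuous :: "((nat \<Rightarrow> bool) \<Rightarrow> real) \<Rightarrow> bool" where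
  "prefix_continuous u \<longleftrightarrow>
    (\<forall>\<delta>>0. \<exists>k. \<forall>\<omega> \<omega>'. (\<forall>j<k. \<omega> j = \<omega>' j) \<longrightarrow> \<bar>u \<omega> - u \<omega>'\<bar> < \<delta>)"

lemma prefix_continuousD:
  assumes "prefix_continuous u" "\<delta> > 0"
  obtains k where "\<forall>\<omega> \<omega>'. (\<forall>j<k. \<omega> j = \<omega>' j) \<longrightarrow> \<bar>u \<omega> - u \<omega>'\<bar> < \<delta>"
  using assms(1)[unfolded prefix_continuous_def, rule_format, OF assms(2)] by (rule exE)

text \<open>A strict sublevel set is the union of the cylinders it contains, and there are only
  countably many cylinders.\<close>

lemma prefix_continuous_measurable:
  assumes "prefix_continuous u"
  shows "u \<in> borel_measurable coin_flips"
  unfolding borel_measurable_iff_less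
proof
  fix q
  have "{\<omega>\<in>space coin_flips. u \<omega> < q} = (\<Union>l\<in>{l. cylinder l \<subseteq> {\<omega>. u \<omega> < q}}. cylinder l)"
  proof (intro set_eqI iffI)
    fix \<omega> assume "\<omega> \<in> {\<omega>\<in>space coin_flips. u \<omega> < q}"
    then have "q - u \<omega> > 0" by simp
    then obtain k where k: "\<forall>\<omega>1 \<omega>2. (\<forall>j<k. \<omega>1 j = \<omega>2 j) \<longrightarrow> \<bar>u \<omega>1 - u \<omega>2\<bar> < q - u \<omega>"
      by (rule prefix_continuousD[OF assms])
    have "\<omega> \<in> cylinder (map \<omega> [0..<k])" by (simp add: cylinder_def)
    moreover have "u \<omega>' < q" if "\<omega>' \<in> cylinder (map \<omega> [0..<k])" for \<omega>'
    proof -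
      have "\<forall>j<k. \<omega> j = \<omega>' j" using that by (simp add: cylinder_def)
      then have "\<bar>u \<omega> - u \<omega>'\<bar> < q - u \<omega>" using k by simp
      then show ?thesis by linarith
    qed
    ultimately show "\<omega> \<in> (\<Union>l\<in>{l. cylinder l \<subseteq> {\<omega>. u \<omega> < q}}. cylinder l)" by blast
  qed auto
  also have "\<dots> \<in> sets coin_flips"
    by (intro sets.countable_UN'') auto
  finally show "{\<omega>\<in>space coin_flips. u \<omega> < q} \<in> sets coin_flips" .
qed


text \<open>A limit point of the solutions for finitely many conditions solves all of them by
  compactness of the Cantor space; strict inequalities become weak ones in the limit.\<close>

lemma prefix_continuous_compact:
  fixes u :: "nat \<Rightarrow> (nat \<Rightarrow> bool) \<Rightarrow> real"
  assumes u: "\<And>j. prefix_continuous (u j)"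
    and fin: "\<And>k. \<exists>\<omega>. \<forall>j<k. if s j then u j \<omega> < a else u j \<omega> > b"
  shows "\<exists>\<omega>. \<forall>j. if s j then u j \<omega> \<le> a else u j \<omega> \<ge> b"
proof -
  obtain z where z: "\<And>k. \<forall>j<k. if s j then u j (z k) < a else u j (z k) > b"
    using fin by metis
  let ?Z = "product_topology (\<lambda>_::nat. discrete_topology (UNIV :: bool set)) UNIV"
  have "compact_space ?Z"
    by (simp add: compact_space_product_topology compact_space_discrete_topology)
  then have "compactin ?Z (topspace ?Z)" by (simp add: compact_space_def)
  from compactin_subfilter[OF this sequentially_bot, of z]
  obtain G \<omega> where G: "G \<le> sequentially" "G \<noteq> bot" "limitin ?Z z \<omega> G"
    by auto
  have coord: "\<forall>\<^sub>F n in G. z n i = \<omega> i" for i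
  proof -
    have "limitin (discrete_topology UNIV) (\<lambda>n. z n i) (\<omega> i) G"
      using G(3) by (simp add: limitin_componentwise)
    then have "\<forall>\<^sub>F n in G. z n i \<in> {\<omega> i}"
      unfolding limitin_def by (metis UNIV_I openin_discrete_topology singletonI subset_UNIV)
    then show ?thesis by simp
  qed
  have lim: "((\<lambda>n. u j (z n)) \<longlongrightarrow> u j \<omega>) G" for j
  proof (rule tendstoI)
    fix e :: real assume "e > 0"
    then obtain k where k: "\<forall>\<omega> \<omega>'. (\<forall>i<k. \<omega> i = \<omega>' i) \<longrightarrow> \<bar>u j \<omega> - u j \<omega>'\<bar> < e"
      by (rule prefix_continuousD[OF u])
    have "\<forall>\<^sub>F n in G. \<forall>i\<in>{..<k}. z n i = \<omega> i"
      using coord by (intro eventually_ball_finite) auto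
    then show "\<forall>\<^sub>F n in G. dist (u j (z n)) (u j \<omega>) < e"
      by (rule eventually_mono) (simp add: dist_real_def k)
  qed
  have ev: "\<forall>\<^sub>F n in G. n > j" for j :: nat
    using filter_leD[OF G(1) eventually_gt_at_top] .
  have "if s j then u j \<omega> \<le> a else u j \<omega> \<ge> b" for j
  proof (cases "s j")
    case True
    have "\<forall>\<^sub>F n in G. u j (z n) \<le> a"
      by (rule eventually_mono[OF ev[of j]]) (metis True less_imp_le z)
    then show ?thesis using tendsto_upperbound[OF lim _ G(2)] True by simp
  next
    case False
    have "\<forall>\<^sub>F n in G. u j (z n) \<ge> b"
      by (rule eventually_mono[OF ev[of j]]) (metis False less_imp_le z)
    then show ?thesis using tendsto_lowerbound[OF lim _ G(2)] False by simp
  qed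
  then show ?thesis by blast
qed

section \<open>Separated Cantor families contradict the Lindelof property\<close>

lemma limits_continuous_reindex:
  assumes "limits_continuous T f"
  shows "limits_continuous T (\<lambda>n. f (r n))"
  unfolding limits_continuous_def
proof (intro allI impI)
  fix G \<phi> assume "G \<noteq> bot" "\<forall>x\<in>topspace T. ((\<lambda>n. f (r n) x) \<longlongrightarrow> \<phi> x) G"
  then have "filtermap r G \<noteq> bot" "\<forall>x\<in>topspace T. ((\<lambda>i. f i x) \<longlongrightarrow> \<phi> x) (filtermap r G)"
    by (simp_all add: filtermap_bot_iff filterlim_filtermap)
  then show "continuous_map T euclideanreal \<phi>"
    using assms unfolding limits_continuous_def by simp
qed

text \<open>The outcome of the Cantor scheme, collected in order to be refuted. The map
  \<open>c\<close> is only required to be continuous after composition with each \<open>f i\<close>.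
  The bound \<open>e\<close> is the same at all levels \<open>k\<close>, while the finite set of
  coordinates may grow with \<open>k\<close>.\<close>

locale separated_Cantor_family =
  fixes T :: "'a topology" and f :: "'i \<Rightarrow> 'a \<Rightarrow> real" and c :: "(nat \<Rightarrow> bool) \<Rightarrow> 'a" and e :: real
  assumes T: "Lindelof_space T" and lim: "limits_continuous T f"
    and f01: "\<And>i x. x \<in> topspace T \<Longrightarrow> f i x \<in> {0..1}" and c: "\<And>\<omega>. c \<omega> \<in> topspace T"
    and cont: "\<And>i. prefix_continuous (\<lambda>\<omega>. f i (c \<omega>))"
    and e: "e > 0"
    and sep: "\<And>k. \<exists>I. finite I \<and> (\<forall>\<omega> \<omega>'. (\<forall>i\<in>I. \<bar>f i (c \<omega>) - f i (c \<omega>')\<bar> < e) \<longrightarrow> (\<forall>j<k. \<omega> j = \<omega>' j))"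
begin

definition u :: "'i \<Rightarrow> (nat \<Rightarrow> bool) \<Rightarrow> real" where "u i \<omega> = f i (c \<omega>)"

definition L1 :: "'i \<Rightarrow> 'i \<Rightarrow> real" where "L1 i j = (\<integral>\<omega>. \<bar>u i \<omega> - u j \<omega>\<bar> \<partial>coin_flips)"

lemma u01: "u i \<omega> \<in> {0..1}" using f01[OF c] by (simp add: u_def)

lemma u_cont: "prefix_continuous (u i)" using cont[of i] by (simp add: u_def[abs_def])

lemma u_meas [measurable]: "u i \<in> borel_measurable coin_flips"
  by (rule prefix_continuous_measurable[OF u_cont])

text \<open>Compactness of the Cantor space turns the finite patterns into infinite ones, realised
  by points of \<open>T\<close> through \<open>c\<close>.\<close>

lemma not_independent:
  fixes r :: "nat \<Rightarrow> 'i"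
  assumes ab: "a < b" and r: "\<forall>s k. \<exists>\<omega>. \<forall>j<k. if s j then u (r j) \<omega> < a else u (r j) \<omega> > b"
  shows False
proof -
  have "\<exists>x\<in>topspace T. \<forall>j. if s j then f (r j) x \<le> a else f (r j) x \<ge> b" for s
  proof -
    obtain \<omega> where "\<forall>j. if s j then u (r j) \<omega> \<le> a else u (r j) \<omega> \<ge> b"
      using prefix_continuous_compact[of "\<lambda>j. u (r j)" s a b] u_cont r by auto
    then show ?thesis using c[of \<omega>] unfolding u_def by blast
  qed
  then show False
    using independent_not_Lindelof[OF T limits_continuous_reindex[OF lim, of r] _ ab] f01 by blast
qed

text \<open>Relative compactness in L^1: the other alternative, oscillation on every part of a set
  of positive measure, would produce an independent sequence.\<close>

lemma L1_limit:
  assumes "G \<noteq> bot"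
  shows "\<exists>G' w. G' \<le> G \<and> G' \<noteq> bot \<and> w \<in> borel_measurable coin_flips \<and> (\<forall>\<omega>. w \<omega> \<in> {0..1}) \<and>
    ((\<lambda>n. \<integral>\<omega>. \<bar>u (r n) \<omega> - w \<omega>\<bar> \<partial>coin_flips) \<longlongrightarrow> 0) G'"
proof -
  consider "?thesis" | "\<exists>G' a b D. G' \<noteq> bot \<and> a < b \<and> D \<in> sets coin_flips \<and> coin.prob D > 0 \<and>
      (\<forall>E\<in>sets coin_flips. E \<subseteq> D \<longrightarrow> coin.prob E > 0 \<longrightarrow>
        (\<forall>\<^sub>F i in G'. coin.prob {x\<in>E. u (r i) x < a} > 0 \<and> coin.prob {x\<in>E. u (r i) x > b} > 0))"
    using coin.L1_limit_or_oscillation[of "\<lambda>n. u (r n)", OF u_meas u01 assms] by argo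
  then show ?thesis
  proof cases
    case 2
    then obtain G' a b D where *: "G' \<noteq> bot" "a < b" "D \<in> sets coin_flips" "coin.prob D > 0"
      "\<forall>E\<in>sets coin_flips. E \<subseteq> D \<longrightarrow> coin.prob E > 0 \<longrightarrow>
        (\<forall>\<^sub>F i in G'. coin.prob {x\<in>E. u (r i) x < a} > 0 \<and> coin.prob {x\<in>E. u (r i) x > b} > 0)"
      by (elim exE conjE) (rule that; assumption)
    have "\<exists>q::nat \<Rightarrow> _. \<forall>s k. \<exists>\<omega>. \<forall>j<k. if s j then u (r (q j)) \<omega> < a else u (r (q j)) \<omega> > b"
      by (rule coin.oscillation_imp_independent[of "\<lambda>n. u (r n)", OF u_meas *(1,3,4), where a=a and b=b])
        (use *(5) in blast)
    then obtain q :: "nat \<Rightarrow> _" where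
      "\<forall>s k. \<exists>\<omega>. \<forall>j<k. if s j then u (r (q j)) \<omega> < a else u (r (q j)) \<omega> > b" ..
    from not_independent[of a b "\<lambda>j. r (q j)", OF *(2) this] show ?thesis ..
  qed
qed

lemma abs_integrable:
  assumes "v \<in> borel_measurable coin_flips" "w \<in> borel_measurable coin_flips"
    "\<And>x. v x \<in> {0..1}" "\<And>x. w x \<in> {0..1}"
  shows "integrable coin_flips (\<lambda>x. \<bar>v x - w x\<bar> :: real)"
proof (rule coin.integrable_const_bound[where B=1])
  have "\<bar>v x - w x\<bar> \<le> 1" for x using assms(3)[of x] assms(4)[of x] by (auto simp: abs_if)
  then show "AE x in coin_flips. norm \<bar>v x - w x\<bar> \<le> 1" by simp
qed (use assms(1,2) in measurable)

lemma L1_triangle: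
  assumes "w \<in> borel_measurable coin_flips" "\<forall>x. w x \<in> {0..1}"
  shows "L1 i j \<le> (\<integral>\<omega>. \<bar>u i \<omega> - w \<omega>\<bar> \<partial>coin_flips) + (\<integral>\<omega>. \<bar>u j \<omega> - w \<omega>\<bar> \<partial>coin_flips)"
    "(\<integral>\<omega>. \<bar>u j \<omega> - w \<omega>\<bar> \<partial>coin_flips) \<le> L1 i j + (\<integral>\<omega>. \<bar>u i \<omega> - w \<omega>\<bar> \<partial>coin_flips)"
proof -
  note int = abs_integrable[OF u_meas u_meas u01 u01] abs_integrable[OF u_meas assms(1) u01 assms(2)[rule_format]]
  show "L1 i j \<le> (\<integral>\<omega>. \<bar>u i \<omega> - w \<omega>\<bar> \<partial>coin_flips) + (\<integral>\<omega>. \<bar>u j \<omega> - w \<omega>\<bar> \<partial>coin_flips)"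
    unfolding L1_def Bochner_Integration.integral_add[OF int(2,2), symmetric]
    by (intro integral_mono Bochner_Integration.integrable_add int) linarith
  show "(\<integral>\<omega>. \<bar>u j \<omega> - w \<omega>\<bar> \<partial>coin_flips) \<le> L1 i j + (\<integral>\<omega>. \<bar>u i \<omega> - w \<omega>\<bar> \<partial>coin_flips)"
    unfolding L1_def Bochner_Integration.integral_add[OF int(1,2), symmetric]
    by (intro integral_mono Bochner_Integration.integrable_add int) linarith
qed

text \<open>Otherwise a sequence with pairwise distances at least \<open>d\<close> exists. Along a
  subfilter it converges in L^1, so two of its members are closer than \<open>d\<close>.\<close>

lemma L1_totally_bounded:
  assumes d: "d > 0"
  shows "\<exists>N. finite N \<and> (\<forall>i. \<exists>j\<in>N. L1 i j < d)"
proof (rule ccontr)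
  assume "\<not> ?thesis"
  then have far: "\<exists>i. \<forall>j\<in>N. L1 i j \<ge> d" if "finite N" for N
    using that by (meson not_less)
  have "\<exists>h::nat \<Rightarrow> 'i. \<forall>n. \<forall>m<n. L1 (h n) (h m) \<ge> d"
  proof (rule dependent_wellorder_choice)
    show "\<And>r f g x. (\<And>y. y < x \<Longrightarrow> f y = g y) \<Longrightarrow> (\<forall>m<x. d \<le> L1 r (f m)) = (\<forall>m<x. d \<le> L1 r (g m))"
      by simp
    show "\<exists>r. \<forall>m<x. d \<le> L1 r (h m)" for x :: nat and h
      using far[of "h ` {..<x}"] by (simp add: lessThan_def)
  qed
  then obtain h :: "nat \<Rightarrow> 'i" where h: "\<And>n m. m < n \<Longrightarrow> L1 (h n) (h m) \<ge> d" by blast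
  obtain G w where G: "G \<le> sequentially" "G \<noteq> bot" and w: "w \<in> borel_measurable coin_flips"
    "\<forall>\<omega>. w \<omega> \<in> {0..1}" and lim: "((\<lambda>n. \<integral>\<omega>. \<bar>u (h n) \<omega> - w \<omega>\<bar> \<partial>coin_flips) \<longlongrightarrow> 0) G"
    using L1_limit[OF sequentially_bot, of h] by auto
  have ev: "\<forall>\<^sub>F n in G. (\<integral>\<omega>. \<bar>u (h n) \<omega> - w \<omega>\<bar> \<partial>coin_flips) < d / 2"
    using order_tendstoD(2)[OF lim, of "d / 2"] d by simp
  obtain m where m: "(\<integral>\<omega>. \<bar>u (h m) \<omega> - w \<omega>\<bar> \<partial>coin_flips) < d / 2"
    using eventually_happens'[OF G(2) ev] by blast
  have "\<forall>\<^sub>F n in G. n > m" using filter_leD[OF G(1) eventually_gt_at_top] .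
  then obtain n where n: "(\<integral>\<omega>. \<bar>u (h n) \<omega> - w \<omega>\<bar> \<partial>coin_flips) < d / 2" "n > m"
    using eventually_happens'[OF G(2) eventually_conj[OF ev]] by blast
  show False using L1_triangle(1)[OF w, of "h n" "h m"] h[OF n(2)] m n(1) by linarith
qed

text \<open>Preimages under \<open>c\<close> need not be measurable, hence the formulation by null supersets.\<close>

definition heavy :: "'a set" where
  "heavy = {x\<in>topspace T. \<forall>V N. openin T V \<longrightarrow> x \<in> V \<longrightarrow> N \<in> null_sets coin_flips \<longrightarrow> \<not> c -` V \<subseteq> N}"

lemma heavyD:
  "x \<in> heavy \<Longrightarrow> openin T V \<Longrightarrow> x \<in> V \<Longrightarrow> N \<in> null_sets coin_flips \<Longrightarrow> \<not> c -` V \<subseteq> N"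
  unfolding heavy_def by blast

text \<open>If continuity fails, index sequences \<open>p\<close> and \<open>q\<close> approach each
  other in L^1 while their values at \<open>x\<close> stay \<open>d\<close> apart. After thinning,
  both converge almost everywhere to one function \<open>w\<close>. Pointwise limits of the two
  sequences are continuous on \<open>T\<close>, differ at \<open>x\<close>, and agree at almost all
  \<open>c \<omega>\<close>; the open set where they differ contradicts that \<open>x\<close> is
  heavy.\<close>

lemma heavy_L1_continuous:
  assumes x: "x \<in> heavy" and d: "d > 0"
  shows "\<exists>n. \<forall>i j. L1 i j < 1 / Suc n \<longrightarrow> \<bar>f i x - f j x\<bar> < d"
proof (rule ccontr)
  assume "\<not> ?thesis"
  then have "\<forall>n. \<exists>i j. L1 i j < 1 / Suc n \<and> d \<le> \<bar>f i x - f j x\<bar>" by (meson not_less)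
  then obtain p q where pq: "\<And>n. L1 (p n) (q n) < 1 / Suc n" "\<And>n. d \<le> \<bar>f (p n) x - f (q n) x\<bar>"
    by metis
  have xT: "x \<in> topspace T" using x by (simp add: heavy_def)
  obtain G w where G: "G \<le> sequentially" "G \<noteq> bot" and w: "w \<in> borel_measurable coin_flips"
    "\<forall>\<omega>. w \<omega> \<in> {0..1}" and plim: "((\<lambda>n. \<integral>\<omega>. \<bar>u (p n) \<omega> - w \<omega>\<bar> \<partial>coin_flips) \<longlongrightarrow> 0) G"
    using L1_limit[OF sequentially_bot, of p] by auto
  note int = abs_integrable[OF u_meas w(1) u01 w(2)[rule_format]]
  let ?v = "\<lambda>n \<omega>. \<bar>u (p n) \<omega> - w \<omega>\<bar> + \<bar>u (q n) \<omega> - w \<omega>\<bar>"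
  have v_int: "(\<integral>\<omega>. ?v n \<omega> \<partial>coin_flips) =
      (\<integral>\<omega>. \<bar>u (p n) \<omega> - w \<omega>\<bar> \<partial>coin_flips) + (\<integral>\<omega>. \<bar>u (q n) \<omega> - w \<omega>\<bar> \<partial>coin_flips)" for n
    by (intro Bochner_Integration.integral_add int)
  \<comment> \<open>A convergent subfilter provides no subsequence. Picking one index for each
    \<open>k\<close> gives a genuine sequence, as needed for the passage from L^1 to almost
    everywhere convergence.\<close>
  have "\<exists>n. (\<integral>\<omega>. ?v n \<omega> \<partial>coin_flips) < 1 / Suc k" for k
  proof -
    have "\<forall>\<^sub>F n in G. (\<integral>\<omega>. \<bar>u (p n) \<omega> - w \<omega>\<bar> \<partial>coin_flips) < 1 / (4 * Suc k)"
      using order_tendstoD(2)[OF plim, of "1 / (4 * Suc k)"] by simp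
    moreover have "\<forall>\<^sub>F n in G. n \<ge> 4 * Suc k"
      using filter_leD[OF G(1) eventually_ge_at_top] .
    ultimately have "\<forall>\<^sub>F n in G. (\<integral>\<omega>. ?v n \<omega> \<partial>coin_flips) < 1 / Suc k"
    proof eventually_elim
      case (elim n)
      have "L1 (p n) (q n) < 1 / (4 * Suc k)"
        using elim(2) by (intro less_le_trans[OF pq(1)] divide_left_mono) auto
      moreover have "3 / (4 * Suc k) < 1 / Suc k" by (simp add: field_simps)
      ultimately show ?case
        using elim(1) L1_triangle(2)[OF w, where i="p n" and j="q n"] unfolding v_int by argo
    qed
    from eventually_happens'[OF G(2) this] show ?thesis by blast
  qed
  then obtain n where n: "\<And>k. (\<integral>\<omega>. ?v (n k) \<omega> \<partial>coin_flips) < 1 / Suc k" by metis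
  have "(\<lambda>k. \<integral>\<omega>. norm (?v (n k) \<omega>) \<partial>coin_flips) \<longlonglongrightarrow> 0"
  proof (rule tendsto_sandwich[OF _ _ tendsto_const LIMSEQ_inverse_real_of_nat])
    show "\<forall>\<^sub>F k in sequentially. 0 \<le> (\<integral>\<omega>. norm (?v (n k) \<omega>) \<partial>coin_flips)" by simp
    show "\<forall>\<^sub>F k in sequentially. (\<integral>\<omega>. norm (?v (n k) \<omega>) \<partial>coin_flips) \<le> inverse (real (Suc k))"
      using n by (intro always_eventually allI less_imp_le) (simp add: inverse_eq_divide)
  qed
  from tendsto_L1_AE_subseq[OF _ this] int obtain r where r: "strict_mono r"
    "AE \<omega> in coin_flips. (\<lambda>k. ?v (n (r k)) \<omega>) \<longlonglongrightarrow> 0"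
    by auto
  define h where "h k b = (if b then p (n (r k)) else q (n (r k)))" for k b
  have AE: "AE \<omega> in coin_flips. \<forall>b. (\<lambda>k. u (h k b) \<omega>) \<longlonglongrightarrow> w \<omega>"
    using r(2)
  proof eventually_elim
    case (elim \<omega>)
    have "(\<lambda>k. u (h k b) \<omega> - w \<omega>) \<longlonglongrightarrow> 0" for b
      by (rule tendsto_rabs_zero_cancel, rule tendsto_sandwich[OF _ _ tendsto_const elim])
        (simp_all add: h_def)
    then show ?case by (simp add: LIM_zero_iff)
  qed
  \<comment> \<open>With the Boolean as part of the point, both sequences converge pointwise along
    the same subfilter.\<close>
  from pointwise_subfilter[OF sequentially_bot, of "topspace T \<times> UNIV" "\<lambda>k (y, b). f (h k b) y"] f01
  obtain G' \<Phi> where G': "G' \<le> sequentially" "G' \<noteq> bot"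
    and \<Phi>: "\<forall>z\<in>topspace T \<times> UNIV. ((\<lambda>k. case z of (y, b) \<Rightarrow> f (h k b) y) \<longlongrightarrow> \<Phi> z) G'"
    by auto
  have \<Phi>_lim: "((\<lambda>k. f (h k b) y) \<longlongrightarrow> \<Phi> (y, b)) G'" if "y \<in> topspace T" for y b
    using \<Phi>[rule_format, of "(y, b)"] that by simp
  have "continuous_map T euclideanreal (\<lambda>y. \<Phi> (y, b))" for b
    using limits_continuous_reindex[OF lim, of "\<lambda>k. h k b"] G'(2) \<Phi>_lim
    unfolding limits_continuous_def by simp
  then have "continuous_map T euclideanreal (\<lambda>y. \<Phi> (y, True) - \<Phi> (y, False))"
    by (intro continuous_map_diff)
  then have V: "openin T {y\<in>topspace T. \<Phi> (y, True) - \<Phi> (y, False) \<in> - {0}}"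
    by (rule openin_continuous_map_preimage) (simp add: open_Compl)
  have "((\<lambda>k. \<bar>f (h k True) x - f (h k False) x\<bar>) \<longlongrightarrow> \<bar>\<Phi> (x, True) - \<Phi> (x, False)\<bar>) G'"
    by (intro tendsto_rabs tendsto_diff \<Phi>_lim xT)
  then have "d \<le> \<bar>\<Phi> (x, True) - \<Phi> (x, False)\<bar>"
    by (rule tendsto_lowerbound[OF _ _ G'(2)]) (simp add: h_def pq(2))
  then have xV: "x \<in> {y\<in>topspace T. \<Phi> (y, True) - \<Phi> (y, False) \<in> - {0}}"
    using d xT by auto
  obtain N where N: "{\<omega>\<in>space coin_flips. \<not> (\<forall>b. (\<lambda>k. u (h k b) \<omega>) \<longlonglongrightarrow> w \<omega>)} \<subseteq> N"
    "N \<in> null_sets coin_flips"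
    using AE[unfolded eventually_ae_filter] by (elim bexE) (rule that; assumption)
  have "c -` {y\<in>topspace T. \<Phi> (y, True) - \<Phi> (y, False) \<in> - {0}} \<subseteq> N"
  proof
    fix \<omega> assume \<omega>: "\<omega> \<in> c -` {y\<in>topspace T. \<Phi> (y, True) - \<Phi> (y, False) \<in> - {0}}"
    show "\<omega> \<in> N"
    proof (rule ccontr)
      assume "\<omega> \<notin> N"
      then have "(\<lambda>k. u (h k b) \<omega>) \<longlonglongrightarrow> w \<omega>" for b using N(1) by auto
      then have "((\<lambda>k. f (h k b) (c \<omega>)) \<longlongrightarrow> w \<omega>) G'" for b
        unfolding u_def by (rule tendsto_mono[OF G'(1)])
      then have "\<Phi> (c \<omega>, b) = w \<omega>" for b
        using tendsto_unique[OF G'(2) \<Phi>_lim[OF c]] by simp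
      then show False using \<omega> by simp
    qed
  qed
  then show False using heavyD[OF x V xV N(2)] by simp
qed

text \<open>Heavy points fall into countably many classes, each inside an open set whose preimage
  under \<open>c\<close> lies in a small cylinder. The other points have neighbourhoods with null
  preimage. A countable subcover would bound the measure of the Cantor space by one half.\<close>

lemma contradiction: False
proof -
  \<comment> \<open>Members of one \<open>V k\<close> below are within \<open>3 * d\<close> of its
    representative in the selected coordinates, hence within \<open>e\<close> of each other.\<close>
  define d where "d = e / 6"
  have d: "d > 0" using e by (simp add: d_def)
  have "\<forall>x. \<exists>n. x \<in> heavy \<longrightarrow> (\<forall>i j. L1 i j < 1 / Suc n \<longrightarrow> \<bar>f i x - f j x\<bar> < d)"
    using heavy_L1_continuous[OF _ d] by simp
  from choice[OF this] obtain m
    where "\<forall>x. x \<in> heavy \<longrightarrow> (\<forall>i j. L1 i j < 1 / Suc (m x) \<longrightarrow> \<bar>f i x - f j x\<bar> < d)" ..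
  then have m: "x \<in> heavy \<Longrightarrow> L1 i j < 1 / Suc (m x) \<Longrightarrow> \<bar>f i x - f j x\<bar> < d" for x i j
    by simp
  have "\<forall>n. \<exists>l. \<forall>i. \<exists>j\<in>set l. L1 i j < 1 / Suc n"
  proof
    fix n
    obtain N where "finite N" "\<forall>i. \<exists>j\<in>N. L1 i j < 1 / Suc n"
      using L1_totally_bounded[of "1 / Suc n"] by auto
    moreover from this obtain l where "set l = N" using finite_list by blast
    ultimately show "\<exists>l. \<forall>i. \<exists>j\<in>set l. L1 i j < 1 / Suc n" by blast
  qed
  from choice[OF this] obtain l where l: "\<forall>n i. \<exists>j\<in>set (l n). L1 i j < 1 / Suc n" ..
  \<comment> \<open>The key of a heavy point consists of its L^1 modulus for the error
    \<open>d\<close> and its rounded values on a finite L^1 net of that fineness. Keys form a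
    countable type, and equal keys force closeness within \<open>3 * d\<close> in every
    coordinate.\<close>
  define key where "key x = (m x, map (\<lambda>i. \<lfloor>f i x / d\<rfloor>) (l (m x)))" for x
  have close: "\<bar>f i x - f i y\<bar> < 3 * d" if xy: "x \<in> heavy" "y \<in> heavy" "key x = key y" for x y i
  proof -
    have my: "m y = m x" using xy(3) by (simp add: key_def)
    obtain j where j: "j \<in> set (l (m x))" "L1 i j < 1 / Suc (m x)" using l by blast
    have "\<lfloor>f j x / d\<rfloor> = \<lfloor>f j y / d\<rfloor>" using xy(3) j(1) my by (simp add: key_def)
    then have "\<bar>f j x / d - f j y / d\<bar> < 1" by linarith
    then have "\<bar>f j x - f j y\<bar> < d"
      using d by (simp add: diff_divide_distrib[symmetric] abs_divide)
    moreover have "\<bar>f i x - f j x\<bar> < d" by (rule m[OF xy(1) j(2)])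
    moreover have "\<bar>f i y - f j y\<bar> < d" using m[OF xy(2)] j(2) my by simp
    ultimately show ?thesis by linarith
  qed
  \<comment> \<open>A representative for each key makes the neighbourhood depend on the key alone,
    so that only countably many arise.\<close>
  define rep where "rep k = (SOME x. x \<in> heavy \<and> key x = k)" for k
  have rep: "rep (key x) \<in> heavy \<and> key (rep (key x)) = key x" if "x \<in> heavy" for x
    unfolding rep_def by (rule someI[of _ x]) (simp add: that)
  have "\<forall>k. \<exists>I. finite I \<and>
      (\<forall>\<omega> \<omega>'. (\<forall>i\<in>I. \<bar>f i (c \<omega>) - f i (c \<omega>')\<bar> < e) \<longrightarrow> (\<forall>j<k. \<omega> j = \<omega>' j))"
    using sep by simp
  from choice[OF this] obtain I where I: "\<forall>k. finite (I k) \<and>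
      (\<forall>\<omega> \<omega>'. (\<forall>i\<in>I k. \<bar>f i (c \<omega>) - f i (c \<omega>')\<bar> < e) \<longrightarrow> (\<forall>j<k. \<omega> j = \<omega>' j))" ..
  \<comment> \<open>The coordinates in \<open>I (to_nat k + 2)\<close> determine that many bits, so
    the preimage of \<open>V k\<close> has outer measure at most
    \<open>(1/2) ^ (to_nat k + 2)\<close>. Over all keys these bounds add up to at most one
    half.\<close>
  define V where "V k = {y\<in>topspace T. \<forall>i\<in>I (to_nat k + 2). \<bar>f i y - f i (rep k)\<bar> < 3 * d}" for k
  have f_cont: "continuous_map T euclideanreal (f i)" for i
  proof -
    have "\<forall>x\<in>topspace T. ((\<lambda>j. f j x) \<longlongrightarrow> f i x) (principal {i})"
      by (auto simp: tendsto_def eventually_principal)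
    then show ?thesis
      using lim[unfolded limits_continuous_def, rule_format, of "principal {i}" "f i"]
      by (simp add: principal_eq_bot_iff)
  qed
  have V_open: "openin T (V k)" for k
  proof -
    have "openin T {y\<in>topspace T. f i y \<in> {z. \<bar>z - f i (rep k)\<bar> < 3 * d}}" for i
      by (rule openin_continuous_map_preimage[OF f_cont])
        (simp add: open_openin[symmetric] open_Collect_less continuous_on_rabs continuous_intros)
    then have "openin T (topspace T \<inter> (\<Inter>i\<in>I (to_nat k + 2). {y\<in>topspace T. f i y \<in> {z. \<bar>z - f i (rep k)\<bar> < 3 * d}}))"
      using I by (intro openin_Int_Inter) auto
    moreover have "topspace T \<inter> (\<Inter>i\<in>I (to_nat k + 2). {y\<in>topspace T. f i y \<in> {z. \<bar>z - f i (rep k)\<bar> < 3 * d}}) = V k"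
      by (auto simp: V_def)
    ultimately show ?thesis by simp
  qed
  have V_small: "\<exists>l. length l = to_nat k + 2 \<and> c -` V k \<subseteq> cylinder l" for k
  proof (cases "c -` V k = {}")
    case True
    then show ?thesis by (intro exI[of _ "replicate (to_nat k + 2) True"]) simp
  next
    case False
    then obtain \<omega>0 where \<omega>0: "c \<omega>0 \<in> V k" by blast
    have "\<omega> \<in> cylinder (map \<omega>0 [0..<to_nat k + 2])" if "c \<omega> \<in> V k" for \<omega>
    proof -
      have "\<forall>i\<in>I (to_nat k + 2). \<bar>f i (c \<omega>) - f i (c \<omega>0)\<bar> < e"
      proof
        fix i assume "i \<in> I (to_nat k + 2)"
        then have "\<bar>f i (c \<omega>) - f i (rep k)\<bar> < 3 * d" "\<bar>f i (c \<omega>0) - f i (rep k)\<bar> < 3 * d"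
          using that \<omega>0 by (auto simp: V_def)
        then show "\<bar>f i (c \<omega>) - f i (c \<omega>0)\<bar> < e" unfolding d_def by linarith
      qed
      then have "\<forall>j<to_nat k + 2. \<omega> j = \<omega>0 j" using I by blast
      then show ?thesis by (simp add: cylinder_def del: upt_Suc)
    qed
    then show ?thesis by (intro exI[of _ "map \<omega>0 [0..<to_nat k + 2]"]) auto
  qed
  then have "\<forall>k. \<exists>l. length l = to_nat k + 2 \<and> c -` V k \<subseteq> cylinder l" by simp
  from choice[OF this] obtain C
    where C: "\<forall>k. length (C k) = to_nat k + 2 \<and> c -` V k \<subseteq> cylinder (C k)" ..
  \<comment> \<open>Every point of \<open>T\<close> that is not heavy lies in a member of this
    family. Only countably many members enter the subcover, so their preimages together stay
    null.\<close>
  define \<U>0 where "\<U>0 = {U. openin T U \<and> (\<exists>N\<in>null_sets coin_flips. c -` U \<subseteq> N)}"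
  have "x \<in> \<Union>(\<U>0 \<union> V ` key ` heavy)" if "x \<in> topspace T" for x
  proof (cases "x \<in> heavy")
    case True
    have "x \<in> V (key x)"
      using that close[OF True] rep[OF True] by (simp add: V_def)
    then show ?thesis using True by blast
  next
    case False
    then show ?thesis using that unfolding heavy_def \<U>0_def by blast
  qed
  then have "\<Union>(\<U>0 \<union> V ` key ` heavy) = topspace T"
    using V_open openin_subset unfolding \<U>0_def by blast
  then have "\<exists>\<V>. countable \<V> \<and> \<V> \<subseteq> \<U>0 \<union> V ` key ` heavy \<and> \<Union>\<V> = topspace T"
  proof (intro Lindelof_spaceD[OF T])
    fix U assume "U \<in> \<U>0 \<union> V ` key ` heavy"
    then show "openin T U"
      using V_open by (elim UnE imageE) (simp_all add: \<U>0_def)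
  qed
  then obtain \<V> where \<V>: "countable \<V>" "\<V> \<subseteq> \<U>0 \<union> V ` key ` heavy" "\<Union>\<V> = topspace T" by blast
  have "\<forall>U. \<exists>N\<in>null_sets coin_flips. U \<in> \<U>0 \<longrightarrow> c -` U \<subseteq> N" unfolding \<U>0_def by auto
  then have "\<forall>U. \<exists>N. N \<in> null_sets coin_flips \<and> (U \<in> \<U>0 \<longrightarrow> c -` U \<subseteq> N)" by (simp add: Bex_def)
  from choice[OF this] obtain N
    where N: "\<forall>U. N U \<in> null_sets coin_flips \<and> (U \<in> \<U>0 \<longrightarrow> c -` U \<subseteq> N U)" ..
  \<comment> \<open>Indexing by natural numbers, with the empty set outside the range of
    \<open>to_nat\<close>, permits comparison with a geometric series.\<close>
  define D where "D n = (if n \<in> range (to_nat :: nat \<times> int list \<Rightarrow> nat) then cylinder (C (from_nat n)) else {})" for n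
  have null: "(\<Union>U\<in>\<V>. N U) \<in> null_sets coin_flips"
    using \<V>(1) N by (intro null_sets_UN') auto
  have D_meas: "range D \<subseteq> sets coin_flips" by (auto simp: D_def)
  have "UNIV \<subseteq> (\<Union>U\<in>\<V>. N U) \<union> (\<Union>n. D n)"
  proof
    fix \<omega> :: "nat \<Rightarrow> bool"
    obtain U where U: "U \<in> \<V>" "c \<omega> \<in> U" using c[of \<omega>] \<V>(3) by blast
    show "\<omega> \<in> (\<Union>U\<in>\<V>. N U) \<union> (\<Union>n. D n)"
    proof (cases "U \<in> \<U>0")
      case True
      then show ?thesis using U N by blast
    next
      case False
      then obtain k where k: "U = V k" using U(1) \<V>(2) by blast
      have "\<omega> \<in> D (to_nat k)"
        using C[rule_format, of k] U(2) k by (auto simp: D_def)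
      then show ?thesis by blast
    qed
  qed
  then have "coin.prob (space coin_flips) \<le> coin.prob ((\<Union>U\<in>\<V>. N U) \<union> (\<Union>n. D n))"
    using null D_meas by (intro coin.finite_measure_mono) auto
  also have "\<dots> \<le> coin.prob (\<Union>U\<in>\<V>. N U) + coin.prob (\<Union>n. D n)"
    using null D_meas by (intro measure_Un_le) auto
  also have "coin.prob (\<Union>U\<in>\<V>. N U) = 0" using null by (rule measure_eq_0_null_sets)
  finally have 1: "1 \<le> coin.prob (\<Union>n. D n)" using coin.prob_space by simp
  have D_le: "coin.prob (D n) \<le> (1/4) * (1/2)^n" for n
  proof (cases "n \<in> range (to_nat :: nat \<times> int list \<Rightarrow> nat)")
    case True
    then obtain k :: "nat \<times> int list" where k: "n = to_nat k" by blast
    then have "coin.prob (D n) = (1/2) ^ (n + 2)"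
      using True C[rule_format, of k] by (simp add: D_def measure_cylinder)
    then show ?thesis by (simp add: power_add power2_eq_square)
  qed (simp add: D_def)
  have summable: "summable (\<lambda>n. (1/4) * (1/2::real)^n)" by (intro summable_mult summable_geometric) simp
  then have D_sum: "summable (\<lambda>n. coin.prob (D n))"
    by (rule summable_comparison_test'[of _ 0]) (use D_le in simp)
  have "coin.prob (\<Union>n. D n) \<le> (\<Sum>n. coin.prob (D n))"
    by (rule coin.finite_measure_subadditive_countably[OF D_meas D_sum])
  also have "\<dots> \<le> (\<Sum>n. (1/4) * (1/2::real)^n)"
    by (rule suminf_le[OF D_le D_sum summable])
  also have "\<dots> = 1/2" by (subst suminf_mult) (simp_all add: suminf_geometric summable_geometric)
  finally show False using 1 by simp
qed

end

section \<open>Cech-complete spaces\<close>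

lemma dense_in_meets:
  assumes "dense_in X S" "openin X U" "U \<noteq> {}"
  shows "U \<inter> S \<noteq> {}"
proof -
  obtain x where x: "x \<in> U" using assms(3) by blast
  then have "x \<in> X closure_of S"
    using assms(1) openin_subset[OF assms(2)] by (auto simp: dense_in_def)
  then show ?thesis using assms(2) x unfolding in_closure_of by blast
qed

lemma dense_inI:
  assumes "S \<subseteq> topspace X" "\<And>U. openin X U \<Longrightarrow> U \<noteq> {} \<Longrightarrow> U \<inter> S \<noteq> {}"
  shows "dense_in X S"
proof -
  have "topspace X \<subseteq> X closure_of S"
    using assms(2) unfolding subset_iff in_closure_of by blast
  then show ?thesis
    using assms(1) closure_of_subset_topspace[of X S] by (simp add: dense_in_def subset_antisym)
qed

lemma compact_space_Stone_Cech: "compact_space (Stone_Cech X)"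
  unfolding Stone_Cech_def Let_def
  by (intro closedin_compact_space compact_space_subtopology closedin_closure_of)
    (simp_all add: compact_space_product_topology compact_space_subtopology)

lemma Hausdorff_space_Stone_Cech: "Hausdorff_space (Stone_Cech X)"
  unfolding Stone_Cech_def Let_def
  by (intro Hausdorff_space_subtopology)
    (simp add: Hausdorff_space_product_topology Hausdorff_space_subtopology)

lemma continuous_map_Stone_Cech_eval: "continuous_map X (Stone_Cech X) (Stone_Cech_eval X)"
proof -
  let ?cube = "product_topology (\<lambda>_. top_of_set {0..1::real}) (unit_functions X)"
  have "continuous_map X ?cube (Stone_Cech_eval X)"
    unfolding continuous_map_componentwise
    by (auto simp: Stone_Cech_eval_def unit_functions_def continuous_functions_def)
  moreover from this have "Stone_Cech_eval X ` topspace X \<subseteq> ?cube closure_of (Stone_Cech_eval X ` topspace X)"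
    by (intro closure_of_subset) (rule continuous_map_image_subset_topspace)
  ultimately show ?thesis
    unfolding Stone_Cech_def Let_def by (intro continuous_map_into_subtopology) auto
qed

lemma Stone_Cech_eval_in_topspace:
  assumes "x \<in> topspace X" shows "Stone_Cech_eval X x \<in> topspace (Stone_Cech X)"
  by (rule subsetD[OF continuous_map_image_subset_topspace[OF continuous_map_Stone_Cech_eval] imageI[OF assms]])

text \<open>Complete regularity gives a function that is 0 at \<open>x\<close> and 1 off
  \<open>U\<close>. It is one of the coordinates of the cube, and \<open>W\<close> is the set where
  this coordinate is below 1.\<close>

lemma Stone_Cech_eval_neighbourhood:
  assumes X: "completely_regular_space X" and U: "openin X U" and x: "x \<in> U"
  shows "\<exists>W. openin (Stone_Cech X) W \<and> Stone_Cech_eval X x \<in> W \<and>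
    (\<forall>y\<in>topspace X. Stone_Cech_eval X y \<in> W \<longrightarrow> y \<in> U)"
proof -
  have xX: "x \<in> topspace X" using openin_subset[OF U] x by blast
  have "closedin X (topspace X - U)" "x \<in> topspace X - (topspace X - U)"
    using U x xX by auto
  then obtain f :: "'a \<Rightarrow> real" where f: "continuous_map X (top_of_set {0..1}) f" "f x = 0"
    "f ` (topspace X - U) \<subseteq> {1}"
    using X unfolding completely_regular_space_def by meson
  let ?f = "restrict f (topspace X)"
  have f_mem: "?f \<in> unit_functions X"
    using continuous_map_eq[OF f(1), of ?f] by (simp add: unit_functions_def continuous_functions_def)
  have "continuous_map (Stone_Cech X) (top_of_set {0..1}) (\<lambda>p. p ?f)"
    unfolding Stone_Cech_def Let_def
    by (intro continuous_map_from_subtopology continuous_map_product_projection f_mem)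
  then have "continuous_map (Stone_Cech X) euclideanreal (\<lambda>p. p ?f)"
    by (rule continuous_map_into_fulltopology)
  then have "openin (Stone_Cech X) {p\<in>topspace (Stone_Cech X). p ?f \<in> {..<1}}"
    by (rule openin_continuous_map_preimage) simp
  moreover have eval: "Stone_Cech_eval X y ?f = f y" if "y \<in> topspace X" for y
    using f_mem that by (simp add: Stone_Cech_eval_def)
  moreover have "y \<in> U" if "y \<in> topspace X" "f y < 1" for y
    using f(3) that by fastforce
  ultimately show ?thesis
    using xX f(2) Stone_Cech_eval_in_topspace[OF xX]
    by (intro exI[of _ "{p\<in>topspace (Stone_Cech X). p ?f \<in> {..<1}}"]) simp
qed

text \<open>\<open>R n V U\<close> says that the closure of \<open>V\<close> in the Stone-Cech compactification lies in the \<open>n\<close>-th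
  open set of a sequence with intersection \<open>F\<close> and meets \<open>X\<close> only inside \<open>U\<close>.\<close>

lemma Cech_complete_sieve:
  assumes X: "Cech_complete_space X" and F: "gdelta_in X F" and dense: "dense_in X F"
  shows "\<exists>R :: nat \<Rightarrow> 'a set \<Rightarrow> 'a set \<Rightarrow> bool.
    (\<forall>n U. openin X U \<longrightarrow> U \<noteq> {} \<longrightarrow> (\<exists>V. openin X V \<and> V \<noteq> {} \<and> R n V U)) \<and>
    (\<forall>n U V V'. R n V U \<longrightarrow> V' \<subseteq> V \<longrightarrow> R n V' U) \<and>
    (\<forall>n U V. R n V U \<longrightarrow> V \<subseteq> U) \<and>
    (\<forall>U. (\<forall>n. openin X (U n) \<and> U n \<noteq> {} \<and> R n (U (Suc n)) (U n)) \<longrightarrow> (\<exists>x\<in>F. \<forall>n. x \<in> U n))"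
proof -
  let ?Y = "Stone_Cech X" and ?e = "Stone_Cech_eval X"
  have reg: "completely_regular_space X" and gdelta: "gdelta_in ?Y (?e ` topspace X)"
    using X by (auto simp: Cech_complete_space_def)
  obtain O' where "\<forall>n. openin ?Y (O' n)" "\<forall>n. O' (Suc n) \<subseteq> O' n"
    and O'2: "\<Inter>(range O') = ?e ` topspace X"
    using gdelta[unfolded gdelta_in_descending] by (elim exE conjE) (rule that; assumption)
  then have O'1: "openin ?Y (O' n)" for n by simp
  obtain U' where "\<forall>n. openin X (U' n)" "\<forall>n. U' (Suc n) \<subseteq> U' n" and U'2: "\<Inter>(range U') = F"
    using F[unfolded gdelta_in_descending] by (elim exE conjE) (rule that; assumption)
  then have U'1: "openin X (U' n)" for n by simp
  note O' = O'1 O'2 and U' = U'1 U'2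
  \<comment> \<open>The union of all open sets with trace inside \<open>U\<close> has trace exactly
    \<open>U\<close>.\<close>
  have "\<exists>W. openin ?Y W \<and> (\<forall>y\<in>topspace X. ?e y \<in> W \<longleftrightarrow> y \<in> U)" if U: "openin X U" for U
  proof -
    let ?\<W> = "{W. openin ?Y W \<and> (\<forall>y\<in>topspace X. ?e y \<in> W \<longrightarrow> y \<in> U)}"
    have "openin ?Y (\<Union>?\<W>)" by (rule openin_Union) simp
    moreover have "?e y \<in> \<Union>?\<W> \<longleftrightarrow> y \<in> U" if "y \<in> topspace X" for y
      using Stone_Cech_eval_neighbourhood[OF reg U, of y] that by blast
    ultimately show ?thesis by blast
  qed
  then have "\<forall>n. \<exists>W. openin ?Y W \<and> (\<forall>y\<in>topspace X. ?e y \<in> W \<longleftrightarrow> y \<in> U' n)"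
    using U'(1) by blast
  from choice[OF this] obtain W
    where W: "\<forall>n. openin ?Y (W n) \<and> (\<forall>y\<in>topspace X. ?e y \<in> W n \<longleftrightarrow> y \<in> U' n)" ..
  \<comment> \<open>The sets \<open>O' n\<close> cut out the image of \<open>X\<close> in the
    compactification and the \<open>W n\<close> extend the open sets that cut out \<open>F\<close>
    in \<open>X\<close>, so the \<open>P n\<close> intersect exactly in the image of
    \<open>F\<close>.\<close>
  define P where "P n = O' n \<inter> W n" for n
  have P_open: "openin ?Y (P n)" for n using O'(1) W by (simp add: P_def openin_Int)
  have P_F: "?e x \<in> P n" if "x \<in> F" for x n
  proof -
    have "x \<in> topspace X" using dense that by (auto simp: dense_in_def)
    then show ?thesis using that U'(2) O'(2) W by (auto simp: P_def)
  qed
  have P_Inter: "\<exists>x\<in>F. p = ?e x" if p: "\<And>n. p \<in> P n" for p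
  proof -
    have "p \<in> \<Inter>(range O')" using p by (simp add: P_def)
    then obtain x where x: "x \<in> topspace X" "p = ?e x" unfolding O'(2) by blast
    have "x \<in> U' n" for n using p[of n] x W by (simp add: P_def)
    then have "x \<in> F" using U'(2) by blast
    then show ?thesis using x by blast
  qed
  note e_top = Stone_Cech_eval_in_topspace[of _ X]
  define R where "R n V U \<longleftrightarrow> V \<subseteq> U \<and> ?Y closure_of (?e ` V) \<subseteq> P n \<and>
      (\<forall>y\<in>topspace X. ?e y \<in> ?Y closure_of (?e ` V) \<longrightarrow> y \<in> U)" for n V U
  have 1: "\<exists>V. openin X V \<and> V \<noteq> {} \<and> R n V U" if U: "openin X U" "U \<noteq> {}" for n U
  proof -
    obtain x where x: "x \<in> U" "x \<in> F" using dense_in_meets[OF dense U] by blast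
    have xX: "x \<in> topspace X" using openin_subset[OF U(1)] x(1) by blast
    obtain Q where Q: "openin ?Y Q" "?e x \<in> Q" "\<forall>y\<in>topspace X. ?e y \<in> Q \<longrightarrow> y \<in> U"
      using Stone_Cech_eval_neighbourhood[OF reg U(1) x(1)] by blast
    \<comment> \<open>Regularity provides a closed neighbourhood \<open>C\<close> of the image of
      \<open>x\<close> inside \<open>Q \<inter> P n\<close>; it contains the closure of the image of
      the new set.\<close>
    have "regular_space ?Y"
      by (rule compact_Hausdorff_imp_regular_space[OF compact_space_Stone_Cech Hausdorff_space_Stone_Cech])
    then have "neighbourhood_base_of (closedin ?Y) ?Y"
      by (simp add: neighbourhood_base_of_closedin)
    from this[unfolded neighbourhood_base_of, rule_format,
        OF conjI[OF openin_Int[OF Q(1) P_open[of n]] IntI[OF Q(2) P_F[OF x(2)]]]]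
    obtain A C where A: "openin ?Y A" "closedin ?Y C" "?e x \<in> A" "A \<subseteq> C" "C \<subseteq> Q \<inter> P n"
      by (elim exE conjE) (rule that; assumption)
    let ?V = "{y\<in>topspace X. ?e y \<in> A}"
    have "openin X ?V"
      by (rule openin_continuous_map_preimage[OF continuous_map_Stone_Cech_eval A(1)])
    moreover have "?Y closure_of (?e ` ?V) \<subseteq> C"
      using A(2,4) by (intro closure_of_minimal) auto
    ultimately show ?thesis
      using A(3,4,5) Q(3) xX unfolding R_def by (intro exI[of _ ?V]) blast
  qed
  have 3: "\<exists>x\<in>F. \<forall>n. x \<in> U n"
    if U: "\<forall>n. openin X (U n) \<and> U n \<noteq> {} \<and> R n (U (Suc n)) (U n)" for U
  proof -
    define C where "C n = ?Y closure_of (?e ` U (Suc n))" for n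
    \<comment> \<open>The closures decrease and are nonempty, so the compactification supplies a
      common point. It lies in every \<open>P n\<close> and therefore comes from
      \<open>F\<close>.\<close>
    have "(\<Inter>n. C n) \<noteq> {}"
    proof (rule compact_space_imp_nest[OF compact_space_Stone_Cech])
      show "closedin ?Y (C n)" for n by (simp add: C_def)
      show "C n \<noteq> {}" for n
      proof -
        have "?e ` U (Suc n) \<subseteq> topspace ?Y"
          using e_top U openin_subset by blast
        then have "?e ` U (Suc n) \<subseteq> C n" unfolding C_def by (rule closure_of_subset)
        then show ?thesis using U by blast
      qed
      have "C (Suc n) \<subseteq> C n" for n
        unfolding C_def using U by (intro closure_of_mono image_mono) (simp add: R_def)
      then show "decseq C" by (intro decseq_SucI) simp
    qed
    then obtain p where p: "\<And>n. p \<in> C n" by blast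
    have "p \<in> P n" for n using p[of n] U unfolding R_def C_def by blast
    then obtain x where x: "x \<in> F" "p = ?e x" using P_Inter by blast
    have "x \<in> U n" for n
      using p[of n] x U dense unfolding R_def C_def dense_in_def by blast
    then show ?thesis using x(1) by blast
  qed
  have 2: "R n V' U" if "R n V U" "V' \<subseteq> V" for n U V V'
    using that closure_of_mono[OF image_mono[OF that(2)], of ?Y ?e] unfolding R_def by blast
  have "\<forall>n U. openin X U \<longrightarrow> U \<noteq> {} \<longrightarrow> (\<exists>V. openin X V \<and> V \<noteq> {} \<and> R n V U)"
    using 1 by simp
  moreover have "\<forall>n U V V'. R n V U \<longrightarrow> V' \<subseteq> V \<longrightarrow> R n V' U" using 2 by simp
  moreover have "\<forall>n U V. R n V U \<longrightarrow> V \<subseteq> U" by (simp add: R_def)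
  moreover have "\<forall>U. (\<forall>n. openin X (U n) \<and> U n \<noteq> {} \<and> R n (U (Suc n)) (U n)) \<longrightarrow> (\<exists>x\<in>F. \<forall>n. x \<in> U n)"
    using 3 by simp
  ultimately show ?thesis by (intro exI[of _ R] conjI)
qed

text \<open>The Baire category theorem. The sieve is used with the whole space as its G-delta set;
  each new set is also cut down by \<open>D n\<close>, which the monotonicity of \<open>R\<close>
  permits.\<close>

lemma Cech_complete_dense_INT:
  assumes X: "Cech_complete_space X" and D: "\<And>n. openin X (D n)" "\<And>n. dense_in X (D n)"
  shows "dense_in X (topspace X \<inter> (\<Inter>n::nat. D n))"
proof (rule dense_inI)
  fix U assume U: "openin X U" "U \<noteq> {}"
  have top: "gdelta_in X (topspace X)" "dense_in X (topspace X)"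
    by (simp_all add: open_imp_gdelta_in dense_in_def)
  obtain R :: "nat \<Rightarrow> 'a set \<Rightarrow> 'a set \<Rightarrow> bool" where
    R1: "\<forall>n U. openin X U \<longrightarrow> U \<noteq> {} \<longrightarrow> (\<exists>V. openin X V \<and> V \<noteq> {} \<and> R n V U)" and
    R2: "\<forall>n U V V'. R n V U \<longrightarrow> V' \<subseteq> V \<longrightarrow> R n V' U" and
    R3: "\<forall>n U V. R n V U \<longrightarrow> V \<subseteq> U" and
    R4: "\<forall>U. (\<forall>n. openin X (U n) \<and> U n \<noteq> {} \<and> R n (U (Suc n)) (U n)) \<longrightarrow> (\<exists>x\<in>topspace X. \<forall>n. x \<in> U n)"
    using Cech_complete_sieve[OF X top] by (elim exE conjE) (rule that; assumption)
  let ?P = "\<lambda>V. openin X V \<and> V \<noteq> {} \<and> V \<subseteq> U"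
  have "\<exists>f. \<forall>n. ?P (f n) \<and> (R n (f (Suc n)) (f n) \<and> f (Suc n) \<subseteq> D n)"
  proof (rule dependent_nat_choice[where P="\<lambda>_. ?P" and Q="\<lambda>n V V'. R n V' V \<and> V' \<subseteq> D n"])
    show "\<exists>V. ?P V" using U by blast
  next
    fix V n assume V: "?P V"
    then obtain V0 where V0: "openin X V0" "V0 \<noteq> {}" "R n V0 V" using R1[rule_format, of V n] by blast
    have "V0 \<subseteq> V" using R3 V0(3) by simp
    then have "?P (V0 \<inter> D n)"
      using V V0 D(1) dense_in_meets[OF D(2) V0(1,2)] by (auto simp: openin_Int)
    moreover have "R n (V0 \<inter> D n) V" using R2[rule_format, OF V0(3), of "V0 \<inter> D n"] by simp
    ultimately show "\<exists>V'. ?P V' \<and> (R n V' V \<and> V' \<subseteq> D n)"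
      by (intro exI[of _ "V0 \<inter> D n"]) simp
  qed
  then obtain f where f: "\<forall>n. ?P (f n) \<and> (R n (f (Suc n)) (f n) \<and> f (Suc n) \<subseteq> D n)" ..
  then have "\<exists>x\<in>topspace X. \<forall>n. x \<in> f n" using R4 by simp
  then obtain x where x: "x \<in> topspace X" "\<forall>n. x \<in> f n" by blast
  have "x \<in> U" "\<And>n. x \<in> D n" using f x(2) by blast+
  then show "U \<inter> (topspace X \<inter> (\<Inter>n. D n)) \<noteq> {}" using x(1) by blast
qed auto

section \<open>The Cantor scheme\<close>

lemma shrink_oscillation:
  fixes f :: "'i \<Rightarrow> 'a \<Rightarrow> real"
  assumes cont: "\<And>i. continuous_map X euclideanreal (f i)"
    and W: "openin X W" "x \<in> W" and I: "finite I" and d: "d > 0"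
  shows "\<exists>W'. openin X W' \<and> x \<in> W' \<and> W' \<subseteq> W \<and> (\<forall>i\<in>I. \<forall>y\<in>W'. \<forall>z\<in>W'. \<bar>f i y - f i z\<bar> < d)"
proof -
  let ?B = "\<lambda>i. {y\<in>topspace X. f i y \<in> ball (f i x) (d / 2)}"
  have B: "openin X (?B i)" for i
    by (rule openin_continuous_map_preimage[OF cont]) simp
  have "openin X (W \<inter> \<Inter>(?B ` I))"
    using I B by (intro openin_Int_Inter W(1)) auto
  moreover have "x \<in> W \<inter> \<Inter>(?B ` I)"
    using W openin_subset[OF W(1)] d by auto
  moreover have "\<bar>f i y - f i z\<bar> < d" if "i \<in> I" "y \<in> W \<inter> \<Inter>(?B ` I)" "z \<in> W \<inter> \<Inter>(?B ` I)" for i y z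
  proof -
    have "dist (f i x) (f i y) < d / 2" "dist (f i x) (f i z) < d / 2" using that by auto
    then show ?thesis unfolding dist_real_def by linarith
  qed
  ultimately show ?thesis by (intro exI[of _ "W \<inter> \<Inter>(?B ` I)"]) blast
qed

text \<open>If every nonempty open subset of \<open>V\<close> is split by more than
  \<open>e\<close>, a binary tree of open sets can be built in which each node is assigned a
  function that separates its two children. The sieve makes every branch meet the carrier of
  \<open>T\<close>, and the selected points form a separated Cantor family.\<close>

lemma small_oscillation_on_open:
  fixes f :: "'i \<Rightarrow> 'a \<Rightarrow> real"
  assumes X: "Cech_complete_space X" and F: "gdelta_in X (topspace T)" "dense_in X (topspace T)"
    and T: "Lindelof_space T" and lim: "limits_continuous T f"
    and cont: "\<And>i. continuous_map X euclideanreal (f i)"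
    and f01: "\<And>i x. x \<in> topspace X \<Longrightarrow> f i x \<in> {0..1}"
    and V: "openin X V" "V \<noteq> {}" and e: "e > 0"
  shows "\<exists>W. openin X W \<and> W \<noteq> {} \<and> W \<subseteq> V \<and> (\<forall>i. \<forall>x\<in>W. \<forall>y\<in>W. \<bar>f i x - f i y\<bar> \<le> e)"
proof (rule ccontr)
  assume "\<not> ?thesis"
  then have osc: "\<exists>i. \<exists>x\<in>W. \<exists>y\<in>W. \<bar>f i x - f i y\<bar> > e"
    if "openin X W" "W \<noteq> {}" "W \<subseteq> V" for W
    using that by (simp add: not_le[symmetric]) blast
  obtain R :: "nat \<Rightarrow> 'a set \<Rightarrow> 'a set \<Rightarrow> bool" where
    R1: "\<forall>n U. openin X U \<longrightarrow> U \<noteq> {} \<longrightarrow> (\<exists>V. openin X V \<and> V \<noteq> {} \<and> R n V U)" and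
    R2: "\<forall>n U V V'. R n V U \<longrightarrow> V' \<subseteq> V \<longrightarrow> R n V' U" and
    R3: "\<forall>n U V. R n V U \<longrightarrow> V \<subseteq> U" and
    R4: "\<forall>U. (\<forall>n. openin X (U n) \<and> U n \<noteq> {} \<and> R n (U (Suc n)) (U n)) \<longrightarrow> (\<exists>x\<in>topspace T. \<forall>n. x \<in> U n)"
    using Cech_complete_sieve[OF X F] by (elim exE conjE) (rule that; assumption)
  \<comment> \<open>Starting from two values more than \<open>e\<close> apart, each side is shrunk
    until its oscillation is below \<open>e / 3\<close>, so a gap of \<open>e / 3\<close> remains
    between the two sides.\<close>
  have split: "\<exists>i U. \<forall>b. openin X (U b) \<and> U b \<noteq> {} \<and> R n (U b) W \<and>
      (\<forall>x\<in>U True. \<forall>y\<in>U False. \<bar>f i x - f i y\<bar> \<ge> e / 3)"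
    if W: "openin X W" "W \<noteq> {}" "W \<subseteq> V" for W n
  proof -
    obtain W0 where W0: "openin X W0" "W0 \<noteq> {}" "R n W0 W" using R1 W by blast
    have "W0 \<subseteq> V" using R3 W0(3) W(3) by blast
    then obtain i x y where xy: "x \<in> W0" "y \<in> W0" "\<bar>f i x - f i y\<bar> > e"
      using osc[OF W0(1,2)] by blast
    obtain A where A: "openin X A" "x \<in> A" "A \<subseteq> W0" "\<forall>j\<in>{i}. \<forall>y\<in>A. \<forall>z\<in>A. \<bar>f j y - f j z\<bar> < e / 3"
      using shrink_oscillation[of X f W0 x "{i}" "e / 3", OF cont W0(1) xy(1)] e by auto
    obtain B where B: "openin X B" "y \<in> B" "B \<subseteq> W0" "\<forall>j\<in>{i}. \<forall>y\<in>B. \<forall>z\<in>B. \<bar>f j y - f j z\<bar> < e / 3"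
      using shrink_oscillation[of X f W0 y "{i}" "e / 3", OF cont W0(1) xy(2)] e by auto
    have "\<bar>f i x' - f i y'\<bar> \<ge> e / 3" if "x' \<in> A" "y' \<in> B" for x' y'
    proof -
      have "\<bar>f i x - f i x'\<bar> < e / 3" "\<bar>f i y - f i y'\<bar> < e / 3" using A B that by simp_all
      then show ?thesis using xy(3) by linarith
    qed
    moreover have "R n A W" "R n B W"
      using R2[rule_format, OF W0(3) A(3)] R2[rule_format, OF W0(3) B(3)] .
    ultimately show ?thesis
      using A B by (intro exI[of _ i] exI[of _ "\<lambda>b. if b then A else B"]) auto
  qed
  define P where "P n W \<longleftrightarrow> (\<forall>\<sigma>. length \<sigma> = n \<longrightarrow> openin X (W \<sigma>) \<and> W \<sigma> \<noteq> {} \<and> W \<sigma> \<subseteq> V)"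
    for n and W :: "bool list \<Rightarrow> 'a set"
  \<comment> \<open>Passing to level \<open>Suc n\<close> assigns functions to the nodes of length
    \<open>n\<close> and keeps all other assignments. The last clause makes every function assigned
    so far nearly constant on the new sets, which later gives continuity along branches.\<close>
  define Q where "Q n W g W' g' \<longleftrightarrow>
      (\<forall>\<sigma>. length \<sigma> \<noteq> n \<longrightarrow> g' \<sigma> = g \<sigma>) \<and>
      (\<forall>\<sigma>. length \<sigma> = n \<longrightarrow> (\<forall>b. R n (W' (\<sigma> @ [b])) (W \<sigma>)) \<and>
        (\<forall>x\<in>W' (\<sigma> @ [True]). \<forall>y\<in>W' (\<sigma> @ [False]). \<bar>f (g' \<sigma>) x - f (g' \<sigma>) y\<bar> \<ge> e / 3)) \<and>
      (\<forall>\<sigma> \<tau>. length \<sigma> \<le> n \<longrightarrow> length \<tau> = Suc n \<longrightarrow>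
        (\<forall>x\<in>W' \<tau>. \<forall>y\<in>W' \<tau>. \<bar>f (g' \<sigma>) x - f (g' \<sigma>) y\<bar> < 1 / Suc n))"
    for n W g W' and g' :: "bool list \<Rightarrow> 'i"
  have step: "\<exists>W' g'. P (Suc n) W' \<and> Q n W g W' g'" if W: "P n W" for n W g
  proof -
    have "\<forall>\<sigma>. \<exists>iU. length \<sigma> = n \<longrightarrow> (\<forall>b. openin X (snd iU b) \<and> snd iU b \<noteq> {} \<and> R n (snd iU b) (W \<sigma>) \<and>
      (\<forall>x\<in>snd iU True. \<forall>y\<in>snd iU False. \<bar>f (fst iU) x - f (fst iU) y\<bar> \<ge> e / 3))"
    proof
      fix \<sigma> :: "bool list"
      show "\<exists>iU. length \<sigma> = n \<longrightarrow> (\<forall>b. openin X (snd iU b) \<and> snd iU b \<noteq> {} \<and> R n (snd iU b) (W \<sigma>) \<and>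
        (\<forall>x\<in>snd iU True. \<forall>y\<in>snd iU False. \<bar>f (fst iU) x - f (fst iU) y\<bar> \<ge> e / 3))"
      proof (cases "length \<sigma> = n")
        case True
        then show ?thesis using split[of "W \<sigma>" n] W by (simp add: P_def)
      qed simp
    qed
    from choice[OF this] obtain iU where iU: "\<forall>\<sigma>. length \<sigma> = n \<longrightarrow>
      (\<forall>b. openin X (snd (iU \<sigma>) b) \<and> snd (iU \<sigma>) b \<noteq> {} \<and> R n (snd (iU \<sigma>) b) (W \<sigma>) \<and>
      (\<forall>x\<in>snd (iU \<sigma>) True. \<forall>y\<in>snd (iU \<sigma>) False. \<bar>f (fst (iU \<sigma>)) x - f (fst (iU \<sigma>)) y\<bar> \<ge> e / 3))" ..
    define g' where "g' \<sigma> = (if length \<sigma> = n then fst (iU \<sigma>) else g \<sigma>)" for \<sigma>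
    have "finite {\<sigma>::bool list. length \<sigma> \<le> n}"
      using finite_lists_length_le[of "UNIV::bool set" n] by simp
    then have fin: "finite (g' ` {\<sigma>. length \<sigma> \<le> n})" by simp
    have "\<forall>\<tau>. \<exists>W'. length \<tau> = Suc n \<longrightarrow> openin X W' \<and> W' \<noteq> {} \<and> W' \<subseteq> snd (iU (butlast \<tau>)) (last \<tau>) \<and>
      (\<forall>i\<in>g' ` {\<sigma>. length \<sigma> \<le> n}. \<forall>x\<in>W'. \<forall>y\<in>W'. \<bar>f i x - f i y\<bar> < 1 / Suc n)"
    proof
      fix \<tau> :: "bool list"
      show "\<exists>W'. length \<tau> = Suc n \<longrightarrow> openin X W' \<and> W' \<noteq> {} \<and> W' \<subseteq> snd (iU (butlast \<tau>)) (last \<tau>) \<and>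
        (\<forall>i\<in>g' ` {\<sigma>. length \<sigma> \<le> n}. \<forall>x\<in>W'. \<forall>y\<in>W'. \<bar>f i x - f i y\<bar> < 1 / Suc n)"
      proof (cases "length \<tau> = Suc n")
        case True
        then have U: "openin X (snd (iU (butlast \<tau>)) (last \<tau>))" "snd (iU (butlast \<tau>)) (last \<tau>) \<noteq> {}"
          using iU by simp_all
        then obtain x where "x \<in> snd (iU (butlast \<tau>)) (last \<tau>)" by blast
        from shrink_oscillation[of X f, OF cont U(1) this fin, of "1 / Suc n"] show ?thesis by auto
      qed simp
    qed
    from choice[OF this] obtain W' where W': "\<forall>\<tau>. length \<tau> = Suc n \<longrightarrow> openin X (W' \<tau>) \<and> W' \<tau> \<noteq> {} \<and>
      W' \<tau> \<subseteq> snd (iU (butlast \<tau>)) (last \<tau>) \<and>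
      (\<forall>i\<in>g' ` {\<sigma>. length \<sigma> \<le> n}. \<forall>x\<in>W' \<tau>. \<forall>y\<in>W' \<tau>. \<bar>f i x - f i y\<bar> < 1 / Suc n)" ..
    have sub: "W' (\<sigma> @ [b]) \<subseteq> snd (iU \<sigma>) b" if "length \<sigma> = n" for \<sigma> b
      using W'[rule_format, of "\<sigma> @ [b]"] that by simp
    have RW: "R n (W' (\<sigma> @ [b])) (W \<sigma>)" if "length \<sigma> = n" for \<sigma> b
      using R2[rule_format, OF _ sub[OF that]] iU that by simp
    have "P (Suc n) W'"
      unfolding P_def
    proof (intro allI impI)
      fix \<tau> :: "bool list" assume len: "length \<tau> = Suc n"
      have "W' \<tau> \<subseteq> W (butlast \<tau>)"
        using R3[rule_format, OF RW[of "butlast \<tau>" "last \<tau>"]] len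
        by (simp add: append_butlast_last_id[symmetric] del: append_butlast_last_id) (metis append_butlast_last_id length_0_conv nat.distinct(1))
      moreover have "W (butlast \<tau>) \<subseteq> V" using W len by (simp add: P_def)
      ultimately show "openin X (W' \<tau>) \<and> W' \<tau> \<noteq> {} \<and> W' \<tau> \<subseteq> V" using W' len by blast
    qed
    moreover have "Q n W g W' g'"
      unfolding Q_def
    proof (intro conjI allI impI ballI)
      fix \<sigma> :: "bool list" assume "length \<sigma> \<noteq> n"
      then show "g' \<sigma> = g \<sigma>" by (simp add: g'_def)
    next
      fix \<sigma> :: "bool list" and b assume "length \<sigma> = n"
      then show "R n (W' (\<sigma> @ [b])) (W \<sigma>)" by (rule RW)
    next
      fix \<sigma> :: "bool list" and x y
      assume "length \<sigma> = n" "x \<in> W' (\<sigma> @ [True])" "y \<in> W' (\<sigma> @ [False])"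
      then show "e / 3 \<le> \<bar>f (g' \<sigma>) x - f (g' \<sigma>) y\<bar>"
        using iU[rule_format, of \<sigma>] sub[of \<sigma>] by (simp add: g'_def subset_iff)
    next
      fix \<sigma> \<tau> :: "bool list" and x y
      assume "length \<sigma> \<le> n" "length \<tau> = Suc n" "x \<in> W' \<tau>" "y \<in> W' \<tau>"
      then show "\<bar>f (g' \<sigma>) x - f (g' \<sigma>) y\<bar> < 1 / Suc n" using W' by blast
    qed
    ultimately show ?thesis by blast
  qed
  have "\<exists>S. \<forall>n. P n (fst (S n)) \<and> Q n (fst (S n)) (snd (S n)) (fst (S (Suc n))) (snd (S (Suc n)))"
  proof (rule dependent_nat_choice[where P="\<lambda>n S. P n (fst S)"
        and Q="\<lambda>n S S'. Q n (fst S) (snd S) (fst S') (snd S')"])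
    show "\<exists>S. P 0 (fst S)" using V by (intro exI[of _ "(\<lambda>_. V, undefined)"]) (simp add: P_def)
    show "\<exists>S'. P (Suc n) (fst S') \<and> Q n (fst S) (snd S) (fst S') (snd S')" if "P n (fst S)" for S n
      using step[OF that, of "snd S"] by simp
  qed
  then obtain S where S: "\<forall>n. P n (fst (S n)) \<and> Q n (fst (S n)) (snd (S n)) (fst (S (Suc n))) (snd (S (Suc n)))" ..
  define W where "W n = fst (S n)" for n
  \<comment> \<open>The index of a node is read off at the first stage at which it has been
    assigned; afterwards it no longer changes.\<close>
  define g where "g \<sigma> = snd (S (Suc (length \<sigma>))) \<sigma>" for \<sigma>
  have S_P: "P n (W n)" and S_Q: "Q n (W n) (snd (S n)) (W (Suc n)) (snd (S (Suc n)))" for n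
    using S by (simp_all add: W_def)
  note S_Q' = S_Q[unfolded Q_def]
  have g: "snd (S (Suc n)) \<sigma> = g \<sigma>" if "length \<sigma> \<le> n" for n \<sigma>
    using that
  proof (induction n)
    case (Suc n)
    then show ?case
    proof (cases "length \<sigma> = Suc n")
      case False
      then have "snd (S (Suc (Suc n))) \<sigma> = snd (S (Suc n)) \<sigma>"
        by (rule S_Q'[THEN conjunct1, rule_format])
      then show ?thesis using Suc False by simp
    qed (simp add: g_def)
  qed (simp add: g_def)
  have W_open: "openin X (W n \<sigma>) \<and> W n \<sigma> \<noteq> {}" if "length \<sigma> = n" for n \<sigma>
    using S_P[of n] that by (simp add: P_def)
  have W_R: "R n (W (Suc n) (\<sigma> @ [b])) (W n \<sigma>)" if "length \<sigma> = n" for n \<sigma> b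
    by (rule S_Q'[THEN conjunct2, THEN conjunct1, rule_format, OF that, THEN conjunct1, rule_format])
  have W_sep: "\<bar>f (g \<sigma>) x - f (g \<sigma>) y\<bar> \<ge> e / 3"
    if "length \<sigma> = n" "x \<in> W (Suc n) (\<sigma> @ [True])" "y \<in> W (Suc n) (\<sigma> @ [False])" for n \<sigma> x y
    using S_Q'[THEN conjunct2, THEN conjunct1, rule_format, OF that(1), THEN conjunct2, rule_format, OF that(2,3)]
      g[of \<sigma> n] that(1) by simp
  have W_osc: "\<bar>f (g \<sigma>) x - f (g \<sigma>) y\<bar> < 1 / Suc n"
    if "length \<sigma> \<le> n" "length \<tau> = Suc n" "x \<in> W (Suc n) \<tau>" "y \<in> W (Suc n) \<tau>" for n \<sigma> \<tau> x y
    using S_Q'[THEN conjunct2, THEN conjunct2, rule_format, OF that] g[OF that(1)] by simp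
  have "\<forall>\<omega>. \<exists>x. x \<in> topspace T \<and> (\<forall>n. x \<in> W n (map \<omega> [0..<n]))"
  proof
    fix \<omega> :: "nat \<Rightarrow> bool"
    have "\<forall>n. openin X (W n (map \<omega> [0..<n])) \<and> W n (map \<omega> [0..<n]) \<noteq> {} \<and>
        R n (W (Suc n) (map \<omega> [0..<Suc n])) (W n (map \<omega> [0..<n]))"
    proof
      fix n
      show "openin X (W n (map \<omega> [0..<n])) \<and> W n (map \<omega> [0..<n]) \<noteq> {} \<and>
          R n (W (Suc n) (map \<omega> [0..<Suc n])) (W n (map \<omega> [0..<n]))"
        using W_open[of "map \<omega> [0..<n]" n] W_R[of "map \<omega> [0..<n]" n "\<omega> n"] by simp
    qed
    from mp[OF spec[OF R4, of "\<lambda>n. W n (map \<omega> [0..<n])"] this]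
    show "\<exists>x. x \<in> topspace T \<and> (\<forall>n. x \<in> W n (map \<omega> [0..<n]))" by blast
  qed
  from choice[OF this] obtain c
    where c: "\<forall>\<omega>. c \<omega> \<in> topspace T \<and> (\<forall>n. c \<omega> \<in> W n (map \<omega> [0..<n]))" ..
  have TX: "topspace T \<subseteq> topspace X" using F(2) by (simp add: dense_in_def)
  have "separated_Cantor_family T (\<lambda>\<sigma>. f (g \<sigma>)) c (e / 3)"
  proof
    show "Lindelof_space T" by fact
    show "limits_continuous T (\<lambda>\<sigma>. f (g \<sigma>))" by (rule limits_continuous_reindex[OF lim])
    show "f (g \<sigma>) x \<in> {0..1}" if "x \<in> topspace T" for \<sigma> x using f01 that TX by blast
    show "c \<omega> \<in> topspace T" for \<omega> using c by simp
    show "e / 3 > 0" using e by simp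
    show "prefix_continuous (\<lambda>\<omega>. f (g \<sigma>) (c \<omega>))" for \<sigma>
      unfolding prefix_continuous_def
    proof (intro allI impI)
      fix \<delta> :: real assume "\<delta> > 0"
      then obtain m where m: "1 / Suc m < \<delta>" using nat_approx_posE by blast
      \<comment> \<open>The oscillation bound at level \<open>Suc n\<close> covers only nodes of
        length at most \<open>n\<close>, hence the maximum.\<close>
      define n where "n = max m (length \<sigma>)"
      have "1 / Suc n \<le> 1 / Suc m" by (simp add: n_def field_simps)
      then have n: "1 / Suc n < \<delta>" using m by simp
      have "\<bar>f (g \<sigma>) (c \<omega>) - f (g \<sigma>) (c \<omega>')\<bar> < \<delta>" if "\<forall>j<Suc n. \<omega> j = \<omega>' j" for \<omega> \<omega>'
      proof -
        have "map \<omega>' [0..<Suc n] = map \<omega> [0..<Suc n]" using that by (simp del: upt_Suc)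
        then have "c \<omega> \<in> W (Suc n) (map \<omega> [0..<Suc n])" "c \<omega>' \<in> W (Suc n) (map \<omega> [0..<Suc n])"
          using c by metis+
        then show ?thesis
          using W_osc[of \<sigma> n "map \<omega> [0..<Suc n]"] n by (fastforce simp: n_def simp del: upt_Suc)
      qed
      then show "\<exists>k. \<forall>\<omega> \<omega>'. (\<forall>j<k. \<omega> j = \<omega>' j) \<longrightarrow> \<bar>f (g \<sigma>) (c \<omega>) - f (g \<sigma>) (c \<omega>')\<bar> < \<delta>"
        by blast
    qed
    \<comment> \<open>All nodes of length at most \<open>k\<close> are used. Once the first
      \<open>j\<close> bits agree, both points lie in children of the same node, and different
      children would be separated by \<open>e / 3\<close>.\<close>
    show "\<exists>I. finite I \<and> (\<forall>\<omega> \<omega>'. (\<forall>\<sigma>\<in>I. \<bar>f (g \<sigma>) (c \<omega>) - f (g \<sigma>) (c \<omega>')\<bar> < e / 3) \<longrightarrow> (\<forall>j<k. \<omega> j = \<omega>' j))" for k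
    proof (intro exI[of _ "{\<sigma>. length \<sigma> \<le> k}"] conjI allI impI)
      show "finite {\<sigma>::bool list. length \<sigma> \<le> k}"
        using finite_lists_length_le[of "UNIV::bool set" k] by simp
      fix \<omega> \<omega>' :: "nat \<Rightarrow> bool" and j
      assume close: "\<forall>\<sigma>\<in>{\<sigma>. length \<sigma> \<le> k}. \<bar>f (g \<sigma>) (c \<omega>) - f (g \<sigma>) (c \<omega>')\<bar> < e / 3"
      assume "j < k"
      then show "\<omega> j = \<omega>' j"
      proof (induction j rule: less_induct)
        case (less j)
        let ?\<sigma> = "map \<omega> [0..<j]"
        have \<sigma>: "map \<omega>' [0..<j] = ?\<sigma>" using less by simp
        have mem: "c \<omega> \<in> W (Suc j) (?\<sigma> @ [\<omega> j])" "c \<omega>' \<in> W (Suc j) (?\<sigma> @ [\<omega>' j])"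
          using c[rule_format, of \<omega>, THEN conjunct2, rule_format, of "Suc j"] c[rule_format, of \<omega>', THEN conjunct2, rule_format, of "Suc j"] \<sigma> by simp_all
        have "\<bar>f (g ?\<sigma>) (c \<omega>) - f (g ?\<sigma>) (c \<omega>')\<bar> < e / 3" using close less.prems by simp
        then show ?case
          using W_sep[of ?\<sigma> j "c \<omega>" "c \<omega>'"] W_sep[of ?\<sigma> j "c \<omega>'" "c \<omega>"] mem
          by (cases "\<omega> j"; cases "\<omega>' j") (auto simp: abs_minus_commute)
      qed
    qed
  qed
  then show False by (rule separated_Cantor_family.contradiction)
qed

section \<open>Oscillation, equicontinuity and the weak topology\<close>

text \<open>A non-strict real bound, unlike the strict bound on extended diameters, passes to
  closures of the set and to pointwise limits of the functions.\<close>

definition oscillation_le :: "'b metric \<Rightarrow> ('a \<Rightarrow> 'b) set \<Rightarrow> 'a set \<Rightarrow> real \<Rightarrow> bool" where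
  "oscillation_le M G U \<epsilon> \<longleftrightarrow> (\<forall>g\<in>G. \<forall>x\<in>U. \<forall>y\<in>U. mdist M (g x) (g y) \<le> \<epsilon>)"

lemma oscillation_leD:
  "oscillation_le M G U \<epsilon> \<Longrightarrow> g \<in> G \<Longrightarrow> x \<in> U \<Longrightarrow> y \<in> U \<Longrightarrow> mdist M (g x) (g y) \<le> \<epsilon>"
  by (simp add: oscillation_le_def)

text \<open>Halving the error recovers the strict diameter bound, since a supremum of distances may
  attain the non-strict one.\<close>

lemma equicontinuity_point_iff:
  "equicontinuity_point X M G x \<longleftrightarrow>
    x \<in> topspace X \<and> (\<forall>\<epsilon>>0. \<exists>U. openin X U \<and> x \<in> U \<and> oscillation_le M G U \<epsilon>)"
proof -
  have 1: "oscillation_le M G U \<epsilon>" if "\<forall>g\<in>G. mdiameter M (g ` U) < ennreal \<epsilon>" for U \<epsilon>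
    unfolding oscillation_le_def
  proof (intro ballI)
    fix g x y assume "g \<in> G" "x \<in> U" "y \<in> U"
    then have "ennreal (mdist M (g x) (g y)) \<le> mdiameter M (g ` U)"
      unfolding mdiameter_def by (intro SUP_upper2[of "(g x, g y)"]) auto
    also have "\<dots> < ennreal \<epsilon>" using that \<open>g \<in> G\<close> by blast
    finally show "mdist M (g x) (g y) \<le> \<epsilon>" by (simp add: ennreal_less_iff)
  qed
  have 2: "mdiameter M (g ` U) < ennreal \<epsilon>" if "oscillation_le M G U (\<epsilon> / 2)" "g \<in> G" "\<epsilon> > 0" for U g \<epsilon>
  proof -
    have "mdiameter M (g ` U) \<le> ennreal (\<epsilon> / 2)"
      unfolding mdiameter_def using that by (intro SUP_least) (auto intro!: ennreal_leI simp: oscillation_le_def)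
    also have "\<dots> < ennreal \<epsilon>" using that(3) by (simp add: ennreal_less_iff)
    finally show ?thesis .
  qed
  have "(\<exists>U. openin X U \<and> x \<in> U \<and> (\<forall>g\<in>G. mdiameter M (g ` U) < ennreal \<epsilon>))"
    if "\<forall>\<epsilon>>0. \<exists>U. openin X U \<and> x \<in> U \<and> oscillation_le M G U \<epsilon>" "\<epsilon> > 0" for \<epsilon>
    using that(1)[rule_format, of "\<epsilon> / 2"] that(2) 2 by auto
  then show ?thesis
    unfolding equicontinuity_point_def using 1 by meson
qed

text \<open>Open sets whose intersection over \<open>n\<close> is the set of equicontinuity points;
  this is how that set is seen to be a G-delta.\<close>

definition small_oscillation_set :: "'a topology \<Rightarrow> 'b metric \<Rightarrow> ('a \<Rightarrow> 'b) set \<Rightarrow> nat \<Rightarrow> 'a set" where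
  "small_oscillation_set X M G n = \<Union>{U. openin X U \<and> oscillation_le M G U (1 / Suc n)}"

lemma openin_small_oscillation_set [simp]: "openin X (small_oscillation_set X M G n)"
  unfolding small_oscillation_set_def by (rule openin_Union) simp

lemma in_small_oscillation_set:
  "x \<in> small_oscillation_set X M G n \<longleftrightarrow> (\<exists>U. openin X U \<and> x \<in> U \<and> oscillation_le M G U (1 / Suc n))"
  unfolding small_oscillation_set_def by blast

lemma equicontinuity_points_eq:
  "{x. equicontinuity_point X M G x} = topspace X \<inter> (\<Inter>n. small_oscillation_set X M G n)"
proof (intro set_eqI iffI)
  fix x assume "x \<in> {x. equicontinuity_point X M G x}"
  then show "x \<in> topspace X \<inter> (\<Inter>n. small_oscillation_set X M G n)"
    by (simp add: equicontinuity_point_iff in_small_oscillation_set)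
next
  fix x assume x: "x \<in> topspace X \<inter> (\<Inter>n. small_oscillation_set X M G n)"
  have "\<exists>U. openin X U \<and> x \<in> U \<and> oscillation_le M G U \<epsilon>" if "\<epsilon> > 0" for \<epsilon>
  proof -
    obtain n where n: "1 / Suc n < \<epsilon>" using \<open>\<epsilon> > 0\<close> nat_approx_posE by blast
    have "x \<in> small_oscillation_set X M G n" using x by blast
    then obtain U where "openin X U" "x \<in> U" "oscillation_le M G U (1 / Suc n)"
      unfolding in_small_oscillation_set by blast
    moreover from this have "oscillation_le M G U \<epsilon>"
      using n unfolding oscillation_le_def by (meson less_imp_le order_trans)
    ultimately show ?thesis by blast
  qed
  then show "x \<in> {x. equicontinuity_point X M G x}"
    using x by (simp add: equicontinuity_point_iff)
qed

lemma gdelta_in_equicontinuity_points: "gdelta_in X {x. equicontinuity_point X M G x}"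
proof -
  have "gdelta_in X (\<Inter>(insert (topspace X) (range (small_oscillation_set X M G))))"
    by (rule gdelta_in_Inter) (auto intro: open_imp_gdelta_in)
  then show ?thesis by (simp add: equicontinuity_points_eq)
qed

lemma mdist_self: "x \<in> mspace M \<Longrightarrow> mdist M x x = 0"
  by simp

lemma openin_mball_preimage:
  assumes "continuous_map X (mtopology_of M) g"
  shows "openin X {y\<in>topspace X. g y \<in> mball_of M a r}"
  by (rule openin_continuous_map_preimage[OF assms])
    (simp add: mball_of_def mtopology_of_def Metric_space.openin_mball)

lemma mdist_le_of_approx:
  assumes "\<And>\<delta>. \<delta> > 0 \<Longrightarrow> \<exists>u\<in>mspace M. \<exists>v\<in>mspace M. mdist M a u < \<delta> \<and> mdist M b v < \<delta> \<and> mdist M u v \<le> \<epsilon>"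
    and a: "a \<in> mspace M" and b: "b \<in> mspace M"
  shows "mdist M a b \<le> \<epsilon>"
proof (rule field_le_epsilon)
  fix \<delta> :: real assume "\<delta> > 0"
  then obtain u v where uv: "u \<in> mspace M" "v \<in> mspace M" "mdist M a u < \<delta> / 2" "mdist M b v < \<delta> / 2"
    "mdist M u v \<le> \<epsilon>"
    using assms(1)[of "\<delta> / 2"] by auto
  have "mdist M a b \<le> mdist M a u + mdist M u b" using a b uv by (intro mdist_triangle)
  moreover have "mdist M u b \<le> mdist M u v + mdist M v b" using b uv by (intro mdist_triangle)
  moreover have "mdist M v b = mdist M b v" by (rule mdist_commute)
  ultimately show "mdist M a b \<le> \<epsilon> + \<delta>" using uv by linarith
qed

text \<open>By continuity, the values of \<open>g\<close> at points of the closure are approximated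
  by its values on \<open>A\<close>.\<close>

lemma oscillation_le_closure_of:
  assumes G: "\<And>g. g \<in> G \<Longrightarrow> continuous_map X (mtopology_of M) g" and A: "oscillation_le M G A \<epsilon>"
  shows "oscillation_le M G (X closure_of A) \<epsilon>"
  unfolding oscillation_le_def
proof (intro ballI)
  fix g x y assume g: "g \<in> G" and xy: "x \<in> X closure_of A" "y \<in> X closure_of A"
  have g_in: "g z \<in> mspace M" if "z \<in> topspace X" for z
    using continuous_map_image_subset_topspace[OF G[OF g]] that by auto
  have top: "x \<in> topspace X" "y \<in> topspace X" using xy by (simp_all add: in_closure_of)
  have near: "\<exists>z\<in>A. z \<in> topspace X \<and> mdist M (g w) (g z) < \<delta>"
    if "w \<in> X closure_of A" "\<delta> > 0" for w \<delta>
  proof -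
    have "w \<in> topspace X" using that by (simp add: in_closure_of)
    then have "w \<in> {y\<in>topspace X. g y \<in> mball_of M (g w) \<delta>}" using g_in that(2) by (simp add: mdist_self)
    then show ?thesis
      using that(1) openin_mball_preimage[OF G[OF g], of "g w" \<delta>] unfolding in_closure_of
      by (metis (no_types, lifting) in_mball_of mem_Collect_eq)
  qed
  show "mdist M (g x) (g y) \<le> \<epsilon>"
  proof (rule mdist_le_of_approx)
    fix \<delta> :: real assume \<delta>: "\<delta> > 0"
    obtain u where u: "u \<in> A" "u \<in> topspace X" "mdist M (g x) (g u) < \<delta>" using near[OF xy(1) \<delta>] by blast
    obtain v where v: "v \<in> A" "v \<in> topspace X" "mdist M (g y) (g v) < \<delta>" using near[OF xy(2) \<delta>] by blast
    show "\<exists>u\<in>mspace M. \<exists>v\<in>mspace M. mdist M (g x) u < \<delta> \<and> mdist M (g y) v < \<delta> \<and> mdist M u v \<le> \<epsilon>"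
      using u v g_in oscillation_leD[OF A g u(1) v(1)]
      by (intro bexI[of _ "g u"] bexI[of _ "g v"]) auto
  qed (use top g_in in auto)
qed

lemma pointwise_closure_in_mspace:
  assumes "h \<in> pointwise_closure X M G" "x \<in> topspace X" shows "h x \<in> mspace M"
proof -
  have "h \<in> topspace (pointwise_topology (topspace X) M)"
    using assms(1) by (simp add: pointwise_closure_def in_closure_of)
  then show ?thesis using assms(2) by auto
qed

text \<open>The bound at a fixed pair of points is a closed condition on the function. Thus
  \<open>G\<close> and its pointwise closure have the same moduli.\<close>

lemma oscillation_le_pointwise_closure:
  assumes S: "S \<subseteq> topspace X" and G: "oscillation_le M G S \<epsilon>"
  shows "oscillation_le M (pointwise_closure X M G) S \<epsilon>"
  unfolding oscillation_le_def
proof (intro ballI)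
  fix h x y assume h: "h \<in> pointwise_closure X M G" and xy: "x \<in> S" "y \<in> S"
  let ?Z = "pointwise_topology (topspace X) M"
  have top: "x \<in> topspace X" "y \<in> topspace X" using xy S by auto
  note h_in = pointwise_closure_in_mspace[OF h]
  show "mdist M (h x) (h y) \<le> \<epsilon>"
  proof (rule mdist_le_of_approx)
    fix \<delta> :: real assume "\<delta> > 0"
    have "openin ?Z {f\<in>topspace ?Z. f z \<in> mball_of M (h z) \<delta>}" if "z \<in> topspace X" for z
      using that by (intro openin_mball_preimage continuous_map_product_projection)
    then have "openin ?Z ({f\<in>topspace ?Z. f x \<in> mball_of M (h x) \<delta>} \<inter> {f\<in>topspace ?Z. f y \<in> mball_of M (h y) \<delta>})"
      using top by (intro openin_Int) simp_all
    moreover have "h \<in> {f\<in>topspace ?Z. f x \<in> mball_of M (h x) \<delta>} \<inter> {f\<in>topspace ?Z. f y \<in> mball_of M (h y) \<delta>}"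
      using h h_in top \<open>\<delta> > 0\<close> by (simp add: pointwise_closure_def in_closure_of mdist_self)
    moreover have "h \<in> ?Z closure_of G" using h by (simp add: pointwise_closure_def)
    ultimately obtain g where g: "g \<in> G"
      "g \<in> {f\<in>topspace ?Z. f x \<in> mball_of M (h x) \<delta>} \<inter> {f\<in>topspace ?Z. f y \<in> mball_of M (h y) \<delta>}"
      unfolding in_closure_of by meson
    show "\<exists>u\<in>mspace M. \<exists>v\<in>mspace M. mdist M (h x) u < \<delta> \<and> mdist M (h y) v < \<delta> \<and> mdist M u v \<le> \<epsilon>"
      using g(2) oscillation_leD[OF G g(1) xy]
      by (intro bexI[of _ "g x"] bexI[of _ "g y"]) auto
  qed (use top h_in in auto)
qed

section \<open>Weak topologies and separability for uniform convergence\<close>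

lemma topspace_weak_topology [simp]: "topspace (weak_topology F H Y) = F"
  unfolding weak_topology_def by auto

lemma openin_weak_topology:
  "f \<in> H \<Longrightarrow> openin Y U \<Longrightarrow> openin (weak_topology F H Y) {x\<in>F. f x \<in> U}"
  unfolding weak_topology_def by (intro topology_generated_by_Basis) blast

text \<open>The pseudometric of uniform closeness over \<open>H\<close> induces a topology at least
  as fine as the weak one. The property is checked on the subbase and is preserved by finite
  intersections and arbitrary unions.\<close>

lemma weak_topology_ball:
  assumes H: "\<And>h x. h \<in> H \<Longrightarrow> x \<in> F \<Longrightarrow> h x \<in> mspace M"
    and V: "openin (weak_topology F (restrict_functions H F) (mtopology_of M)) V" and x: "x \<in> V"
  shows "\<exists>\<epsilon>>0. \<forall>y\<in>F. (\<forall>h\<in>H. mdist M (h x) (h y) < \<epsilon>) \<longrightarrow> y \<in> V"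
proof -
  let ?S = "insert F {{x\<in>F. f x \<in> U} | f U. f \<in> restrict_functions H F \<and> openin (mtopology_of M) U}"
  have "generate_topology_on ?S V"
    using V unfolding weak_topology_def openin_topology_generated_by_iff .
  then have "\<forall>x\<in>V. \<exists>\<epsilon>>0. \<forall>y\<in>F. (\<forall>h\<in>H. mdist M (h x) (h y) < \<epsilon>) \<longrightarrow> y \<in> V"
  proof induction
    case (Int a b)
    show ?case
    proof
      fix x assume "x \<in> a \<inter> b"
      then obtain r s where "r > 0" "s > 0"
        "\<forall>y\<in>F. (\<forall>h\<in>H. mdist M (h x) (h y) < r) \<longrightarrow> y \<in> a"
        "\<forall>y\<in>F. (\<forall>h\<in>H. mdist M (h x) (h y) < s) \<longrightarrow> y \<in> b"
        using Int.IH by blast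
      then show "\<exists>\<epsilon>>0. \<forall>y\<in>F. (\<forall>h\<in>H. mdist M (h x) (h y) < \<epsilon>) \<longrightarrow> y \<in> a \<inter> b"
        by (intro exI[of _ "min r s"]) simp
    qed
  next
    case (UN K)
    then show ?case by (meson UnionE UnionI)
  next
    case (Basis s)
    show ?case
    proof
      fix x assume x: "x \<in> s"
      show "\<exists>\<epsilon>>0. \<forall>y\<in>F. (\<forall>h\<in>H. mdist M (h x) (h y) < \<epsilon>) \<longrightarrow> y \<in> s"
      proof (cases "s = F")
        case True
        then show ?thesis by (intro exI[of _ 1]) simp
      next
        case False
        then obtain h U where h: "h \<in> H" "s = {x\<in>F. restrict h F x \<in> U}" "openin (mtopology_of M) U"
          using Basis unfolding restrict_functions_def by blast
        have hx: "h x \<in> U" "x \<in> F" using x h(2) by auto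
        obtain r where r: "r > 0" "mball_of M (h x) r \<subseteq> U"
          using h(3) hx(1) unfolding mtopology_of_def mball_of_def
          using Metric_space.openin_mtopology[OF Metric_space_mspace_mdist] by metis
        have "y \<in> s" if "y \<in> F" "\<forall>h\<in>H. mdist M (h x) (h y) < r" for y
        proof -
          have "h y \<in> mball_of M (h x) r" using that h(1) H hx(2) by simp
          then show ?thesis using r(2) h(2) that(1) by auto
        qed
        then show ?thesis using r(1) by blast
      qed
    qed
  qed simp
  then show ?thesis using x by blast
qed

text \<open>Separability of \<open>E\<close> for the pseudometric of uniform closeness over
  \<open>H\<close>, written without the supremum, which might be infinite.\<close>

definition uniformly_separable :: "'b metric \<Rightarrow> ('a \<Rightarrow> 'b) set \<Rightarrow> 'a set \<Rightarrow> bool" where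
  "uniformly_separable M H E \<longleftrightarrow>
    (\<exists>Q. countable Q \<and> Q \<subseteq> E \<and> (\<forall>x\<in>E. \<forall>\<epsilon>>0. \<exists>q\<in>Q. \<forall>h\<in>H. mdist M (h x) (h q) \<le> \<epsilon>))"

text \<open>Countably many balls have centre in \<open>Q\<close> and radius
  \<open>1 / Suc n\<close>. Those contained in a member of the cover already cover \<open>E\<close>,
  because weakly open sets contain balls around their points; one member is chosen for each such
  ball.\<close>

lemma uniformly_separable_imp_Lindelof:
  assumes H: "\<And>h x. h \<in> H \<Longrightarrow> x \<in> E \<Longrightarrow> h x \<in> mspace M" and sep: "uniformly_separable M H E"
  shows "Lindelof_space (weak_topology E (restrict_functions H E) (mtopology_of M))"
    (is "Lindelof_space ?T")
  unfolding Lindelof_space_alt topspace_weak_topology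
proof (intro allI impI)
  fix \<U> assume \<U>: "(\<forall>U\<in>\<U>. openin ?T U) \<and> E \<subseteq> \<Union>\<U>"
  obtain Q where Q: "countable Q" "Q \<subseteq> E" "\<forall>x\<in>E. \<forall>\<epsilon>>0. \<exists>q\<in>Q. \<forall>h\<in>H. mdist M (h x) (h q) \<le> \<epsilon>"
    using sep unfolding uniformly_separable_def by blast
  define B where "B q n = {y\<in>E. \<forall>h\<in>H. mdist M (h q) (h y) \<le> 1 / Suc n}" for q and n :: nat
  define I where "I = {(q, n). q \<in> Q \<and> (\<exists>V\<in>\<U>. B q n \<subseteq> V)}"
  have "countable I"
    by (rule countable_subset[of _ "Q \<times> UNIV"]) (use Q(1) in \<open>auto simp: I_def\<close>)
  have "\<forall>p. \<exists>V. p \<in> I \<longrightarrow> V \<in> \<U> \<and> B (fst p) (snd p) \<subseteq> V" by (auto simp: I_def)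
  from choice[OF this] obtain V where V: "\<forall>p. p \<in> I \<longrightarrow> V p \<in> \<U> \<and> B (fst p) (snd p) \<subseteq> V p" ..
  have "x \<in> \<Union>(V ` I)" if x: "x \<in> E" for x
  proof -
    obtain W where W: "W \<in> \<U>" "x \<in> W" using x \<U> by blast
    have "openin ?T W" using \<U> W(1) by simp
    have "\<exists>r>0. \<forall>y\<in>E. (\<forall>h\<in>H. mdist M (h x) (h y) < r) \<longrightarrow> y \<in> W"
      by (rule weak_topology_ball[of H E M W x]) (use H \<open>openin ?T W\<close> W(2) in auto)
    then obtain r where r: "r > 0" "\<forall>y\<in>E. (\<forall>h\<in>H. mdist M (h x) (h y) < r) \<longrightarrow> y \<in> W" by blast
    obtain n where n: "1 / Suc n < r / 2" using nat_approx_posE[of "r / 2"] r(1) by auto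
    obtain q where q: "q \<in> Q" "\<forall>h\<in>H. mdist M (h x) (h q) \<le> 1 / Suc n" using Q(3)[rule_format, OF x, of "1 / Suc n"] by auto
    have "y \<in> W" if "y \<in> B q n" for y
    proof -
      have "mdist M (h x) (h y) < r" if h: "h \<in> H" for h
      proof -
        have "mdist M (h x) (h y) \<le> mdist M (h x) (h q) + mdist M (h q) (h y)"
          using H h x q(1) Q(2) \<open>y \<in> B q n\<close> by (intro mdist_triangle) (auto simp: B_def)
        moreover have "mdist M (h q) (h y) \<le> 1 / Suc n" using h \<open>y \<in> B q n\<close> by (simp add: B_def)
        moreover have "mdist M (h x) (h q) \<le> 1 / Suc n" using q(2) h by simp
        ultimately show ?thesis using n by linarith
      qed
      then show ?thesis using r(2) that by (simp add: B_def)
    qed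
    then have I: "(q, n) \<in> I" using q(1) W(1) unfolding I_def by blast
    have "x \<in> B q n" using x q(2) by (simp add: B_def mdist_commute)
    then have "x \<in> V (q, n)" using V[rule_format, OF I] by auto
    then show ?thesis using I by blast
  qed
  then show "\<exists>\<V>. countable \<V> \<and> \<V> \<subseteq> \<U> \<and> E \<subseteq> \<Union>\<V>"
    using \<open>countable I\<close> V by (intro exI[of _ "V ` I"] conjI subsetI) (simp, blast, blast)
qed

section \<open>Metrizability and the three conditions\<close>

lemma continuous_map_restrict_product:
  assumes "J \<subseteq> I"
  shows "continuous_map (product_topology Y I) (product_topology Y J) (\<lambda>h. restrict h J)"
  unfolding continuous_map_componentwise
  using assms by (auto intro!: continuous_map_product_projection)

lemma compactin_restrict_functions:
  assumes "compactin (pointwise_topology S M) K" "F \<subseteq> S"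
  shows "compactin (pointwise_topology F M) (restrict_functions K F)"
  unfolding restrict_functions_def
  by (rule image_compactin[OF assms(1) continuous_map_restrict_product[OF assms(2)]])

text \<open>Functions in \<open>K\<close> are determined on \<open>E\<close> by their values on the
  countable set \<open>Q\<close>. Restriction to \<open>Q\<close> is therefore a continuous
  injection of a compact space into a countable power of \<open>M\<close>, hence an
  embedding.\<close>

lemma uniformly_separable_imp_metrizable:
  assumes K: "compactin (pointwise_topology S M) K" and E: "E \<subseteq> S" and sep: "uniformly_separable M K E"
  shows "metrizable_space (subtopology (pointwise_topology E M) (restrict_functions K E))"
    (is "metrizable_space ?Z")
proof -
  have comp: "compactin (pointwise_topology E M) (restrict_functions K E)"
    by (rule compactin_restrict_functions[OF K E])
  then have Z_comp: "compact_space ?Z" by (simp add: compact_space_subtopology)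
  have Z_top: "topspace ?Z = restrict_functions K E"
    using compactin_subset_topspace[OF comp] by auto
  have K_in: "h x \<in> mspace M" if "h \<in> K" "x \<in> S" for h x
    using compactin_subset_topspace[OF K] that by auto
  obtain Q where Q: "countable Q" "Q \<subseteq> E" "\<forall>x\<in>E. \<forall>\<epsilon>>0. \<exists>q\<in>Q. \<forall>h\<in>K. mdist M (h x) (h q) \<le> \<epsilon>"
    using sep unfolding uniformly_separable_def by blast
  let ?Y = "pointwise_topology Q M"
  have M: "metrizable_space (mtopology_of M)"
    unfolding mtopology_of_def by (rule Metric_space.metrizable_space_mtopology) simp
  have Y: "metrizable_space ?Y"
    unfolding metrizable_space_product_topology using M countable_subset[OF _ Q(1)] by simp
  have "continuous_map ?Z ?Y (\<lambda>h. restrict h Q)"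
    by (intro continuous_map_from_subtopology continuous_map_restrict_product Q(2))
  moreover have "inj_on (\<lambda>h. restrict h Q) (topspace ?Z)"
  proof (rule inj_onI)
    fix h1 h2 assume h: "h1 \<in> topspace ?Z" "h2 \<in> topspace ?Z" "restrict h1 Q = restrict h2 Q"
    obtain k1 k2 where k: "k1 \<in> K" "k2 \<in> K" "h1 = restrict k1 E" "h2 = restrict k2 E"
      using h(1,2)[unfolded Z_top] unfolding restrict_functions_def by blast
    have eq: "k1 q = k2 q" if "q \<in> Q" for q
      using fun_cong[OF h(3), of q] that Q(2) k(3,4) by auto
    have "k1 x = k2 x" if x: "x \<in> E" for x
    proof -
      have in_M: "k1 x \<in> mspace M" "k2 x \<in> mspace M" using K_in k x E by auto
      have "mdist M (k1 x) (k2 x) \<le> 0"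
      proof (rule field_le_epsilon)
        fix \<epsilon> :: real assume "\<epsilon> > 0"
        then obtain q where q: "q \<in> Q" "\<forall>h\<in>K. mdist M (h x) (h q) \<le> \<epsilon> / 2"
          using Q(3)[rule_format, OF x, of "\<epsilon> / 2"] by auto
        have "k1 q \<in> mspace M" using K_in k(1) q(1) Q(2) E by blast
        then have "mdist M (k1 x) (k2 x) \<le> mdist M (k1 x) (k1 q) + mdist M (k1 q) (k2 x)"
          using in_M by (intro mdist_triangle)
        moreover have "mdist M (k1 q) (k2 x) = mdist M (k2 x) (k2 q)"
          using eq[OF q(1)] by (simp add: mdist_commute)
        ultimately show "mdist M (k1 x) (k2 x) \<le> 0 + \<epsilon>"
          using bspec[OF q(2) k(1)] bspec[OF q(2) k(2)] by linarith
      qed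
      then show ?thesis using in_M by (metis mdist_nonneg mdist_zero order_antisym)
    qed
    then show "h1 = h2" using k(3,4) by (auto simp: restrict_def)
  qed
  ultimately have "embedding_map ?Z ?Y (\<lambda>h. restrict h Q)"
    by (intro continuous_imp_embedding_map Z_comp metrizable_imp_Hausdorff_space[OF Y])
  then have "?Z homeomorphic_space subtopology ?Y ((\<lambda>h. restrict h Q) ` topspace ?Z)"
    by (rule embedding_map_imp_homeomorphic_space)
  then show ?thesis
    using homeomorphic_metrizable_space metrizable_space_subtopology[OF Y] by blast
qed

text \<open>The balls of radius \<open>1 / Suc n\<close> around finite nets of the same fineness
  form a countable base.\<close>

lemma compact_metrizable_imp_second_countable:
  assumes Z: "compact_space Z" "metrizable_space Z"
  shows "second_countable Z"
proof -
  obtain S d where Sd: "Metric_space S d" "Z = Metric_space.mtopology S d"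
    using Z(2) unfolding metrizable_space_def by blast
  interpret Metric_space S d by (rule Sd(1))
  have "compactin mtopology S" using Z(1) Sd(2) by (simp add: compact_space_def)
  then have "mtotally_bounded S" by (rule compactin_imp_mtotally_bounded)
  then have "\<forall>n::nat. \<exists>K. finite K \<and> K \<subseteq> S \<and> S \<subseteq> (\<Union>x\<in>K. mball x (1 / Suc n))"
    unfolding mtotally_bounded_def by simp
  from choice[OF this] obtain K
    where K: "\<forall>n. finite (K n) \<and> K n \<subseteq> S \<and> S \<subseteq> (\<Union>x\<in>K n. mball x (1 / Suc n))" ..
  define \<B> where "\<B> = (\<Union>n. (\<lambda>x. mball x (1 / Suc n)) ` K n)"
  have "countable \<B>" unfolding \<B>_def using K by (intro countable_UN) (auto intro: countable_finite)
  moreover have "openin Z V" if "V \<in> \<B>" for V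
    using that by (auto simp: \<B>_def Sd(2))
  moreover have "\<exists>V\<in>\<B>. x \<in> V \<and> V \<subseteq> U" if U: "openin Z U" "x \<in> U" for U x
  proof -
    have xS: "x \<in> S" using openin_subset[OF U(1)] U(2) by (auto simp: Sd(2))
    obtain r where r: "r > 0" "mball x r \<subseteq> U"
      using U unfolding Sd(2) openin_mtopology by blast
    obtain n where n: "1 / Suc n < r / 2" using nat_approx_posE[of "r / 2"] r(1) by auto
    obtain k where k: "k \<in> K n" "x \<in> mball k (1 / Suc n)" using K xS by blast
    have "y \<in> mball x r" if y: "y \<in> mball k (1 / Suc n)" for y
    proof -
      have "d x y \<le> d x k + d k y" using k(2) y by (intro triangle) auto
      moreover have "d x k < 1 / Suc n" "d k y < 1 / Suc n" using k(2) y by (simp_all add: commute)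
      ultimately show ?thesis using n y xS by auto
    qed
    then have "mball k (1 / Suc n) \<subseteq> U" using r(2) by blast
    then show ?thesis using k unfolding \<B>_def by blast
  qed
  ultimately show ?thesis unfolding second_countable_def by blast
qed

text \<open>The key of \<open>x\<close> encodes a finite cover of \<open>K\<close> by basic open sets on which the evaluation at \<open>x\<close> is
  nearly constant, together with approximate values in a countable dense subset of \<open>M\<close>.\<close>

lemma countable_keys:
  assumes K: "compactin (pointwise_topology S M) K" and F: "F \<subseteq> S"
    and M: "separable_space (mtopology_of M)" and \<epsilon>: "\<epsilon> > 0"
    and metr: "metrizable_space (subtopology (pointwise_topology F M) (restrict_functions K F))"
  shows "\<exists>\<kappa> :: 'a \<Rightarrow> nat. \<forall>x\<in>F. \<forall>y\<in>F. \<kappa> x = \<kappa> y \<longrightarrow> (\<forall>h\<in>K. mdist M (h x) (h y) \<le> \<epsilon>)"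
proof -
  let ?Z = "subtopology (pointwise_topology F M) (restrict_functions K F)"
  have comp: "compactin (pointwise_topology F M) (restrict_functions K F)"
    by (rule compactin_restrict_functions[OF K F])
  then have Z_comp: "compact_space ?Z" by (simp add: compact_space_subtopology)
  have Z_top: "topspace ?Z = restrict_functions K F"
    using compactin_subset_topspace[OF comp] by auto
  obtain \<B> where \<B>: "countable \<B>" "\<forall>V\<in>\<B>. openin ?Z V"
    "\<forall>U x. openin ?Z U \<and> x \<in> U \<longrightarrow> (\<exists>V\<in>\<B>. x \<in> V \<and> V \<subseteq> U)"
    using compact_metrizable_imp_second_countable[OF Z_comp metr] unfolding second_countable_def
    by (elim exE conjE) (rule that; assumption)
  obtain D where D: "countable D" "D \<subseteq> mspace M" "mtopology_of M closure_of D = mspace M"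
    using M unfolding separable_space_def by auto
  have ev: "continuous_map ?Z (mtopology_of M) (\<lambda>h. h x)" if "x \<in> F" for x
    using that by (intro continuous_map_from_subtopology continuous_map_product_projection)
  define good where "good x N \<longleftrightarrow> finite N \<and> N \<subseteq> \<B> \<times> D \<and> topspace ?Z \<subseteq> \<Union>(fst ` N) \<and>
      (\<forall>(V, p)\<in>N. \<forall>h\<in>V. mdist M p (h x) < \<epsilon> / 2)" for x N
  have "\<exists>N. good x N" if x: "x \<in> F" for x
  proof -
    let ?C = "{V\<in>\<B>. \<exists>p\<in>D. \<forall>h\<in>V. mdist M p (h x) < \<epsilon> / 2}"
    have "topspace ?Z \<subseteq> \<Union>?C"
    proof
      fix h assume h: "h \<in> topspace ?Z"
      have "h x \<in> mspace M"
        using continuous_map_image_subset_topspace[OF ev[OF x]] h by auto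
      then have "h x \<in> mtopology_of M closure_of D" using D(3) by simp
      moreover have "openin (mtopology_of M) (mball_of M (h x) (\<epsilon> / 2))"
        by (simp add: mball_of_def mtopology_of_def Metric_space.openin_mball)
      moreover have "h x \<in> mball_of M (h x) (\<epsilon> / 2)" using \<open>h x \<in> mspace M\<close> \<epsilon> by (simp add: mdist_self)
      ultimately obtain p where p: "p \<in> D" "p \<in> mball_of M (h x) (\<epsilon> / 2)"
        unfolding in_closure_of by meson
      have "openin ?Z {k\<in>topspace ?Z. k x \<in> mball_of M p (\<epsilon> / 2)}"
        by (rule openin_mball_preimage[OF ev[OF x]])
      moreover have "h \<in> {k\<in>topspace ?Z. k x \<in> mball_of M p (\<epsilon> / 2)}"
        using h p(2) by (simp add: mdist_commute)
      ultimately obtain V where V: "V \<in> \<B>" "h \<in> V" "V \<subseteq> {k\<in>topspace ?Z. k x \<in> mball_of M p (\<epsilon> / 2)}"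
        using \<B>(3) by meson
      then have "\<forall>h\<in>V. mdist M p (h x) < \<epsilon> / 2" by auto
      then show "h \<in> \<Union>?C" using V(1,2) p(1) by blast
    qed
    moreover have "\<forall>V\<in>?C. openin ?Z V" using \<B>(2) by blast
    moreover have "compactin ?Z (topspace ?Z)" using Z_comp by (simp add: compact_space_def)
    ultimately have "\<exists>\<F>. finite \<F> \<and> \<F> \<subseteq> ?C \<and> topspace ?Z \<subseteq> \<Union>\<F>"
      unfolding compactin_def by meson
    then obtain \<F> where \<F>: "finite \<F>" "\<F> \<subseteq> ?C" "topspace ?Z \<subseteq> \<Union>\<F>" by blast
    have "\<forall>V. \<exists>p. V \<in> \<F> \<longrightarrow> p \<in> D \<and> (\<forall>h\<in>V. mdist M p (h x) < \<epsilon> / 2)" using \<F>(2) by blast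
    from choice[OF this] obtain p where p: "\<forall>V. V \<in> \<F> \<longrightarrow> p V \<in> D \<and> (\<forall>h\<in>V. mdist M (p V) (h x) < \<epsilon> / 2)" ..
    have "good x ((\<lambda>V. (V, p V)) ` \<F>)"
      unfolding good_def using \<F> p by (auto simp: image_image)
    then show ?thesis ..
  qed
  then have "\<forall>x. \<exists>N. x \<in> F \<longrightarrow> good x N" by simp
  from choice[OF this] obtain N where N: "\<forall>x. x \<in> F \<longrightarrow> good x (N x)" ..
  \<comment> \<open>All candidate covers are finite subsets of one countable set, so they can be
    coded injectively by natural numbers.\<close>
  let ?\<N> = "{N. finite N \<and> N \<subseteq> \<B> \<times> D}"
  have count: "countable ?\<N>"
    using \<B>(1) D(1) countable_Collect_finite_subset[of "\<B> \<times> D"] by simp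
  have N_in: "N x \<in> ?\<N>" if "x \<in> F" for x using N that by (simp add: good_def)
  have close: "mdist M (h x) (h y) \<le> \<epsilon>"
    if xy: "x \<in> F" "y \<in> F" "to_nat_on ?\<N> (N x) = to_nat_on ?\<N> (N y)" and h: "h \<in> K" for x y h
  proof -
    have eq: "N x = N y"
      using xy(3) to_nat_on_inj[OF count N_in[OF xy(1)] N_in[OF xy(2)]] by simp
    have "restrict h F \<in> restrict_functions K F" using h by (auto simp: restrict_functions_def)
    then have "restrict h F \<in> topspace ?Z" by (simp only: Z_top)
    moreover have gx: "good x (N x)" and gy: "good y (N x)" using N xy(1,2) eq by auto
    ultimately have "restrict h F \<in> \<Union>(fst ` N x)" unfolding good_def by (meson subsetD)
    \<comment> \<open>Since \<open>x\<close> and \<open>y\<close> share their cover, the piece that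
      contains the restriction of \<open>h\<close> carries one value \<open>p\<close> that
      approximates both \<open>h x\<close> and \<open>h y\<close>.\<close>
    then obtain c where c: "c \<in> N x" "restrict h F \<in> fst c" by blast
    obtain V p where Vp: "c = (V, p)" by (cases c)
    have D_p: "p \<in> D" using gx c(1) Vp unfolding good_def by (meson mem_Sigma_iff subsetD)
    have "mdist M p (restrict h F x) < \<epsilon> / 2"
      using gx c Vp unfolding good_def by (metis (no_types, lifting) case_prodD fst_conv)
    moreover have "mdist M p (restrict h F y) < \<epsilon> / 2"
      using gy c Vp unfolding good_def by (metis (no_types, lifting) case_prodD fst_conv)
    ultimately have *: "mdist M p (h x) < \<epsilon> / 2" "mdist M p (h y) < \<epsilon> / 2" using xy(1,2) by simp_all
    have in_M: "h x \<in> mspace M" "h y \<in> mspace M" "p \<in> mspace M"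
      using subsetD[OF compactin_subset_topspace[OF K] h] xy(1,2) F D(2) D_p by auto
    have "mdist M (h x) (h y) \<le> mdist M (h x) p + mdist M p (h y)"
      using in_M by (intro mdist_triangle)
    then show ?thesis using * xy(1,2) mdist_commute[of M "h x" p] by simp
  qed
  show ?thesis
  proof (intro exI[of _ "\<lambda>x. to_nat_on ?\<N> (N x)"] ballI impI)
    fix x y h
    assume "x \<in> F" "y \<in> F" "to_nat_on ?\<N> (N x) = to_nat_on ?\<N> (N y)" "h \<in> K"
    then show "mdist M (h x) (h y) \<le> \<epsilon>" by (rule close)
  qed
qed


section \<open>Baire category, separability of the equicontinuity points, and the
  implications\<close>

lemma dense_in_trans:
  assumes "dense_in X F" "dense_in (subtopology X F) D"
  shows "dense_in X D"
proof (rule dense_inI)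
  have FX: "topspace (subtopology X F) = F" using assms(1) by (auto simp: dense_in_def)
  then have DF: "D \<subseteq> F" using assms(2) by (simp add: dense_in_def)
  then show "D \<subseteq> topspace X" using assms(1) by (auto simp: dense_in_def)
  fix U assume U: "openin X U" "U \<noteq> {}"
  have "openin (subtopology X F) (F \<inter> U)" using U(1) by (simp add: openin_subtopology_Int2)
  moreover have "F \<inter> U \<noteq> {}" using dense_in_meets[OF assms(1) U] by blast
  ultimately have "F \<inter> U \<inter> D \<noteq> {}" by (rule dense_in_meets[OF assms(2)])
  then show "U \<inter> D \<noteq> {}" by blast
qed

lemma dense_in_superset:
  assumes "dense_in X D" "D \<subseteq> S" "S \<subseteq> topspace X" shows "dense_in X S"
  using dense_in_meets[OF assms(1)] assms(2,3) by (intro dense_inI) blast+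

lemma Cech_complete_dense_Inter:
  assumes X: "Cech_complete_space X" and "countable \<D>" "\<And>D. D \<in> \<D> \<Longrightarrow> openin X D \<and> dense_in X D"
  shows "dense_in X (topspace X \<inter> \<Inter>\<D>)"
proof -
  \<comment> \<open>Adding the whole space makes the family nonempty, so that
    \<open>from_nat_into\<close> enumerates it.\<close>
  let ?D = "insert (topspace X) \<D>"
  have c: "countable ?D" "?D \<noteq> {}" using assms(2) by auto
  have D: "openin X D \<and> dense_in X D" if "D \<in> ?D" for D
    using that assms(3) by (auto simp: dense_in_def)
  have "dense_in X (topspace X \<inter> (\<Inter>n. from_nat_into ?D n))"
    using D[OF from_nat_into[OF c(2)]] by (intro Cech_complete_dense_INT[OF X]) auto
  moreover have "topspace X \<inter> (\<Inter>n. from_nat_into ?D n) = topspace X \<inter> \<Inter>\<D>"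
    using range_from_nat_into[OF c(2,1)] by auto
  ultimately show ?thesis by simp
qed

text \<open>Dense open subsets of \<open>E\<close> are traces of open sets that are dense in
  \<open>X\<close>. Together with the \<open>D n\<close> these are countably many dense open sets,
  to which the category theorem for \<open>X\<close> applies.\<close>

lemma Baire_space_dense_gdelta:
  assumes X: "Cech_complete_space X" and E: "E = topspace X \<inter> (\<Inter>n::nat. D n)" "\<And>n. openin X (D n)"
    and dense: "dense_in X E"
  shows "Baire_space (subtopology X E)"
  unfolding Baire_space_def
proof (intro allI impI)
  let ?S = "subtopology X E"
  fix \<U> assume \<U>: "countable \<U> \<and> (\<forall>U\<in>\<U>. openin ?S U \<and> dense_in ?S U)"
  have "\<forall>U. \<exists>U'. U \<in> \<U> \<longrightarrow> openin X U' \<and> U = U' \<inter> E"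
    using \<U> unfolding openin_subtopology by blast
  from choice[OF this] obtain V where V: "\<forall>U. U \<in> \<U> \<longrightarrow> openin X (V U) \<and> U = V U \<inter> E" ..
  have S_top: "topspace ?S = E" using E(1) by auto
  have 1: "openin X (D n) \<and> dense_in X (D n)" for n
    using dense_in_superset[OF dense _ openin_subset[OF E(2)], of n] E by blast
  have 2: "openin X (V U) \<and> dense_in X (V U)" if "U \<in> \<U>" for U
  proof -
    have "dense_in X U" using dense_in_trans[OF dense] \<U> that by blast
    moreover have "openin X (V U)" "U \<subseteq> V U" using V that by auto
    ultimately show ?thesis using dense_in_superset openin_subset by blast
  qed
  have G: "dense_in X (topspace X \<inter> \<Inter>(range D \<union> V ` \<U>))"
    using \<U> 1 2 by (intro Cech_complete_dense_Inter[OF X]) auto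
  show "dense_in ?S (topspace ?S \<inter> \<Inter>\<U>)"
  proof (rule dense_inI)
    fix W assume W: "openin ?S W" "W \<noteq> {}"
    obtain W' where W': "openin X W'" "W = W' \<inter> E" using W(1) unfolding openin_subtopology by blast
    then have "W' \<noteq> {}" using W(2) by blast
    from dense_in_meets[OF G W'(1) this] obtain x
      where x: "x \<in> W'" "x \<in> topspace X" "\<forall>n. x \<in> D n" "\<forall>U\<in>\<U>. x \<in> V U" by auto
    then have xE: "x \<in> E" using E(1) by simp
    then have "\<forall>U\<in>\<U>. x \<in> U" using x(4) V by blast
    then show "W \<inter> (topspace ?S \<inter> \<Inter>\<U>) \<noteq> {}" using W'(2) x(1) xE S_top by blast
  qed auto
qed

text \<open>For each error, the level sets of the key split \<open>F\<close> into countably many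
  pieces on which all functions oscillate little. Category makes the interiors of their closures
  dense, so equicontinuity points are dense; one point per occurring key gives separability.\<close>

lemma Baire_imp_uniformly_separable:
  assumes G: "\<And>g. g \<in> G \<Longrightarrow> continuous_map X (mtopology_of M) g"
    and GK: "G \<subseteq> pointwise_closure X M G"
    and F: "dense_in X F" and Baire: "Baire_space (subtopology X F)"
    and keys: "\<And>\<epsilon>. \<epsilon> > 0 \<Longrightarrow> \<exists>\<kappa> :: 'a \<Rightarrow> nat. \<forall>x\<in>F. \<forall>y\<in>F. \<kappa> x = \<kappa> y \<longrightarrow>
      (\<forall>h\<in>pointwise_closure X M G. mdist M (h x) (h y) \<le> \<epsilon>)"
    and E_def: "E = {x. equicontinuity_point X M G x}"
  shows "dense_in X E \<and> uniformly_separable M (pointwise_closure X M G) E"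
proof -
  let ?K = "pointwise_closure X M G" and ?S = "subtopology X F"
  let ?O = "small_oscillation_set X M G"
  have FX: "F \<subseteq> topspace X" using F by (simp add: dense_in_def)
  then have S_top: "topspace ?S = F" by auto
  have E: "E = topspace X \<inter> (\<Inter>n. ?O n)" unfolding E_def by (rule equicontinuity_points_eq)
  have "\<forall>n::nat. \<exists>\<kappa> :: 'a \<Rightarrow> nat. \<forall>x\<in>F. \<forall>y\<in>F. \<kappa> x = \<kappa> y \<longrightarrow> (\<forall>h\<in>?K. mdist M (h x) (h y) \<le> 1 / Suc n)"
    using keys by simp
  from choice[OF this] obtain \<kappa> :: "nat \<Rightarrow> 'a \<Rightarrow> nat" where
    \<kappa>: "\<forall>n. \<forall>x\<in>F. \<forall>y\<in>F. \<kappa> n x = \<kappa> n y \<longrightarrow> (\<forall>h\<in>?K. mdist M (h x) (h y) \<le> 1 / Suc n)" ..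
  have dense_O: "openin ?S (F \<inter> ?O n) \<and> dense_in ?S (F \<inter> ?O n)" for n
  proof
    show "openin ?S (F \<inter> ?O n)" by (simp add: openin_subtopology_Int2)
    define A where "A k = {x\<in>F. \<kappa> n x = k}" for k
    define C where "C k = ?S closure_of A k" for k
    \<comment> \<open>Removing the boundary of the closed set \<open>C k\<close> leaves a dense open
      set. A point that avoids all these boundaries is interior to the closure of its own level
      set.\<close>
    define D where "D k = topspace ?S - (C k - ?S interior_of C k)" for k
    have D_open: "openin ?S (D k)" for k
      unfolding D_def C_def
      by (intro openin_diff openin_topspace closedin_diff closedin_closure_of openin_interior_of)
    have D_dense: "dense_in ?S (D k)" for k
    proof (rule dense_inI)
      show "D k \<subseteq> topspace ?S" by (auto simp: D_def)
      fix U assume U: "openin ?S U" "U \<noteq> {}"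
      show "U \<inter> D k \<noteq> {}"
      proof
        assume "U \<inter> D k = {}"
        then have *: "U \<subseteq> C k - ?S interior_of C k" using openin_subset[OF U(1)] unfolding D_def by blast
        then have "U \<subseteq> ?S interior_of C k" using U(1) by (intro interior_of_maximal) auto
        then show False using * U(2) by blast
      qed
    qed
    have dense: "dense_in ?S (topspace ?S \<inter> \<Inter>(range D))"
      by (rule Baire[unfolded Baire_space_def, rule_format]) (use D_open D_dense in auto)
    have "x \<in> F \<inter> ?O n" if x: "x \<in> topspace ?S \<inter> \<Inter>(range D)" for x
    proof -
      let ?k = "\<kappa> n x"
      have xF: "x \<in> F" using x S_top by simp
      have "A ?k \<subseteq> C ?k" unfolding C_def by (rule closure_of_subset) (simp only: S_top, auto simp: A_def)
      then have "x \<in> C ?k" using xF by (auto simp: A_def)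
      moreover have "x \<in> D ?k" using x by blast
      ultimately have "x \<in> ?S interior_of C ?k" unfolding D_def by blast
      then obtain J where J: "openin ?S J" "x \<in> J" "J \<subseteq> C ?k" unfolding interior_of_def by blast
      then obtain U where U: "openin X U" "J = U \<inter> F" unfolding openin_subtopology by blast
      \<comment> \<open>Density of \<open>F\<close> passes from closure in \<open>F\<close> to
        closure in \<open>X\<close>, so the oscillation bound holds on a neighbourhood that is open
        in \<open>X\<close>.\<close>
      have U_sub: "U \<subseteq> X closure_of (A ?k)"
      proof
        fix u assume u: "u \<in> U"
        have "\<exists>y\<in>A ?k. y \<in> W" if W: "openin X W" "u \<in> W" for W
        proof -
          have "openin X (W \<inter> U)" "W \<inter> U \<noteq> {}" using W U(1) u by (auto simp: openin_Int)
          from dense_in_meets[OF F this] obtain z where z: "z \<in> W" "z \<in> U" "z \<in> F" by blast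
          then have "z \<in> C ?k" using J(3) U(2) by blast
          moreover have "openin ?S (F \<inter> W)" using W(1) by (simp add: openin_subtopology_Int2)
          moreover have "z \<in> F \<inter> W" using z by simp
          ultimately show ?thesis unfolding C_def in_closure_of by blast
        qed
        then show "u \<in> X closure_of (A ?k)"
          using openin_subset[OF U(1)] u unfolding in_closure_of by blast
      qed
      have "oscillation_le M G (A ?k) (1 / Suc n)"
        unfolding oscillation_le_def
      proof (intro ballI)
        fix g y z assume g: "g \<in> G" and yz: "y \<in> A ?k" "z \<in> A ?k"
        have "\<kappa> n y = \<kappa> n z" "y \<in> F" "z \<in> F" using yz by (simp_all add: A_def)
        then show "mdist M (g y) (g z) \<le> 1 / Suc n" using \<kappa> g GK by blast
      qed
      from oscillation_le_closure_of[OF G this] have "oscillation_le M G U (1 / Suc n)"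
        using U_sub unfolding oscillation_le_def by blast
      then have "x \<in> ?O n" using U J(2) unfolding in_small_oscillation_set by blast
      then show ?thesis using xF by simp
    qed
    then show "dense_in ?S (F \<inter> ?O n)"
      by (intro dense_in_superset[OF dense]) (use S_top in auto)
  qed
  have "dense_in ?S (topspace ?S \<inter> \<Inter>(range (\<lambda>n. F \<inter> ?O n)))"
    by (rule Baire[unfolded Baire_space_def, rule_format]) (use dense_O in auto)
  moreover have "topspace ?S \<inter> \<Inter>(range (\<lambda>n. F \<inter> ?O n)) = F \<inter> E"
    using FX by (auto simp: E)
  ultimately have FE: "dense_in X (F \<inter> E)" using dense_in_trans[OF F] by simp
  have dense_E: "dense_in X E"
    using dense_in_superset[OF FE, of E] E by blast
  \<comment> \<open>Only keys that occur on \<open>F \<inter> E\<close> are kept, so the chosen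
    representatives lie in \<open>E\<close>.\<close>
  define P where "P = {(n, \<kappa> n z) | n z. z \<in> F \<inter> E}"
  have "\<forall>p. \<exists>z. p \<in> P \<longrightarrow> z \<in> F \<inter> E \<and> \<kappa> (fst p) z = snd p" by (auto simp: P_def)
  from choice[OF this] obtain q where q: "\<forall>p. p \<in> P \<longrightarrow> q p \<in> F \<inter> E \<and> \<kappa> (fst p) (q p) = snd p" ..
  have "uniformly_separable M ?K E"
    unfolding uniformly_separable_def
  proof (intro exI[of _ "q ` P"] conjI ballI allI impI)
    have "countable P" by (rule countable_subset[of _ UNIV]) auto
    then show "countable (q ` P)" by simp
    show "q ` P \<subseteq> E" using q by auto
    fix x and \<epsilon> :: real assume x: "x \<in> E" and \<epsilon>: "\<epsilon> > 0"
    obtain n where n: "1 / Suc n < \<epsilon> / 2" using nat_approx_posE[of "\<epsilon> / 2"] \<epsilon> by auto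
    have "x \<in> ?O n" using x E by blast
    then obtain U where U: "openin X U" "x \<in> U" "oscillation_le M G U (1 / Suc n)"
      unfolding in_small_oscillation_set by blast
    \<comment> \<open>Keys control only points of \<open>F\<close>, and \<open>x\<close> may lie
      outside it. A nearby \<open>z\<close> in \<open>F \<inter> E\<close> links \<open>x\<close> to
      a representative.\<close>
    then obtain z where z: "z \<in> U" "z \<in> F \<inter> E" using dense_in_meets[OF FE U(1)] by blast
    have p: "(n, \<kappa> n z) \<in> P" using z(2) by (auto simp: P_def)
    let ?q = "q (n, \<kappa> n z)"
    have q': "?q \<in> F" "\<kappa> n ?q = \<kappa> n z" using q[rule_format, OF p] by auto
    have UX: "U \<subseteq> topspace X" by (rule openin_subset[OF U(1)])
    have "mdist M (h x) (h ?q) \<le> \<epsilon>" if h: "h \<in> ?K" for h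
    proof -
      have in_M: "h x \<in> mspace M" "h z \<in> mspace M" "h ?q \<in> mspace M"
        using pointwise_closure_in_mspace[OF h] UX U(2) z(1) q'(1) FX by auto
      have "mdist M (h x) (h z) \<le> 1 / Suc n"
        by (rule oscillation_leD[OF oscillation_le_pointwise_closure[OF UX U(3)] h U(2) z(1)])
      moreover have "mdist M (h z) (h ?q) \<le> 1 / Suc n"
        using \<kappa>[rule_format, of z ?q n h] z(2) q' h by simp
      moreover have "mdist M (h x) (h ?q) \<le> mdist M (h x) (h z) + mdist M (h z) (h ?q)"
        using in_M by (intro mdist_triangle)
      ultimately show ?thesis using n by linarith
    qed
    then show "\<exists>q\<in>q ` P. \<forall>h\<in>?K. mdist M (h x) (h q) \<le> \<epsilon>" using p by blast
  qed
  then show ?thesis using dense_E by simp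
qed

text \<open>For every \<open>n\<close> the subspace \<open>E\<close> is covered by open sets of
  small oscillation. One point from each nonempty member of a countable subcover gives the dense
  set.\<close>

lemma hereditarily_Lindelof_imp_uniformly_separable:
  assumes X: "hereditarily Lindelof_space X" and E_def: "E = {x. equicontinuity_point X M G x}"
  shows "uniformly_separable M (pointwise_closure X M G) E"
proof -
  let ?O = "small_oscillation_set X M G"
  have E: "E = topspace X \<inter> (\<Inter>n. ?O n)" unfolding E_def by (rule equicontinuity_points_eq)
  have L: "Lindelof_space (subtopology X E)"
    by (rule X[unfolded hereditarily_def, rule_format]) (simp add: E)
  have S_top: "topspace (subtopology X E) = E" using E by auto
  have "\<forall>n::nat. \<exists>\<V>. countable \<V> \<and> \<V> \<subseteq> {U \<inter> E | U. openin X U \<and> oscillation_le M G U (1 / Suc n)} \<and> \<Union>\<V> = E"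
  proof
    fix n :: nat
    let ?\<U> = "{U \<inter> E | U. openin X U \<and> oscillation_le M G U (1 / Suc n)}"
    have EO: "E \<subseteq> ?O n" by (simp add: E le_infI2 INF_lower)
    have "\<Union>?\<U> = ?O n \<inter> E" unfolding small_oscillation_set_def by blast
    then have "\<Union>?\<U> = topspace (subtopology X E)"
      by (simp only: S_top Int_absorb1[OF EO])
    moreover have "openin (subtopology X E) W" if "W \<in> ?\<U>" for W
      using that unfolding openin_subtopology by blast
    ultimately have "\<exists>\<V>. countable \<V> \<and> \<V> \<subseteq> ?\<U> \<and> \<Union>\<V> = topspace (subtopology X E)"
      by (intro Lindelof_spaceD[OF L])
    then show "\<exists>\<V>. countable \<V> \<and> \<V> \<subseteq> ?\<U> \<and> \<Union>\<V> = E" by (simp only: S_top)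
  qed
  from choice[OF this] obtain \<V> where \<V>: "\<forall>n::nat. countable (\<V> n) \<and>
    \<V> n \<subseteq> {U \<inter> E | U. openin X U \<and> oscillation_le M G U (1 / Suc n)} \<and> \<Union>(\<V> n) = E" ..
  define pick where "pick V = (SOME x. x \<in> V)" for V :: "'a set"
  have pick: "pick V \<in> V" if "x \<in> V" for x V unfolding pick_def using that by (rule someI)
  show ?thesis
    unfolding uniformly_separable_def
  proof (intro exI[of _ "\<Union>n. pick ` (\<V> n - {{}})"] conjI ballI allI impI)
    show "countable (\<Union>n. pick ` (\<V> n - {{}}))" using \<V> by (intro countable_UN) auto
    show "(\<Union>n. pick ` (\<V> n - {{}})) \<subseteq> E"
    proof
      fix y assume "y \<in> (\<Union>n. pick ` (\<V> n - {{}}))"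
      then obtain n V where V: "V \<in> \<V> n" "V \<noteq> {}" "y = pick V" by blast
      then have "y \<in> V" using pick by blast
      then show "y \<in> E" using V(1) \<V> by blast
    qed
    fix x and \<epsilon> :: real assume x: "x \<in> E" and \<epsilon>: "\<epsilon> > 0"
    obtain n where n: "1 / Suc n < \<epsilon>" using nat_approx_posE \<epsilon> by blast
    obtain V where V: "V \<in> \<V> n" "x \<in> V" using \<V> x by blast
    then obtain U where U: "openin X U" "oscillation_le M G U (1 / Suc n)" "V = U \<inter> E" using \<V> by blast
    have "oscillation_le M (pointwise_closure X M G) U (1 / Suc n)"
      by (rule oscillation_le_pointwise_closure[OF openin_subset[OF U(1)] U(2)])
    then have "mdist M (h x) (h (pick V)) \<le> 1 / Suc n" if "h \<in> pointwise_closure X M G" for h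
      using that V(2) pick[OF V(2)] U(3) by (intro oscillation_leD) auto
    then have "\<forall>h\<in>pointwise_closure X M G. mdist M (h x) (h (pick V)) \<le> \<epsilon>"
      using n by force
    then show "\<exists>q\<in>\<Union>n. pick ` (\<V> n - {{}}). \<forall>h\<in>pointwise_closure X M G. mdist M (h x) (h q) \<le> \<epsilon>"
      using V by blast
  qed
qed

text \<open>Compactness gives a limit \<open>h\<close> in \<open>K\<close> of the \<open>g i\<close>
  along a subfilter. The points \<open>p i\<close> need not converge: distance to a point is
  1-Lipschitz, so \<open>\<phi>\<close> varies between \<open>x\<close> and \<open>y\<close> by at
  most the distance from \<open>h x\<close> to \<open>h y\<close>, and \<open>h\<close> is weakly
  continuous.\<close>

lemma limits_continuous_weak_topology:
  assumes K: "compactin (pointwise_topology S M) K" and F: "F \<subseteq> S"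
    and g: "\<And>i. g i \<in> K" and p: "\<And>i. p i \<in> mspace M"
  shows "limits_continuous (weak_topology F (restrict_functions K F) (mtopology_of M))
    (\<lambda>i x. min 1 (mdist M (g i x) (p i)))" (is "limits_continuous ?T ?f")
  unfolding limits_continuous_def topspace_weak_topology
proof (intro allI impI)
  fix G \<phi> assume G: "G \<noteq> bot" and \<phi>: "\<forall>x\<in>F. ((\<lambda>i. min 1 (mdist M (g i x) (p i))) \<longlongrightarrow> \<phi> x) G"
  obtain G' h where G': "G' \<le> G" "G' \<noteq> bot" and h: "h \<in> K" "limitin (pointwise_topology S M) g h G'"
    using compactin_subfilter[OF K G, of g] g by blast
  have K_in: "k x \<in> mspace M" if "k \<in> K" "x \<in> S" for k x
    using compactin_subset_topspace[OF K] that by auto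
  have near: "\<forall>\<^sub>F i in G'. mdist M (h x) (g i x) < d" if "x \<in> S" "d > 0" for x d
  proof -
    have "limitin (mtopology_of M) (\<lambda>i. g i x) (h x) G'"
      using h(2) that(1) by (simp add: limitin_componentwise)
    moreover have "openin (mtopology_of M) (mball_of M (h x) d)"
      by (simp add: mball_of_def mtopology_of_def Metric_space.openin_mball)
    moreover have "h x \<in> mball_of M (h x) d" using K_in[OF h(1) that(1)] that(2) by (simp add: mdist_self)
    ultimately have "\<forall>\<^sub>F i in G'. g i x \<in> mball_of M (h x) d" unfolding limitin_def by blast
    then show ?thesis by (rule eventually_mono) simp
  qed
  have \<phi>_lip: "\<bar>\<phi> x - \<phi> y\<bar> \<le> mdist M (h x) (h y)" if xy: "x \<in> F" "y \<in> F" for x y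
  proof (rule field_le_epsilon)
    fix d :: real assume d: "d > 0"
    have xyS: "x \<in> S" "y \<in> S" using xy F by auto
    have "((\<lambda>i. \<bar>?f i x - ?f i y\<bar>) \<longlongrightarrow> \<bar>\<phi> x - \<phi> y\<bar>) G'"
      using \<phi> xy by (intro tendsto_rabs tendsto_diff tendsto_mono[OF G'(1)]) auto
    moreover have "\<forall>\<^sub>F i in G'. \<bar>?f i x - ?f i y\<bar> \<le> mdist M (h x) (h y) + d"
    proof (rule eventually_mono)
      show "\<forall>\<^sub>F i in G'. mdist M (h x) (g i x) < d / 2 \<and> mdist M (h y) (g i y) < d / 2"
        using d by (intro eventually_conj near xyS) simp_all
      fix i assume *: "mdist M (h x) (g i x) < d / 2 \<and> mdist M (h y) (g i y) < d / 2"
      have in_M: "g i x \<in> mspace M" "g i y \<in> mspace M" "h x \<in> mspace M" "h y \<in> mspace M"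
        using K_in g h(1) xyS by auto
      have "mdist M (g i x) (p i) \<le> mdist M (g i x) (g i y) + mdist M (g i y) (p i)"
        "mdist M (g i y) (p i) \<le> mdist M (g i y) (g i x) + mdist M (g i x) (p i)"
        "mdist M (g i x) (g i y) \<le> mdist M (g i x) (h x) + mdist M (h x) (g i y)"
        "mdist M (h x) (g i y) \<le> mdist M (h x) (h y) + mdist M (h y) (g i y)"
        using in_M p by (auto intro!: mdist_triangle)
      moreover have "mdist M (g i x) (h x) = mdist M (h x) (g i x)" "mdist M (g i y) (g i x) = mdist M (g i x) (g i y)"
        by (rule mdist_commute)+
      ultimately show "\<bar>?f i x - ?f i y\<bar> \<le> mdist M (h x) (h y) + d"
        using * by (auto simp: min_def abs_if)
    qed
    ultimately show "\<bar>\<phi> x - \<phi> y\<bar> \<le> mdist M (h x) (h y) + d"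
      using G'(2) by (intro tendsto_upperbound)
  qed
  have "openin ?T {x\<in>F. \<phi> x \<in> U}" if U: "open U" for U
  proof (subst openin_subopen, intro ballI)
    fix x assume x: "x \<in> {x\<in>F. \<phi> x \<in> U}"
    then obtain d where d: "d > 0" "ball (\<phi> x) d \<subseteq> U" using U open_contains_ball by blast
    let ?W = "{y\<in>F. restrict h F y \<in> mball_of M (h x) d}"
    have "openin ?T ?W"
    proof (rule openin_weak_topology)
      show "restrict h F \<in> restrict_functions K F"
        unfolding restrict_functions_def by (rule imageI[OF h(1)])
      show "openin (mtopology_of M) (mball_of M (h x) d)"
        by (simp add: mball_of_def mtopology_of_def Metric_space.openin_mball)
    qed
    moreover have "x \<in> ?W" using x d(1) F K_in[OF h(1)] by (auto simp: mdist_self)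
    moreover have "?W \<subseteq> {x\<in>F. \<phi> x \<in> U}"
    proof
      fix y assume y: "y \<in> ?W"
      then have "\<bar>\<phi> x - \<phi> y\<bar> < d" using \<phi>_lip[of x y] x by auto
      then have "\<phi> y \<in> ball (\<phi> x) d" by (simp add: dist_real_def)
      then show "y \<in> {x\<in>F. \<phi> x \<in> U}" using y d(2) by auto
    qed
    ultimately show "\<exists>T. openin ?T T \<and> x \<in> T \<and> T \<subseteq> {x\<in>F. \<phi> x \<in> U}" by blast
  qed
  then show "continuous_map ?T euclideanreal \<phi>"
    by (simp add: continuous_map_def)
qed

text \<open>Truncated distances to points of \<open>M\<close> reduce the claim to real functions,
  for which nonempty open sets of small oscillation exist inside every nonempty open set. Category
  then intersects over all errors.\<close>

lemma Lindelof_imp_almost_equicontinuous: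
  assumes X: "Cech_complete_space X" and G: "\<And>g. g \<in> G \<Longrightarrow> continuous_map X (mtopology_of M) g"
    and GK: "G \<subseteq> pointwise_closure X M G"
    and K: "compactin (pointwise_topology (topspace X) M) (pointwise_closure X M G)"
    and L: "Lindelof_on_dense_gdelta X M G"
  shows "almost_equicontinuous X M G"
proof -
  let ?K = "pointwise_closure X M G" and ?O = "small_oscillation_set X M G"
  obtain F where F: "dense_in X F" "gdelta_in X F"
    and T: "Lindelof_space (weak_topology F (restrict_functions ?K F) (mtopology_of M))"
    using L unfolding Lindelof_on_dense_gdelta_def by blast
  let ?T = "weak_topology F (restrict_functions ?K F) (mtopology_of M)"
  have FX: "F \<subseteq> topspace X" using F(1) by (simp add: dense_in_def)
  have G_in: "g x \<in> mspace M" if "g \<in> G" "x \<in> topspace X" for g x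
    using continuous_map_image_subset_topspace[OF G[OF that(1)]] that(2) by auto
  have "dense_in X (?O n)" for n
  proof (rule dense_inI)
    show "?O n \<subseteq> topspace X" by (rule openin_subset) simp
    fix V assume V: "openin X V" "V \<noteq> {}"
    have "\<exists>W. openin X W \<and> W \<noteq> {} \<and> W \<subseteq> V \<and> oscillation_le M G W (1 / Suc n)"
    proof (cases "G = {}")
      case True
      then show ?thesis using V by (auto simp: oscillation_le_def)
    next
      case False
      then obtain g0 where g0: "g0 \<in> G" by blast
      obtain x0 where x0: "x0 \<in> topspace X" using V openin_subset by blast
      \<comment> \<open>Indices are arbitrary pairs of a function and a value; default members of
        \<open>G\<close> and \<open>M\<close> make \<open>g\<close> and \<open>p\<close>
        total.\<close>
      define g where "g i = (if fst i \<in> G then fst i else g0)" for i :: "('a \<Rightarrow> 'b) \<times> 'b"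
      define p where "p i = (if snd i \<in> mspace M then snd i else g0 x0)" for i :: "('a \<Rightarrow> 'b) \<times> 'b"
      have g: "g i \<in> G" and p: "p i \<in> mspace M" for i
        using g0 x0 G_in by (simp_all add: g_def p_def)
      define f where "f i x = min 1 (mdist M (g i x) (p i))" for i x
      \<comment> \<open>A bound below 1 is needed so that truncation at 1 can be undone at the
        end.\<close>
      define e where "e = 1 / (2 * Suc n)"
      have e: "0 < e" "e < 1" "e \<le> 1 / Suc n" by (simp_all add: e_def field_simps)
      have "\<exists>W. openin X W \<and> W \<noteq> {} \<and> W \<subseteq> V \<and> (\<forall>i. \<forall>x\<in>W. \<forall>y\<in>W. \<bar>f i x - f i y\<bar> \<le> e)"
      proof (rule small_oscillation_on_open[of X ?T f V e])
        show "limits_continuous ?T f"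
          unfolding f_def[abs_def] using g GK p
          by (intro limits_continuous_weak_topology[OF K FX]) auto
        show "continuous_map X euclideanreal (f i)" for i
        proof -
          have "continuous_map X (mtopology_of M) (\<lambda>x. p i)" using p by simp
          from continuous_map_mdist[OF G[OF g] this]
          have "continuous_map X euclideanreal (\<lambda>x. mdist M (g i x) (p i))" .
          then show ?thesis unfolding f_def[abs_def] by (intro continuous_map_real_min) simp_all
        qed
      qed (use X F T V e in \<open>auto simp: f_def\<close>)
      then obtain W where W: "openin X W" "W \<noteq> {}" "W \<subseteq> V"
        "\<forall>i. \<forall>x\<in>W. \<forall>y\<in>W. \<bar>f i x - f i y\<bar> \<le> e" by blast
      have "mdist M (h x) (h y) \<le> 1 / Suc n" if h: "h \<in> G" and xy: "x \<in> W" "y \<in> W" for h x y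
      proof -
        have in_M: "h x \<in> mspace M" using G_in[OF h] xy(1) openin_subset[OF W(1)] by blast
        \<comment> \<open>Choosing \<open>h x\<close> itself as reference point makes the first
          value zero, so the second is the truncated distance from \<open>h y\<close> to
          \<open>h x\<close>.\<close>
        have "\<bar>f (h, h x) x - f (h, h x) y\<bar> \<le> e" using W(4) xy by blast
        then have "min 1 (mdist M (h y) (h x)) \<le> e"
          using h in_M by (simp add: f_def g_def p_def mdist_self)
        then show ?thesis using e by (simp add: min_def mdist_commute split: if_splits)
      qed
      then show ?thesis using W by (intro exI[of _ W]) (simp add: oscillation_le_def)
    qed
    then show "V \<inter> ?O n \<noteq> {}" unfolding small_oscillation_set_def by blast
  qed
  then have "dense_in X (topspace X \<inter> (\<Inter>n. ?O n))"
    by (intro Cech_complete_dense_INT[OF X]) simp_all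
  then show ?thesis
    unfolding almost_equicontinuous_def equicontinuity_points_eq .
qed

theorem theoremA:
  fixes X :: "'a topology" and M :: "'b metric" and G :: "('a \<Rightarrow> 'b) set"
  assumes "Cech_complete_space X"
    and "separable_space (mtopology_of M)"
    and "G \<subseteq> continuous_functions X (mtopology_of M)"
    and "compactin (pointwise_topology (topspace X) M) (pointwise_closure X M G)"
  shows "(metrizable_on_dense_Baire X M G \<longrightarrow> Lindelof_on_dense_gdelta X M G) \<and>
         (Lindelof_on_dense_gdelta X M G \<longrightarrow> almost_equicontinuous X M G) \<and>
         (hereditarily Lindelof_space X \<longrightarrow>
            (almost_equicontinuous X M G \<longleftrightarrow> metrizable_on_dense_Baire X M G) \<and>
            (metrizable_on_dense_Baire X M G \<longleftrightarrow> Lindelof_on_dense_gdelta X M G))"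
proof -
  let ?K = "pointwise_closure X M G"
  define E where "E = {x. equicontinuity_point X M G x}"
  have E: "E = topspace X \<inter> (\<Inter>n. small_oscillation_set X M G n)"
    unfolding E_def by (rule equicontinuity_points_eq)
  then have EX: "E \<subseteq> topspace X" by blast
  have G: "continuous_map X (mtopology_of M) g" if "g \<in> G" for g
    using assms(3) that by (auto simp: continuous_functions_def)
  have "G \<subseteq> topspace (pointwise_topology (topspace X) M)"
  proof
    fix g assume g: "g \<in> G"
    then have "g \<in> extensional (topspace X)" using assms(3) by (auto simp: continuous_functions_def)
    then show "g \<in> topspace (pointwise_topology (topspace X) M)"
      using continuous_map_image_subset_topspace[OF G[OF g]] by (auto simp: PiE_def)
  qed
  then have GK: "G \<subseteq> ?K" unfolding pointwise_closure_def by (rule closure_of_subset)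
  \<comment> \<open>The Lindelof set in (c) is the set \<open>E\<close> of equicontinuity points
    rather than the Baire set given by (b).\<close>
  have b_c: "Lindelof_on_dense_gdelta X M G" if "dense_in X E" "uniformly_separable M ?K E"
  proof -
    have "Lindelof_space (weak_topology E (restrict_functions ?K E) (mtopology_of M))"
    proof (rule uniformly_separable_imp_Lindelof[OF _ that(2)])
      show "h x \<in> mspace M" if "h \<in> ?K" "x \<in> E" for h x
        using pointwise_closure_in_mspace[OF that(1)] that(2) EX by auto
    qed
    then show ?thesis
      using that(1) gdelta_in_equicontinuity_points[of X M G]
      unfolding Lindelof_on_dense_gdelta_def E_def by blast
  qed
  have bc: "Lindelof_on_dense_gdelta X M G" if b: "metrizable_on_dense_Baire X M G"
  proof -
    obtain F where F: "dense_in X F" "Baire_space (subtopology X F)"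
      "metrizable_space (subtopology (pointwise_topology F M) (restrict_functions ?K F))"
      using b unfolding metrizable_on_dense_Baire_def by blast
    have FX: "F \<subseteq> topspace X" using F(1) by (simp add: dense_in_def)
    have "dense_in X E \<and> uniformly_separable M ?K E"
      by (rule Baire_imp_uniformly_separable[OF G GK F(1,2) countable_keys[OF assms(4) FX assms(2) _ F(3)] E_def])
    then show ?thesis using b_c by simp
  qed
  have ca: "almost_equicontinuous X M G" if "Lindelof_on_dense_gdelta X M G"
    by (rule Lindelof_imp_almost_equicontinuous[OF assms(1) G GK assms(4) that])
  \<comment> \<open>The set \<open>E\<close> also serves as the Baire set in (b): it is a dense
    G-delta in a Cech-complete space.\<close>
  have ab: "metrizable_on_dense_Baire X M G"
    if "hereditarily Lindelof_space X" and a: "almost_equicontinuous X M G"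
  proof -
    have dense: "dense_in X E" using a by (simp add: almost_equicontinuous_def E_def)
    have "uniformly_separable M ?K E"
      by (rule hereditarily_Lindelof_imp_uniformly_separable[OF that(1) E_def])
    then have "metrizable_space (subtopology (pointwise_topology E M) (restrict_functions ?K E))"
      by (rule uniformly_separable_imp_metrizable[OF assms(4) EX])
    moreover have "Baire_space (subtopology X E)"
      by (rule Baire_space_dense_gdelta[OF assms(1) E _ dense]) simp
    ultimately show ?thesis using dense unfolding metrizable_on_dense_Baire_def by blast
  qed
  \<comment> \<open>For hereditarily Lindelof \<open>X\<close> the cycle from (b) to (c) to (a) and
    back to (b) is closed.\<close>
  show ?thesis using bc ca ab by blast
qed

end
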